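(* Let $\mu\in\{+1,-1\}$ and $p\ge 7$. For $0<\alpha<\infty$ let $\mathscr{L}_\alpha$ be the operator on $l^2(\mathbb{Z})$ given by $(\mathscr{L}_\alpha f)_n=\sum_{m\ne n}\frac{f_n-f_m}{|n-m|^{1+\alpha}}$, let $\mathscr{L}_\infty=\mathscr{L}=-\delta^2$, i.e. $(\mathscr{L}f)_n=2f_n-f_{n+1}-f_{n-1}$, and put $U^{(\alpha)}(t)=e^{-it\mathscr{L}_\alpha}$, $U(t)=U^{(\infty)}(t)=e^{-it\mathscr{L}}$. For $f\in l^2(\mathbb{Z})$ and $0<\alpha\le\infty$ let $u^{(\alpha)}\in C^1_{loc}(\mathbb{R};l^2(\mathbb{Z}))$ be the unique global solution of $$i\dot u^{(\alpha)}_n=(\mathscr{L}_\alpha u^{(\alpha)})_n+\mu|u^{(\alpha)}_n|^{p-1}u^{(\alpha)}_n,\qquad u^{(\alpha)}(0)=f,$$ and write $v=u^{(\infty)}$. Then there exists $\tilde\alpha>0$ such that the following hold. (1) For all $\tilde\alpha<\alpha<\infty$, the data-to-asymptotic-state map $f\mapsto u_+^{(\alpha)}$ is well-defined as an isometric homeomorphism in a small neighborhood of $l^2(\mathbb{Z})$, uniformly in $\tilde\alpha<\alpha\le\infty$. More precisely, there exists $\delta_1=\delta_1(\tilde\alpha)>0$ such that whenever $\|f\|_{l^2}<\delta_1$, there exists a unique $u_+^{(\alpha)}\in l^2(\mathbb{Z})$ with $$\|u^{(\alpha)}(t)-U^{(\alpha)}(t)u_+^{(\alpha)}\|_{l^2}\to0\quad\text{as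 }t\to\infty .$$ (2) There exists $\delta_2=\delta_2(\tilde\alpha)>0$ such that whenever $0<\|f\|_{l^{5/4}}<\delta_2$, one has $$\|u^{(\alpha)}(t)\|_{l^5}\le C(\tilde\alpha)(1+|t|)^{-1/5}\|f\|_{l^{5/4}},$$ and $$\inf_{\alpha>\tilde\alpha}\ \sup_{t\in[0,\infty)}\|u^{(\alpha)}(t)-v(t)\|_{l^2}>0.$$
   Context: Here $l^q=l^q(\mathbb{Z})$ denotes complex-valued sequences. The operators $\mathscr{L}_\alpha$ ($0<\alpha\le\infty$) are bounded and self-adjoint on $l^2(\mathbb{Z})$, and the initial value problems are globally well-posed in $l^2(\mathbb{Z})$. In (1) and in the decay estimate of (2), $\alpha$ ranges over $\tilde\alpha<\alpha\le\infty$, and $\delta_1,\delta_2,C(\tilde\alpha)$ do not depend on $\alpha$ in that range; in the last display the infimum is over finite $\alpha>\tilde\alpha$. *)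

theory Defs
  imports "HOL-Analysis.Analysis"
begin

section \<open>Sequence spaces\<close>

definition in_lq :: "real \<Rightarrow> (int \<Rightarrow> complex) \<Rightarrow> bool" where
  "in_lq q f \<longleftrightarrow> (\<lambda>n. cmod (f n) powr q) summable_on UNIV"

text \<open>Meaningful only together with \<^const>\<open>in_lq\<close>: \<^const>\<open>infsum\<close> is 0 on non-summable families.\<close>

definition lq_norm :: "real \<Rightarrow> (int \<Rightarrow> complex) \<Rightarrow> real" where
  "lq_norm q f = (\<Sum>\<^sub>\<infinity>n. cmod (f n) powr q) powr (1 / q)"

lemma in_l2_iff: "in_lq 2 f \<longleftrightarrow> (\<lambda>n. (cmod (f n))\<^sup>2) summable_on UNIV"
  by (simp add: in_lq_def)

lemma in_l2_add:
  assumes "in_lq 2 f" "in_lq 2 g"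
  shows "in_lq 2 (\<lambda>n. f n + g n)"
  unfolding in_l2_iff
proof (rule summable_on_comparison_test)
  show "(\<lambda>n. 2 * (cmod (f n))\<^sup>2 + 2 * (cmod (g n))\<^sup>2) summable_on UNIV"
    using assms unfolding in_l2_iff by (intro summable_on_add summable_on_cmult_right)
  fix n
  have "(cmod (f n + g n))\<^sup>2 \<le> (cmod (f n) + cmod (g n))\<^sup>2"
    by (intro power_mono norm_triangle_ineq) auto
  also have "\<dots> \<le> 2 * (cmod (f n))\<^sup>2 + 2 * (cmod (g n))\<^sup>2"
    using sum_squares_bound[of "cmod (f n)" "cmod (g n)"] by (simp add: power2_sum)
  finally show "(cmod (f n + g n))\<^sup>2 \<le> 2 * (cmod (f n))\<^sup>2 + 2 * (cmod (g n))\<^sup>2" .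
qed auto

lemma in_l2_mult: "in_lq 2 f \<Longrightarrow> in_lq 2 (\<lambda>n. c * f n)"
  unfolding in_l2_iff by (auto simp: norm_mult power_mult_distrib intro: summable_on_cmult_right)

typedef l2 = "{f :: int \<Rightarrow> complex. in_lq 2 f}"
  morphisms seq Abs_l2
  by (rule exI[of _ "\<lambda>_. 0"]) (simp add: in_l2_iff)

setup_lifting type_definition_l2

lemma in_l2_seq [simp]: "in_lq 2 (seq f)"
  using seq by simp

lemma l2_eqI: "(\<And>n. seq f n = seq g n) \<Longrightarrow> f = g"
  by (metis ext seq_inject)

lift_definition scaleC :: "complex \<Rightarrow> l2 \<Rightarrow> l2" is "\<lambda>c f n. c * f n"
  by (rule in_l2_mult)

lemma inner_summable:
  assumes "in_lq 2 f" "in_lq 2 g"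
  shows "(\<lambda>n. f n \<bullet> g n) summable_on UNIV"
proof -
  have "(\<lambda>n. norm (f n \<bullet> g n)) summable_on UNIV"
  proof (rule summable_on_comparison_test)
    show "(\<lambda>n. (cmod (f n))\<^sup>2 + (cmod (g n))\<^sup>2) summable_on UNIV"
      using assms unfolding in_l2_iff by (intro summable_on_add)
    fix n
    have "norm (f n \<bullet> g n) \<le> cmod (f n) * cmod (g n)"
      using Cauchy_Schwarz_ineq2 by simp
    also have "\<dots> \<le> 2 * cmod (f n) * cmod (g n)"
      by simp
    also have "\<dots> \<le> (cmod (f n))\<^sup>2 + (cmod (g n))\<^sup>2"
      by (rule sum_squares_bound)
    finally show "norm (f n \<bullet> g n) \<le> (cmod (f n))\<^sup>2 + (cmod (g n))\<^sup>2" .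
  qed auto
  then show ?thesis
    using summable_on_iff_abs_summable_on_real by blast
qed

instantiation l2 :: real_inner
begin

lift_definition zero_l2 :: l2 is "\<lambda>_. 0"
  by (simp add: in_l2_iff)
lift_definition plus_l2 :: "l2 \<Rightarrow> l2 \<Rightarrow> l2" is "\<lambda>f g n. f n + g n"
  by (rule in_l2_add)
lift_definition uminus_l2 :: "l2 \<Rightarrow> l2" is "\<lambda>f n. - f n"
  by (simp add: in_l2_iff)
lift_definition minus_l2 :: "l2 \<Rightarrow> l2 \<Rightarrow> l2" is "\<lambda>f g n. f n - g n"
proof -
  fix f g :: "int \<Rightarrow> complex"
  assume "in_lq 2 f" "in_lq 2 g"
  then have "in_lq 2 (\<lambda>n. f n + (- 1) * g n)"
    by (intro in_l2_add in_l2_mult)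
  then show "in_lq 2 (\<lambda>n. f n - g n)" by simp
qed
lift_definition scaleR_l2 :: "real \<Rightarrow> l2 \<Rightarrow> l2" is "\<lambda>r f n. r *\<^sub>R f n"
  using in_l2_mult by (simp add: scaleR_conv_of_real)

text \<open>The real inner product of the underlying real Hilbert space; \<open>\<bullet>\<close> on complex
  numbers is \<open>Re (z * cnj w)\<close>.\<close>

definition inner_l2 :: "l2 \<Rightarrow> l2 \<Rightarrow> real" where
  "inner_l2 f g = (\<Sum>\<^sub>\<infinity>n. seq f n \<bullet> seq g n)"
definition norm_l2 :: "l2 \<Rightarrow> real" where
  "norm_l2 f = lq_norm 2 (seq f)"
definition sgn_l2 :: "l2 \<Rightarrow> l2" where
  "sgn_l2 f = inverse (norm f) *\<^sub>R f"
definition dist_l2 :: "l2 \<Rightarrow> l2 \<Rightarrow> real" where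
  "dist_l2 f g = norm (f - g)"
definition uniformity_l2 :: "(l2 \<times> l2) filter" where
  "uniformity_l2 = (INF e\<in>{0<..}. principal {(x, y). dist x y < e})"
definition open_l2 :: "l2 set \<Rightarrow> bool" where
  "open_l2 U \<longleftrightarrow> (\<forall>x\<in>U. \<forall>\<^sub>F (x', y) in uniformity. x' = x \<longrightarrow> y \<in> U)"

instance
proof
  fix f g h :: l2 and r s :: real
  show "f + g + h = f + (g + h)" by transfer (simp add: add.assoc)
  show "f + g = g + f" by transfer (simp add: add.commute)
  show "0 + f = f" by transfer simp
  show "- f + f = 0" by transfer simp
  show "f - g = f + - g" by transfer simp
  show "r *\<^sub>R (f + g) = r *\<^sub>R f + r *\<^sub>R g" by transfer (simp add: scaleR_add_right)
  show "(r + s) *\<^sub>R f = r *\<^sub>R f + s *\<^sub>R f" by transfer (simp add: scaleR_add_left)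
  show "r *\<^sub>R s *\<^sub>R f = (r * s) *\<^sub>R f" by transfer simp
  show "1 *\<^sub>R f = f" by transfer simp
  show "sgn f = inverse (norm f) *\<^sub>R f" by (rule sgn_l2_def)
  show "dist f g = norm (f - g)" by (rule dist_l2_def)
  show "uniformity = (INF e\<in>{0<..}. principal {(x :: l2, y). dist x y < e})"
    by (rule uniformity_l2_def)
  show "open U \<longleftrightarrow> (\<forall>x\<in>U. \<forall>\<^sub>F (x', y) in uniformity. x' = x \<longrightarrow> y \<in> U)" for U :: "l2 set"
    by (rule open_l2_def)
  show "inner f g = inner g f"
    by (simp add: inner_l2_def inner_commute)
  show "inner (f + g) h = inner f h + inner g h"
    by (simp add: inner_l2_def plus_l2.rep_eq inner_add_left infsum_add inner_summable)
  show "inner (r *\<^sub>R f) g = r * inner f g"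
    by (simp add: inner_l2_def scaleR_l2.rep_eq infsum_cmult_right')
  show "0 \<le> inner f f"
    by (simp add: inner_l2_def infsum_nonneg)
  show "inner f f = 0 \<longleftrightarrow> f = 0"
  proof
    assume *: "inner f f = 0"
    have "seq f n \<bullet> seq f n = 0" for n
      by (rule nonneg_infsum_le_0D[where A = UNIV and f = "\<lambda>n. seq f n \<bullet> seq f n"])
         (use * in \<open>auto simp: inner_l2_def inner_summable\<close>)
    then show "f = 0" by (intro l2_eqI) (simp add: zero_l2.rep_eq)
  qed (simp add: inner_l2_def zero_l2.rep_eq)
  show "norm f = sqrt (inner f f)"
    by (simp add: norm_l2_def lq_norm_def inner_l2_def powr_half_sqrt infsum_nonneg
        flip: power2_norm_eq_inner)
qed

end

lemma norm_l2_sq: "(norm (f :: l2))\<^sup>2 = (\<Sum>\<^sub>\<infinity>n. (cmod (seq f n))\<^sup>2)"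
  by (simp add: power2_norm_eq_inner inner_l2_def)

lemma sum_le_norm_l2:
  assumes "finite F"
  shows "(\<Sum>n\<in>F. (cmod (seq f n))\<^sup>2) \<le> (norm f)\<^sup>2"
  unfolding norm_l2_sq using assms in_l2_seq[of f]
  by (intro finite_sum_le_infsum) (auto simp: in_l2_iff)

lemma norm_l2_leI:
  assumes "\<And>F. finite F \<Longrightarrow> (\<Sum>n\<in>F. (cmod (seq f n))\<^sup>2) \<le> e\<^sup>2" "0 \<le> e"
  shows "norm f \<le> e"
proof -
  have "(norm f)\<^sup>2 \<le> e\<^sup>2"
    unfolding norm_l2_sq using assms in_l2_seq[of f]
    by (intro infsum_le_finite_sums) (auto simp: in_l2_iff)
  then show ?thesis using assms(2) by (simp add: power2_le_iff_abs_le)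
qed

lemma seq_le_norm: "cmod (seq f n) \<le> norm f"
  using sum_le_norm_l2[of "{n}" f] by (simp add: power2_le_iff_abs_le)

lemma bounded_linear_seq: "bounded_linear (\<lambda>f. seq f n)"
  by (rule bounded_linear_intro[where K = 1])
     (auto simp: plus_l2.rep_eq scaleR_l2.rep_eq seq_le_norm)

instance l2 :: banach
proof
  fix X :: "nat \<Rightarrow> l2"
  assume X: "Cauchy X"
  have "Cauchy (\<lambda>k. seq (X k) n)" for n
    using bounded_linear.Cauchy[OF bounded_linear_seq X] .
  then have "\<exists>l. (\<lambda>k. seq (X k) n) \<longlonglongrightarrow> l" for n
    using Cauchy_convergent_iff convergent_def by blast
  then obtain g where g: "\<And>n. (\<lambda>k. seq (X k) n) \<longlonglongrightarrow> g n"
    by metis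
  have key: "\<exists>N. \<forall>m\<ge>N. \<forall>F. finite F \<longrightarrow> (\<Sum>n\<in>F. (cmod (seq (X m) n - g n))\<^sup>2) \<le> e\<^sup>2"
    if e: "e > 0" for e
  proof -
    obtain N where N: "\<And>m k. m \<ge> N \<Longrightarrow> k \<ge> N \<Longrightarrow> norm (X m - X k) < e"
      using CauchyD[OF X e] by blast
    have "(\<Sum>n\<in>F. (cmod (seq (X m) n - g n))\<^sup>2) \<le> e\<^sup>2" if m: "m \<ge> N" and F: "finite F" for m F
    proof (rule LIMSEQ_le_const2)
      show "(\<lambda>k. \<Sum>n\<in>F. (cmod (seq (X m) n - seq (X k) n))\<^sup>2)
          \<longlonglongrightarrow> (\<Sum>n\<in>F. (cmod (seq (X m) n - g n))\<^sup>2)"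
        by (intro tendsto_intros g)
      have "(\<Sum>n\<in>F. (cmod (seq (X m) n - seq (X k) n))\<^sup>2) \<le> e\<^sup>2" if "k \<ge> N" for k
      proof -
        have "(\<Sum>n\<in>F. (cmod (seq (X m) n - seq (X k) n))\<^sup>2) \<le> (norm (X m - X k))\<^sup>2"
          using sum_le_norm_l2[OF F, of "X m - X k"] by (simp add: minus_l2.rep_eq)
        also have "\<dots> \<le> e\<^sup>2"
          using N[OF m that] by (intro power_mono) auto
        finally show ?thesis .
      qed
      then show "\<exists>K. \<forall>k\<ge>K. (\<Sum>n\<in>F. (cmod (seq (X m) n - seq (X k) n))\<^sup>2) \<le> e\<^sup>2"
        by blast
    qed
    then show ?thesis by blast
  qed
  obtain N where "\<And>F. finite F \<Longrightarrow> (\<Sum>n\<in>F. (cmod (seq (X N) n - g n))\<^sup>2) \<le> 1\<^sup>2"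
    using key[of 1] by auto
  then have d: "in_lq 2 (\<lambda>n. seq (X N) n - g n)"
    unfolding in_l2_iff
    by (intro nonneg_bdd_above_summable_on) (auto intro!: bdd_aboveI2)
  have "in_lq 2 (\<lambda>n. seq (X N) n + (- 1) * (seq (X N) n - g n))"
    by (intro in_l2_add in_l2_mult d in_l2_seq)
  then have sg: "seq (Abs_l2 g) = g"
    by (simp add: Abs_l2_inverse)
  have "X \<longlonglongrightarrow> Abs_l2 g"
  proof (rule LIMSEQ_I)
    fix r :: real assume r: "0 < r"
    then obtain M where M: "\<And>m F. m \<ge> M \<Longrightarrow> finite F \<Longrightarrow>
        (\<Sum>n\<in>F. (cmod (seq (X m) n - g n))\<^sup>2) \<le> (r / 2)\<^sup>2"
      using key[of "r / 2"] by auto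
    have "norm (X m - Abs_l2 g) < r" if "m \<ge> M" for m
    proof -
      have "norm (X m - Abs_l2 g) \<le> r / 2"
        by (rule norm_l2_leI) (use M[OF that] r in \<open>auto simp: minus_l2.rep_eq sg\<close>)
      then show ?thesis using r by simp
    qed
    then show "\<exists>no. \<forall>n\<ge>no. norm (X n - Abs_l2 g) < r" by blast
  qed
  then show "convergent X" by (auto simp: convergent_def)
qed

lemma norm_scaleC: "norm (scaleC c f) = cmod c * norm f"
proof -
  have "(norm (scaleC c f))\<^sup>2 = (cmod c * norm f)\<^sup>2"
    by (simp add: norm_l2_sq scaleC.rep_eq norm_mult power_mult_distrib infsum_cmult_right')
  then show ?thesis by (simp add: power2_eq_iff_nonneg)
qed


section \<open>The operators and their propagators\<close>

text \<open>The order \<open>\<alpha>\<close> ranges over the extended reals, \<open>\<alpha> = \<infinity>\<close> being the nearest-neighbour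
  Laplacian. Only \<open>\<alpha> > 0\<close> is meaningful.\<close>

definition lap_seq :: "ereal \<Rightarrow> (int \<Rightarrow> complex) \<Rightarrow> int \<Rightarrow> complex" where
  "lap_seq \<alpha> f n =
    (if \<alpha> = \<infinity> then 2 * f n - f (n + 1) - f (n - 1)
     else \<Sum>\<^sub>\<infinity>m\<in>-{n}. (f n - f m) / of_real (of_int \<bar>n - m\<bar> powr (1 + real_of_ereal \<alpha>)))"

definition lap :: "ereal \<Rightarrow> l2 \<Rightarrow> l2" where
  "lap \<alpha> f = Abs_l2 (lap_seq \<alpha> (seq f))"

text \<open>The exponential series of the bounded operator \<open>-i t L\<close>, applied to \<open>f\<close> and summed in
  \<^typ>\<open>l2\<close> (the class \<^class>\<open>real_normed_algebra_1\<close> required by \<^const>\<open>exp\<close> is not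
  available for operators).\<close>

definition propagator :: "ereal \<Rightarrow> real \<Rightarrow> l2 \<Rightarrow> l2" where
  "propagator \<alpha> t f = (\<Sum>k. scaleC ((- \<i> * of_real t) ^ k / fact k) ((lap \<alpha> ^^ k) f))"

text \<open>The junk value of \<^const>\<open>Abs_l2\<close> outside \<open>l2\<close> never occurs for \<open>\<alpha> > 0\<close>, and the
  exponential series converges.\<close>

definition shift :: "int \<Rightarrow> l2 \<Rightarrow> l2" where
  "shift j f = Abs_l2 (\<lambda>n. seq f (n - j))"

lemma bij_minus_int: "bij (\<lambda>n. n - j :: int)"
  by (rule bij_betw_byWitness[where f' = "\<lambda>n. n + j"]) auto

lemma seq_shift: "seq (shift j f) = (\<lambda>n. seq f (n - j))"
proof -
  have "in_lq 2 (\<lambda>n. seq f (n - j))"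
    unfolding in_l2_iff
    using summable_on_reindex_bij_betw[OF bij_minus_int, of "\<lambda>n. (cmod (seq f n))\<^sup>2" j]
      in_l2_seq[of f] by (simp add: in_l2_iff)
  then show ?thesis by (simp add: shift_def Abs_l2_inverse)
qed

lemma norm_shift: "norm (shift j f) = norm f"
proof -
  have "(norm (shift j f))\<^sup>2 = (norm f)\<^sup>2"
    unfolding norm_l2_sq seq_shift
    using infsum_reindex_bij_betw[OF bij_minus_int, of "\<lambda>n. (cmod (seq f n))\<^sup>2" j] by simp
  then show ?thesis by (simp add: power2_eq_iff_nonneg)
qed

lemma kernel_summable:
  fixes a :: real
  assumes "a > 0"
  shows "(\<lambda>j::int. of_int \<bar>j\<bar> powr - (1 + a)) summable_on UNIV"
proof -
  let ?K = "\<lambda>j::int. real_of_int \<bar>j\<bar> powr - (1 + a)"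
  have "summable (\<lambda>n. of_nat n powr - (1 + a) :: real)"
    using assms by (subst summable_real_powr_iff) auto
  then have nat: "(\<lambda>n::nat. real n powr - (1 + a)) summable_on UNIV"
    by (intro norm_summable_imp_summable_on) simp
  have "?K summable_on (range int)"
    by (subst summable_on_reindex) (use nat in \<open>auto simp: o_def\<close>)
  moreover have "?K summable_on (range (\<lambda>n. - int n))"
    by (subst summable_on_reindex) (use nat in \<open>auto simp: o_def inj_on_def\<close>)
  ultimately have "?K summable_on (range int \<union> range (\<lambda>n. - int n))"
    by (rule summable_on_union)
  moreover have "range int \<union> range (\<lambda>n. - int n) = UNIV"
    by (auto simp: image_iff) (metis int_cases2)
  ultimately show ?thesis by simp
qed

lemma lap_bounded:
  assumes "\<alpha> > 0"
  shows "\<exists>C\<ge>0. \<forall>f. seq (lap \<alpha> f) = lap_seq \<alpha> (seq f) \<and> norm (lap \<alpha> f) \<le> C * norm f"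
proof (cases "\<alpha> = \<infinity>")
  case True
  have "seq (lap \<alpha> f) = lap_seq \<alpha> (seq f) \<and> norm (lap \<alpha> f) \<le> 4 * norm f" for f
  proof -
    let ?g = "2 *\<^sub>R f - shift (- 1) f - shift 1 f"
    have eq: "lap_seq \<alpha> (seq f) = seq ?g"
      by (auto simp: lap_seq_def True minus_l2.rep_eq scaleR_l2.rep_eq seq_shift scaleR_conv_of_real)
    have "norm ?g \<le> norm (2 *\<^sub>R f) + norm (shift (- 1) f) + norm (shift 1 f)"
      by (meson add_right_mono norm_triangle_ineq4 order_trans)
    then show ?thesis by (simp add: lap_def eq seq_inverse norm_shift)
  qed
  then show ?thesis by (intro exI[of _ 4]) auto
next
  case False
  define a where "a = real_of_ereal \<alpha>"
  have a: "a > 0"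
    using assms False unfolding a_def by (cases \<alpha>) auto
  define K where "K j = real_of_int \<bar>j\<bar> powr - (1 + a)" for j
  have K: "K summable_on UNIV"
    unfolding K_def by (rule kernel_summable[OF a])
  have "seq (lap \<alpha> f) = lap_seq \<alpha> (seq f) \<and> norm (lap \<alpha> f) \<le> (\<Sum>\<^sub>\<infinity>j. K j) * 2 * norm f" for f
  proof -
    let ?h = "\<lambda>j. K j *\<^sub>R (f - shift j f)"
    have bd: "norm (?h j) \<le> K j * (2 * norm f)" for j
    proof -
      have "norm (f - shift j f) \<le> 2 * norm f"
        using norm_triangle_ineq4[of f "shift j f"] by (simp add: norm_shift)
      then show ?thesis by (simp add: K_def mult_left_mono)
    qed
    have K2: "(\<lambda>j. K j * (2 * norm f)) summable_on UNIV"
      using K by (rule summable_on_cmult_left)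
    have abs: "(\<lambda>j. norm (?h j)) summable_on UNIV"
      by (rule Infinite_Sum.abs_summable_on_comparison_test'[OF K2]) (use bd in auto)
    have sm: "?h summable_on UNIV"
      using abs by (rule abs_summable_summable)
    have eq: "lap_seq \<alpha> (seq f) = seq (\<Sum>\<^sub>\<infinity>j. ?h j)"
    proof
      fix n
      have "((\<lambda>j. seq (?h j) n) has_sum seq (\<Sum>\<^sub>\<infinity>j. ?h j) n) UNIV"
        by (rule has_sum_bounded_linear[OF bounded_linear_seq]) (use sm in simp)
      then have "seq (\<Sum>\<^sub>\<infinity>j. ?h j) n = (\<Sum>\<^sub>\<infinity>j. K j *\<^sub>R (seq f n - seq f (n - j)))"
        by (simp add: infsumI scaleR_l2.rep_eq minus_l2.rep_eq seq_shift)
      also have "\<dots> = (\<Sum>\<^sub>\<infinity>m. K (n - m) *\<^sub>R (seq f n - seq f m))"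
      proof -
        have "bij (\<lambda>m. n - m)"
          by (rule bij_betw_byWitness[where f' = "\<lambda>m. n - m"]) auto
        from infsum_reindex_bij_betw[OF this, of "\<lambda>j. K j *\<^sub>R (seq f n - seq f (n - j))"]
        show ?thesis by simp
      qed
      also have "\<dots> = (\<Sum>\<^sub>\<infinity>m\<in>-{n}. K (n - m) *\<^sub>R (seq f n - seq f m))"
        by (rule infsum_cong_neutral) auto
      also have "\<dots> = lap_seq \<alpha> (seq f) n"
        using False
        by (simp add: lap_seq_def K_def a_def powr_minus [of _ "1 + real_of_ereal \<alpha>", simplified]
            scaleR_conv_of_real divide_inverse mult.commute flip: of_real_inverse)
      finally show "lap_seq \<alpha> (seq f) n = seq (\<Sum>\<^sub>\<infinity>j. ?h j) n" by simp
    qed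
    have "norm (\<Sum>\<^sub>\<infinity>j. ?h j) \<le> (\<Sum>\<^sub>\<infinity>j. norm (?h j))"
      by (rule norm_infsum_bound[OF abs])
    also have "\<dots> \<le> (\<Sum>\<^sub>\<infinity>j. K j * (2 * norm f))"
      by (rule infsum_mono[OF abs K2 bd])
    also have "\<dots> = (\<Sum>\<^sub>\<infinity>j. K j) * 2 * norm f"
      by (simp add: infsum_cmult_left')
    finally show ?thesis by (simp add: lap_def eq seq_inverse)
  qed
  moreover have "(\<Sum>\<^sub>\<infinity>j. K j) * 2 \<ge> 0"
    by (simp add: infsum_nonneg K_def)
  ultimately show ?thesis by blast
qed

lemma seq_lap: "\<alpha> > 0 \<Longrightarrow> seq (lap \<alpha> f) = lap_seq \<alpha> (seq f)"
  using lap_bounded by blast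

lemma summable_propagator:
  assumes "\<alpha> > 0"
  shows "summable (\<lambda>k. scaleC ((- \<i> * of_real t) ^ k / fact k) ((lap \<alpha> ^^ k) f))"
proof -
  obtain C where C: "C \<ge> 0" "\<And>g. norm (lap \<alpha> g) \<le> C * norm g"
    using lap_bounded[OF assms] by blast
  have pow: "norm ((lap \<alpha> ^^ k) f) \<le> C ^ k * norm f" for k
  proof (induction k)
    case (Suc k)
    have "norm ((lap \<alpha> ^^ Suc k) f) \<le> C * norm ((lap \<alpha> ^^ k) f)"
      using C(2) by simp
    also have "\<dots> \<le> C * (C ^ k * norm f)"
      using Suc C(1) by (rule mult_left_mono)
    finally show ?case by (simp add: mult.assoc)
  qed simp
  have "summable (\<lambda>k. (inverse (fact k) * (\<bar>t\<bar> * C) ^ k) * norm f)"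
    by (intro summable_mult2 summable_exp)
  then show ?thesis
  proof (rule summable_comparison_test'[where N = 0])
    fix k :: nat
    have "norm (scaleC ((- \<i> * of_real t) ^ k / fact k) ((lap \<alpha> ^^ k) f))
        = (\<bar>t\<bar> ^ k / fact k) * norm ((lap \<alpha> ^^ k) f)"
      by (simp add: norm_scaleC norm_divide norm_power norm_mult)
    also have "\<dots> \<le> (\<bar>t\<bar> ^ k / fact k) * (C ^ k * norm f)"
      by (intro mult_left_mono pow) auto
    finally show "norm (scaleC ((- \<i> * of_real t) ^ k / fact k) ((lap \<alpha> ^^ k) f))
        \<le> (inverse (fact k) * (\<bar>t\<bar> * C) ^ k) * norm f"
      by (simp add: power_mult_distrib divide_inverse mult_ac)
  qed
qed


section \<open>The nonlinear equation\<close>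

text \<open>\<open>u\<close> is continuously differentiable from \<open>\<real>\<close> into \<open>l2\<close>; the equation itself is read
  coordinatewise.\<close>

definition nls_solution :: "real \<Rightarrow> real \<Rightarrow> ereal \<Rightarrow> l2 \<Rightarrow> (real \<Rightarrow> l2) \<Rightarrow> bool" where
  "nls_solution \<mu> p \<alpha> f u \<longleftrightarrow>
    u 0 = f \<and>
    (\<exists>u'. continuous_on UNIV u' \<and>
      (\<forall>t. (u has_vector_derivative u' t) (at t)) \<and>
      (\<forall>t n. \<i> * seq (u' t) n =
        seq (lap \<alpha> (u t)) n
          + of_real (\<mu> * cmod (seq (u t) n) powr (p - 1)) * seq (u t) n))"

definition scatters_to :: "ereal \<Rightarrow> (real \<Rightarrow> l2) \<Rightarrow> l2 \<Rightarrow> bool" where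
  "scatters_to \<alpha> u w \<longleftrightarrow> ((\<lambda>t. norm (u t - propagator \<alpha> t w)) \<longlongrightarrow> 0) at_top"

end

theory Submission
  imports Defs
begin

text \<open>
  The symbols of all operators with \<open>\<alpha> > 11\<close> have second and third derivatives that do not vanish
  simultaneously, uniformly in \<open>\<alpha>\<close>, because the nearest-neighbour terms dominate the rest of the
  kernel. Van der Corput's lemma then gives a uniform decay \<open>(1 + \<bar>t\<bar>) powr (-1/3)\<close> from \<open>l1\<close> to
  \<open>l\<infinity>\<close>.

  On functions of time with values in \<open>l\<infinity>\<close>, a solution is comparable on each unit interval with its
  value at the left end point, so Strichartz' inequality is only needed at integer times. There it
  is dual to a Hardy--Littlewood--Sobolev inequality for finite sums; applied to the
  profile \<open>k \<mapsto> U(-k) u(k)\<close> and its increments (instead of to a free solution) it absorbs Duhamel's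
  formula. Since \<open>p \<ge> 7\<close>, the increments are summable, the profile of a small solution converges,
  and its limit differs from the initial value by a map with Lipschitz constant \<open>1/3\<close>; this gives
  the homeomorphism.

  The decay in \<open>l5\<close> follows from real interpolation of the dispersive estimate with unitarity.
  Finally, the difference of a fractional symbol and the nearest-neighbour symbol is dominated by
  its terms at distance two, and van der Corput's lemma applies to it as well: the two linear
  evolutions become orthogonal as \<open>t \<rightarrow> \<infinity>\<close>, and so do the two nonlinear solutions, which keep
  their norms.
\<close>


section \<open>Flows of bounded skew operators\<close>

text \<open>All exponents come from the rate 1/3. A kernel \<open>d powr (-1/3)\<close> pairs 6/5
  with 6 in Hardy--Littlewood--Sobolev, so six powers of the sup norm are summable in time; these
  are the p - 1 \<ge> 6 extra factors of the nonlinearity. Interpolation with unitarity turns 1/3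
  into 1/5 in l5, and seven factors then decay like 7/5 > 1, which closes the bootstrap for the
  decay. The number 11 is a count. The kernel has at least 12 powers of decay; four are spent on
  derivatives of the symbol, since a Lipschitz bound for the third derivative is wanted; the other
  eight make all terms beyond the leading distance sum to at most a quarter of the leading one. The
  obstacle in the last claim is that the operators converge as \<alpha> grows: the difference kernel
  has leading weight \<open>2 powr - (1 + \<alpha>)\<close>, so the two evolutions separate ever
  later. The lower bound survives because the supremum runs over all times: for each \<alpha> there
  is a time, depending on \<alpha>, at which the distance is at least \<open>norm f\<close>.\<close>

text \<open>\<open>has_derivative_series\<close> asks for errors proportional to the direction h. In
  one real variable a derivative is h times a vector, so uniform convergence of the derivatives
  provides them.\<close>

lemma has_vector_derivative_series:
  fixes f :: "nat \<Rightarrow> real \<Rightarrow> 'a::banach"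
  assumes S: "convex S" "open S"
    and f: "\<And>n x. x \<in> S \<Longrightarrow> (f n has_vector_derivative f' n x) (at x)"
    and lim: "uniform_limit S (\<lambda>n x. \<Sum>i<n. f' i x) g' sequentially"
    and sm: "\<And>x. x \<in> S \<Longrightarrow> summable (\<lambda>n. f n x)"
    and x: "x \<in> S"
  shows "((\<lambda>x. \<Sum>n. f n x) has_vector_derivative g' x) (at x)"
proof -
  have "\<exists>g. \<forall>x\<in>S. (\<lambda>n. f n x) sums (g x) \<and> (g has_derivative (\<lambda>h. h *\<^sub>R g' x)) (at x within S)"
  proof (rule has_derivative_series[OF S(1) _ _ x])
    show "(\<lambda>n. f n x) sums (\<Sum>n. f n x)"
      using sm[OF x] by (rule summable_sums)
    show "(f n has_derivative (\<lambda>h. h *\<^sub>R f' n x)) (at x within S)" if "x \<in> S" for n x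
      using f[OF that] has_derivative_at_withinI unfolding has_vector_derivative_def by blast
    fix e :: real assume e: "e > 0"
    have "\<forall>\<^sub>F n in sequentially. \<forall>x\<in>S. dist (\<Sum>i<n. f' i x) (g' x) < e"
      using uniform_limitD[OF lim e] .
    then show "\<forall>\<^sub>F n in sequentially. \<forall>x\<in>S. \<forall>h. norm ((\<Sum>i<n. h *\<^sub>R f' i x) - h *\<^sub>R g' x) \<le> e * norm h"
    proof eventually_elim
      case (elim n)
      show ?case
      proof (intro ballI allI)
        fix x h assume "x \<in> S"
        then have "norm ((\<Sum>i<n. f' i x) - g' x) \<le> e"
          using elim by (auto simp: dist_norm less_imp_le)
        then show "norm ((\<Sum>i<n. h *\<^sub>R f' i x) - h *\<^sub>R g' x) \<le> e * norm h"
          by (simp flip: scaleR_sum_right scaleR_diff_right add: mult.commute[of e] mult_left_mono)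
      qed
    qed
  qed
  then obtain g where g: "\<And>x. x \<in> S \<Longrightarrow> (\<lambda>n. f n x) sums (g x)"
      "\<And>x. x \<in> S \<Longrightarrow> (g has_vector_derivative g' x) (at x within S)"
    unfolding has_vector_derivative_def by blast
  have "(g has_vector_derivative g' x) (at x)"
    using g(2)[OF x] at_within_open[OF x S(2)] by simp
  then show ?thesis
    by (rule has_vector_derivative_transform_within_open[OF _ S(2) x])
       (use g(1) in \<open>simp add: sums_iff\<close>)
qed

lemma has_vector_derivative_inner:
  fixes f g :: "real \<Rightarrow> 'a::real_inner"
  assumes "(f has_vector_derivative f') (at t)" "(g has_vector_derivative g') (at t)"
  shows "((\<lambda>t. inner (f t) (g t)) has_real_derivative inner f' (g t) + inner (f t) g') (at t)"
proof -
  have "((\<lambda>t. inner (f t) (g t)) has_derivative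
      (\<lambda>h. inner (f t) (h *\<^sub>R g') + inner (h *\<^sub>R f') (g t))) (at t)"
    using assms unfolding has_vector_derivative_def
    by (rule has_derivative_inner)
  then show ?thesis
    unfolding has_field_derivative_def
    by (rule has_derivative_eq_rhs) (auto simp: algebra_simps)
qed

definition flow :: "('a::banach \<Rightarrow> 'a) \<Rightarrow> real \<Rightarrow> 'a \<Rightarrow> 'a" where
  "flow B t x = (\<Sum>k. (t ^ k / fact k) *\<^sub>R (B ^^ k) x)"

text \<open>Meant for -i times a self-adjoint operator. Skewness for the real inner product already
  makes the flow isometric; complex linearity enters later, as commutation with
  \<open>scaleC\<close>.\<close>

locale skew_operator =
  fixes B :: "'a::{real_inner, banach} \<Rightarrow> 'a"
  assumes bl: "bounded_linear B"
    and skew: "inner (B x) y = - inner x (B y)"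
begin

lemma inner_B_self: "inner (B x) x = 0"
  using skew[of x x] by (simp add: inner_commute)

lemma summable_flow: "summable (\<lambda>k. (t ^ k / fact k) *\<^sub>R (B ^^ k) x)"
  and flow_0: "flow B 0 x = x"
  and flow_deriv: "((\<lambda>t. flow B t x) has_vector_derivative B (flow B t x)) (at t)"
proof -
  interpret bounded_linear B by (rule bl)
  obtain C where C: "C > 0" "\<And>x. norm (B x) \<le> norm x * C"
    using pos_bounded by blast
  have pow: "norm ((B ^^ k) x) \<le> C ^ k * norm x" for k
  proof (induction k)
    case (Suc k)
    have "norm ((B ^^ Suc k) x) \<le> norm ((B ^^ k) x) * C" using C by simp
    also have "\<dots> \<le> (C ^ k * norm x) * C" using Suc C by (intro mult_right_mono) auto
    finally show ?case by (simp add: mult_ac)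
  qed simp
  have nrm: "norm ((t ^ k / fact k) *\<^sub>R (B ^^ k) x) \<le> (inverse (fact k) * (R * C) ^ k) * norm x"
    if "\<bar>t\<bar> \<le> R" for t R k
  proof -
    have "norm ((t ^ k / fact k) *\<^sub>R (B ^^ k) x) = (\<bar>t\<bar> ^ k / fact k) * norm ((B ^^ k) x)"
      by (simp add: power_abs)
    also have "\<dots> \<le> (R ^ k / fact k) * (C ^ k * norm x)"
      using that by (intro mult_mono pow divide_right_mono power_mono) auto
    finally show ?thesis by (simp add: power_mult_distrib divide_inverse mult_ac)
  qed
  have smb: "summable (\<lambda>k. (inverse (fact k) * (R * C) ^ k) * norm x)" for R
    by (intro summable_mult2 summable_exp)
  show sm: "summable (\<lambda>k. (t ^ k / fact k) *\<^sub>R (B ^^ k) x)" for t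
    by (rule summable_comparison_test'[OF smb[of "\<bar>t\<bar>"], of 0]) (use nrm in auto)
  show "flow B 0 x = x"
  proof -
    have "flow B 0 x = (\<Sum>k\<in>{0}. (0 ^ k / fact k) *\<^sub>R (B ^^ k) x)"
      unfolding flow_def by (rule suminf_finite) (auto simp: power_0_left)
    then show ?thesis by simp
  qed
  \<comment> \<open>The majorant \<open>smb\<close> is uniform only over bounded times, hence an
    interval around t.\<close>
  define S where "S = {-(\<bar>t\<bar> + 1)<..<\<bar>t\<bar> + 1}"
  \<comment> \<open>Differentiating a term of the exponential series gives B of its predecessor, so
    the derived series is that of B applied to the flow, shifted by one behind a leading 0.\<close>
  define f' where "f' n s = (case n of 0 \<Rightarrow> 0 | Suc k \<Rightarrow> (s ^ k / fact k) *\<^sub>R (B ^^ Suc k) x)" for n s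
  have "uniform_limit S (\<lambda>n s. \<Sum>i<n. (s ^ i / fact i) *\<^sub>R (B ^^ i) x)
          (\<lambda>s. \<Sum>i. (s ^ i / fact i) *\<^sub>R (B ^^ i) x) sequentially"
    by (rule Weierstrass_m_test[OF _ smb[of "\<bar>t\<bar> + 1"]]) (intro nrm, auto simp: S_def)
  then have "uniform_limit S (\<lambda>n s. \<Sum>i<n. (s ^ i / fact i) *\<^sub>R (B ^^ i) x) (\<lambda>s. flow B s x) sequentially"
    by (simp add: flow_def)
  then have "uniform_limit S (\<lambda>n s. B (\<Sum>i<n. (s ^ i / fact i) *\<^sub>R (B ^^ i) x)) (\<lambda>s. B (flow B s x)) sequentially"
    by (rule bounded_linear.uniform_limit[OF bl])
  then have "uniform_limit S (\<lambda>n s. \<Sum>i<n. (s ^ i / fact i) *\<^sub>R (B ^^ Suc i) x) (\<lambda>s. B (flow B s x)) sequentially"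
    by (simp add: sum scaleR)
  then have "uniform_limit S (\<lambda>n s. \<Sum>i<Suc n. f' i s) (\<lambda>s. B (flow B s x)) sequentially"
    by (simp add: sum.lessThan_Suc_shift f'_def del: sum.lessThan_Suc)
  then have lim: "uniform_limit S (\<lambda>n s. \<Sum>i<n. f' i s) (\<lambda>s. B (flow B s x)) sequentially"
    by (rule filterlim_sequentially_Suc[THEN iffD1])
  have "((\<lambda>s. \<Sum>n. (s ^ n / fact n) *\<^sub>R (B ^^ n) x) has_vector_derivative B (flow B t x)) (at t)"
  proof (rule has_vector_derivative_series[OF _ _ _ lim])
    fix n s
    show "((\<lambda>s. (s ^ n / fact n) *\<^sub>R (B ^^ n) x) has_vector_derivative f' n s) (at s)"
    proof (cases n)
      case 0
      then show ?thesis by (simp add: f'_def)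
    next
      case (Suc k)
      have "((\<lambda>s. s ^ n / fact n) has_real_derivative (s ^ k / fact k)) (at s)"
        unfolding Suc
        using DERIV_cdivide[OF DERIV_pow[of "Suc k" s UNIV], of "fact (Suc k)"] by simp
      then have "((\<lambda>s. (s ^ n / fact n) *\<^sub>R (B ^^ n) x) has_vector_derivative
          (s ^ n / fact n) *\<^sub>R 0 + (s ^ k / fact k) *\<^sub>R (B ^^ n) x) (at s)"
        by (rule has_vector_derivative_scaleR) simp
      then show ?thesis by (simp add: Suc f'_def)
    qed
  qed (use sm in \<open>auto simp: S_def\<close>)
  then show "((\<lambda>t. flow B t x) has_vector_derivative B (flow B t x)) (at t)"
    by (simp add: flow_def)
qed

lemma norm_solution:
  assumes "\<And>t. (x has_vector_derivative B (x t)) (at t)"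
  shows "norm (x t) = norm (x 0)"
proof -
  have "((\<lambda>t. inner (x t) (x t)) has_real_derivative 0) (at t)" for t
    using has_vector_derivative_inner[OF assms assms, of t] skew[of "x t" "x t"] by simp
  then have "inner (x t) (x t) = inner (x 0) (x 0)"
    by (intro DERIV_isconst_all allI)
  then show ?thesis by (simp add: norm_eq_sqrt_inner)
qed

text \<open>The difference of two solutions is a solution, so its norm stays at its initial value 0.
  The group law, additivity and the commutation rules below all exhibit a solution with the right
  initial value instead of manipulating the series.\<close>

lemma flow_unique:
  assumes x: "\<And>t. (x has_vector_derivative B (x t)) (at t)"
  shows "x t = flow B t (x 0)"
proof -
  interpret bounded_linear B by (rule bl)
  have "((\<lambda>t. x t - flow B t (x 0)) has_vector_derivative B (x t - flow B t (x 0))) (at t)" for t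
    by (simp add: diff has_vector_derivative_diff x flow_deriv)
  then have "norm (x t - flow B t (x 0)) = norm (x 0 - flow B 0 (x 0))"
    by (rule norm_solution)
  then show ?thesis by (simp add: flow_0)
qed

lemma norm_flow: "norm (flow B t x) = norm x"
  using norm_solution[OF flow_deriv] by (simp add: flow_0)

lemma flow_shift_deriv:
  "((\<lambda>s. flow B (s + c) x) has_vector_derivative B (flow B (t + c) x)) (at t)"
proof -
  have "((\<lambda>s. s + c) has_vector_derivative 1) (at t)"
    by (auto intro!: derivative_eq_intros simp: has_vector_derivative_def)
  from vector_diff_chain_at[OF this flow_deriv] show ?thesis by (simp add: o_def)
qed

lemma flow_add_time: "flow B (t + s) x = flow B t (flow B s x)"
  using flow_unique[OF flow_shift_deriv, of t s x] by simp

lemma flow_minus_cancel [simp]: "flow B (- t) (flow B t x) = x" "flow B t (flow B (- t) x) = x"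
  by (simp_all add: flow_0 flip: flow_add_time)

lemma flow_commute_bounded_linear:
  assumes C: "bounded_linear C" and comm: "\<And>x. B (C x) = C (B x)"
  shows "flow B t (C x) = C (flow B t x)"
  using flow_unique[of "\<lambda>t. C (flow B t x)" t]
    bounded_linear.has_vector_derivative[OF C flow_deriv]
  by (simp add: flow_0 comm)

lemma flow_add: "flow B t (x + y) = flow B t x + flow B t y"
proof -
  interpret bounded_linear B by (rule bl)
  show ?thesis
    using flow_unique[of "\<lambda>t. flow B t x + flow B t y" t]
    by (simp add: flow_0 has_vector_derivative_add flow_deriv add)
qed

lemma bounded_linear_flow: "bounded_linear (flow B t)"
proof (rule bounded_linear_intro[where K = 1])
  interpret bounded_linear B by (rule bl)
  show "flow B t (r *\<^sub>R x) = r *\<^sub>R flow B t x" for r x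
    by (rule flow_commute_bounded_linear) (auto simp: scaleR bounded_linear_scaleR_right)
qed (auto simp: flow_add norm_flow)

lemmas flow_diff = bounded_linear.axioms(1)[OF bounded_linear_flow, THEN linear_diff]
lemmas flow_sum = bounded_linear.axioms(1)[OF bounded_linear_flow, THEN linear_sum]

lemma flow_inner: "inner (flow B t x) (flow B t y) = inner x y"
proof -
  have "norm (flow B t x + flow B t y) = norm (x + y)"
    by (metis flow_add norm_flow)
  then show ?thesis
    using dot_norm[of x y] dot_norm[of "flow B t x" "flow B t y"] by (simp add: norm_flow)
qed

lemma flow_adjoint: "inner (flow B t x) y = inner x (flow B (- t) y)"
  using flow_inner[of t x "flow B (- t) y"] by simp

text \<open>Skewness cancels the linear terms and leaves the forcing paired with a free solution.
  This scalar identity takes the place of Duhamel's formula; the free solution passes through y at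
  time -c.\<close>

lemma weak_duhamel:
  assumes "(u has_vector_derivative B (u t) + n) (at t)"
  shows "((\<lambda>t. inner (u t) (flow B (t + c) y)) has_real_derivative inner n (flow B (t + c) y)) (at t)"
  using has_vector_derivative_inner[OF assms flow_shift_deriv[of c y t]]
    skew[of "u t" "flow B (t + c) y"] by (simp add: inner_add_left)

lemma flow_product:
  assumes f: "(f has_vector_derivative f') (at t)"
  shows "((\<lambda>s. flow B s (f s)) has_vector_derivative B (flow B t (f t)) + flow B t f') (at t)"
proof -
  interpret F: bounded_linear "flow B s" for s by (rule bounded_linear_flow)
  have cont: "((\<lambda>s. flow B s f') \<longlongrightarrow> flow B t f') (at t)"
    using has_vector_derivative_continuous[OF flow_deriv] continuous_within by blast
  \<comment> \<open>Three remainders: that of f, transported by the isometry; the continuity of the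
    flow at the vector f'; the differentiability of the flow at the fixed vector
    \<open>f t\<close>.\<close>
  let ?r = "\<lambda>s. norm (f s - f t - (s - t) *\<^sub>R f') / norm (s - t)
      + (norm (flow B s f' - flow B t f')
      + norm (flow B s (f t) - flow B t (f t) - (s - t) *\<^sub>R B (flow B t (f t))) / norm (s - t))"
  have r: "(?r \<longlongrightarrow> 0) (at t)"
    using f flow_deriv[of "f t" t] LIM_zero[OF cont]
    unfolding has_vector_derivative_def has_derivative_iff_norm
    by (intro tendsto_add_zero tendsto_norm_zero) auto
  show ?thesis
    unfolding has_vector_derivative_def has_derivative_iff_norm
  proof (intro conjI bounded_linear_scaleR_left tendsto_sandwich[OF _ _ tendsto_const r])
    show "\<forall>\<^sub>F s in at t. norm (flow B s (f s) - flow B t (f t) - (s - t) *\<^sub>R (B (flow B t (f t)) + flow B t f'))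
        / norm (s - t) \<le> ?r s"
    proof (intro eventually_at_filter[THEN iffD2] always_eventually allI impI)
      fix s assume st: "s \<noteq> t"
      have eq: "flow B s (f s) - flow B t (f t) - (s - t) *\<^sub>R (B (flow B t (f t)) + flow B t f')
          = flow B s (f s - f t - (s - t) *\<^sub>R f') + ((s - t) *\<^sub>R (flow B s f' - flow B t f')
          + (flow B s (f t) - flow B t (f t) - (s - t) *\<^sub>R B (flow B t (f t))))"
        by (simp add: F.diff F.add F.scaleR algebra_simps)
      have "norm (flow B s (f s) - flow B t (f t) - (s - t) *\<^sub>R (B (flow B t (f t)) + flow B t f')) \<le> norm (f s - f t - (s - t) *\<^sub>R f') + (norm (s - t) * norm (flow B s f' - flow B t f')
          + norm (flow B s (f t) - flow B t (f t) - (s - t) *\<^sub>R B (flow B t (f t))))"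
        unfolding eq by (intro norm_triangle_le add_mono order_refl) (auto simp: norm_flow)
      also have "\<dots> = norm (s - t) * ?r s"
        using st by (simp add: distrib_left)
      finally show "norm (flow B s (f s) - flow B t (f t) - (s - t) *\<^sub>R (B (flow B t (f t)) + flow B t f'))
          / norm (s - t) \<le> ?r s"
        using st by (simp add: pos_divide_le_eq mult.commute)
    qed
  qed (simp add: always_eventually)
qed

lemma skew_uminus: "skew_operator (\<lambda>x. - B x)"
  by (intro skew_operator.intro bounded_linear_minus bl) (simp add: skew)

lemma flow_uminus: "flow (\<lambda>x. - B x) t x = flow B (- t) x"
proof -
  interpret m: skew_operator "\<lambda>x. - B x" by (rule skew_uminus)
  have "((\<lambda>s. flow B (- s) x) has_vector_derivative - B (flow B (- t) x)) (at t)" for t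
  proof -
    have "((\<lambda>s. - s) has_vector_derivative -1) (at t)"
      by (auto intro!: derivative_eq_intros simp: has_vector_derivative_def)
    from vector_diff_chain_at[OF this flow_deriv] show ?thesis by (simp add: o_def)
  qed
  from m.flow_unique[OF this] show ?thesis by (simp add: flow_0)
qed

end

text \<open>For commuting operators the flow of A is the flow of B after that of D = A - B, because
  by \<open>flow_product\<close> the composite solves the equation of A; the isometry
  \<open>flow B t\<close> then drops out of the inner product.\<close>

lemma flow_commuting_difference:
  assumes "skew_operator A" "skew_operator B" "skew_operator D"
    and comm: "\<And>x. B (A x) = A (B x)" and D: "\<And>x. D x = A x - B x"
  shows "inner (flow A t x) (flow B t y) = inner (flow D t x) y"
proof -
  interpret A: skew_operator A by fact
  interpret B: skew_operator B by fact
  interpret D: skew_operator D by fact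
  have DB: "D (B x) = B (D x)" for x
    by (simp add: D comm bounded_linear.axioms(1)[OF B.bl, THEN linear_diff])
  have BD: "B (flow D s x) = flow D s (B x)" for s x
    by (rule D.flow_commute_bounded_linear[OF B.bl DB, symmetric])
  have "((\<lambda>s. flow B s (flow D s x)) has_vector_derivative A (flow B s (flow D s x))) (at s)" for s
  proof -
    interpret P: bounded_linear "flow B s" by (rule B.bounded_linear_flow)
    have "flow B s (A y) = A (flow B s y)" for y
      by (rule B.flow_commute_bounded_linear[OF A.bl comm])
    moreover have "flow B s (B y) = B (flow B s y)" for y
      by (rule B.flow_commute_bounded_linear[OF B.bl refl])
    ultimately show ?thesis
      using B.flow_product[OF D.flow_deriv[of x s]] by (simp add: D P.diff)
  qed
  from A.flow_unique[OF this, of t] have "flow A t x = flow B t (flow D t x)"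
    by (simp add: D.flow_0 B.flow_0)
  then show ?thesis by (simp add: B.flow_inner)
qed


section \<open>Even convolution kernels\<close>

lemma bounded_linear_scaleC: "bounded_linear (scaleC c)"
  by (rule bounded_linear_intro[where K = "cmod c"])
     (auto intro!: l2_eqI simp: scaleC.rep_eq plus_l2.rep_eq scaleR_l2.rep_eq norm_scaleC algebra_simps)

lemma scaleC_scaleC: "scaleC a (scaleC b f) = scaleC (a * b) f"
  by (intro l2_eqI) (simp add: scaleC.rep_eq)

lemma scaleC_minus: "scaleC (- c) f = - scaleC c f"
  by (intro l2_eqI) (simp add: scaleC.rep_eq uminus_l2.rep_eq)

lemma scaleC_of_real: "scaleC (of_real r) f = r *\<^sub>R f"
  by (intro l2_eqI) (simp add: scaleC.rep_eq scaleR_l2.rep_eq scaleR_conv_of_real)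

lemma seq_sum: "seq (\<Sum>i\<in>A. f i) n = (\<Sum>i\<in>A. seq (f i) n)"
  using bounded_linear.axioms(1)[OF bounded_linear_seq, THEN linear_sum] .

lemma inner_scaleC: "inner (scaleC c f) g = inner f (scaleC (cnj c) g)"
  unfolding inner_l2_def scaleC.rep_eq by (simp add: inner_complex_def algebra_simps)

lemma bounded_linear_shift: "bounded_linear (shift j)"
  by (rule bounded_linear_intro[where K = 1])
     (auto intro!: l2_eqI simp: seq_shift plus_l2.rep_eq scaleR_l2.rep_eq norm_shift)

lemma shift_shift: "shift j (shift k f) = shift (j + k) f"
  by (intro l2_eqI) (simp add: seq_shift algebra_simps)

lemma shift_scaleC: "shift j (scaleC c f) = scaleC c (shift j f)"
  by (intro l2_eqI) (simp add: seq_shift scaleC.rep_eq)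

lemma inner_shift: "inner (shift j f) g = inner f (shift (- j) g)"
proof -
  have "inner (shift j f) g = (\<Sum>\<^sub>\<infinity>n. (\<lambda>m. seq f m \<bullet> seq g (m + j)) (n - j))"
    by (simp add: inner_l2_def seq_shift)
  also have "\<dots> = (\<Sum>\<^sub>\<infinity>m. seq f m \<bullet> seq g (m + j))"
    by (rule infsum_reindex_bij_betw[OF bij_minus_int])
  finally show ?thesis by (simp add: inner_l2_def seq_shift)
qed

lift_definition delta :: "int \<Rightarrow> l2" is "\<lambda>a n. if n = a then 1 else 0"
proof -
  fix a :: int
  have "(\<lambda>n. (cmod (if n = a then 1 else 0))\<^sup>2) summable_on {a}" by simp
  then have "(\<lambda>n. (cmod (if n = a then 1 else 0))\<^sup>2) summable_on UNIV"
    by (rule summable_on_cong_neutral[THEN iffD1, rotated -1]) auto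
  then show "in_lq 2 (\<lambda>n. if n = a then 1 else 0)"
    unfolding in_l2_iff .
qed

lemma inner_delta: "inner f (scaleC c (delta n)) = Re (seq f n * cnj c)"
proof -
  have "inner f (scaleC c (delta n)) = (\<Sum>\<^sub>\<infinity>m\<in>{n}. seq f m \<bullet> (c * (if m = n then 1 else 0)))"
    unfolding inner_l2_def scaleC.rep_eq delta.rep_eq
    by (rule infsum_cong_neutral) auto
  then show ?thesis by (simp add: inner_complex_def)
qed

lemma norm_delta [simp]: "norm (delta n) = 1"
proof -
  have "scaleC 1 (delta n) = delta n"
    by (intro l2_eqI) (simp add: scaleC.rep_eq)
  then have "inner (delta n) (delta n) = 1"
    using inner_delta[of "delta n" 1 n] by (simp add: delta.rep_eq)
  then show ?thesis by (simp add: norm_eq_sqrt_inner)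
qed

section \<open>Convolution operators with an even summable kernel\<close>

definition lapk :: "(int \<Rightarrow> real) \<Rightarrow> l2 \<Rightarrow> l2" where
  "lapk K f = (\<Sum>\<^sub>\<infinity>j. K j *\<^sub>R (f - shift j f))"

definition gen :: "(int \<Rightarrow> real) \<Rightarrow> l2 \<Rightarrow> l2" where
  "gen K f = scaleC (- \<i>) (lapk K f)"

locale even_kernel =
  fixes K :: "int \<Rightarrow> real"
  assumes summable: "K summable_on UNIV"
    and even: "K (- j) = K j"
begin

lemma abs_summable: "(\<lambda>j. \<bar>K j\<bar>) summable_on UNIV"
  using summable summable_on_iff_abs_summable_on_real by force

lemma norm_lapk_term: "norm (K j *\<^sub>R (f - shift j f)) \<le> \<bar>K j\<bar> * (2 * norm f)"
proof -
  have "norm (f - shift j f) \<le> 2 * norm f"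
    using norm_triangle_ineq4[of f "shift j f"] by (simp add: norm_shift)
  then show ?thesis by (simp add: mult_left_mono)
qed

lemma abs_summable_lapk: "(\<lambda>j. norm (K j *\<^sub>R (f - shift j f))) summable_on UNIV"
  by (rule Infinite_Sum.abs_summable_on_comparison_test'[OF summable_on_cmult_left[OF abs_summable]])
     (use norm_lapk_term in auto)

lemma lapk_has_sum: "((\<lambda>j. K j *\<^sub>R (f - shift j f)) has_sum lapk K f) UNIV"
  unfolding lapk_def using abs_summable_summable[OF abs_summable_lapk] by simp

lemma bounded_linear_lapk: "bounded_linear (lapk K)"
proof (rule bounded_linear_intro)
  interpret S: bounded_linear "shift j" for j by (rule bounded_linear_shift)
  fix f g :: l2 and r :: real
  have "((\<lambda>j. K j *\<^sub>R (f - shift j f) + K j *\<^sub>R (g - shift j g)) has_sum lapk K f + lapk K g) UNIV"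
    by (intro has_sum_add lapk_has_sum)
  then have "((\<lambda>j. K j *\<^sub>R ((f + g) - shift j (f + g))) has_sum lapk K f + lapk K g) UNIV"
    by (simp add: S.add algebra_simps)
  then show "lapk K (f + g) = lapk K f + lapk K g"
    by (rule has_sum_unique[OF lapk_has_sum])
  have "((\<lambda>j. r *\<^sub>R (K j *\<^sub>R (f - shift j f))) has_sum r *\<^sub>R lapk K f) UNIV"
    by (intro has_sum_bounded_linear[OF bounded_linear_scaleR_right] lapk_has_sum)
  then have "((\<lambda>j. K j *\<^sub>R (r *\<^sub>R f - shift j (r *\<^sub>R f))) has_sum r *\<^sub>R lapk K f) UNIV"
    by (simp add: S.scaleR algebra_simps)
  then show "lapk K (r *\<^sub>R f) = r *\<^sub>R lapk K f"
    by (rule has_sum_unique[OF lapk_has_sum])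
  have "norm (lapk K f) \<le> (\<Sum>\<^sub>\<infinity>j. norm (K j *\<^sub>R (f - shift j f)))"
    unfolding lapk_def by (rule norm_infsum_bound[OF abs_summable_lapk])
  also have "\<dots> \<le> (\<Sum>\<^sub>\<infinity>j. \<bar>K j\<bar> * (2 * norm f))"
    by (intro infsum_mono abs_summable_lapk summable_on_cmult_left abs_summable norm_lapk_term)
  also have "\<dots> = norm f * (2 * (\<Sum>\<^sub>\<infinity>j. \<bar>K j\<bar>))"
    by (simp add: infsum_cmult_left')
  finally show "norm (lapk K f) \<le> norm f * (2 * (\<Sum>\<^sub>\<infinity>j. \<bar>K j\<bar>))" .
qed

lemma seq_lapk_has_sum: "((\<lambda>j. K j *\<^sub>R (seq f n - seq f (n - j))) has_sum seq (lapk K f) n) UNIV"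
  using has_sum_bounded_linear[OF bounded_linear_seq lapk_has_sum[of f], of n]
  by (simp add: scaleR_l2.rep_eq minus_l2.rep_eq seq_shift)

text \<open>Summing over displacements makes the operator a convergent sum of translations, and
  whatever commutes with each of them commutes with the sum. This serves for scalars, for shifts
  and, through these, for other convolution operators.\<close>

lemma lapk_commute:
  assumes C: "bounded_linear C" and comm: "\<And>j f. C (shift j f) = shift j (C f)"
  shows "lapk K (C f) = C (lapk K f)"
proof -
  interpret bounded_linear C by (rule C)
  have "((\<lambda>j. K j *\<^sub>R (C f - shift j (C f))) has_sum C (lapk K f)) UNIV"
    using has_sum_bounded_linear[OF C lapk_has_sum[of f]] by (simp add: scaleR diff comm)
  then show ?thesis
    by (rule has_sum_unique[OF lapk_has_sum])
qed

lemma lapk_scaleC: "lapk K (scaleC c f) = scaleC c (lapk K f)"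
  by (intro lapk_commute bounded_linear_scaleC) (simp add: shift_scaleC)

lemma lapk_shift: "lapk K (shift j f) = shift j (lapk K f)"
  by (intro lapk_commute bounded_linear_shift) (simp add: shift_shift add.commute)

text \<open>The adjoint of \<open>shift j\<close> is \<open>shift (- j)\<close>; substituting -j for
  j and evenness of K restore the sum.\<close>

lemma inner_lapk: "inner (lapk K f) g = inner f (lapk K g)"
proof -
  have l: "((\<lambda>j. K j * (inner f g - inner (shift j f) g)) has_sum inner (lapk K f) g) UNIV"
    using has_sum_bounded_linear[OF bounded_linear_inner_left lapk_has_sum[of f], of g]
    by (simp add: inner_diff_left)
  have "((\<lambda>j. K j * (inner f g - inner f (shift j g))) has_sum inner f (lapk K g)) UNIV"
    using has_sum_bounded_linear[OF bounded_linear_inner_right lapk_has_sum[of g], of f]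
    by (simp add: inner_diff_right)
  moreover have "bij (uminus :: int \<Rightarrow> int)"
    by (rule bij_betw_byWitness[where f' = uminus]) auto
  ultimately have "((\<lambda>j. K (- j) * (inner f g - inner f (shift (- j) g))) has_sum inner f (lapk K g)) UNIV"
    using has_sum_reindex_bij_betw[of uminus UNIV UNIV
        "\<lambda>j. K j * (inner f g - inner f (shift j g))" "inner f (lapk K g)"]
    by simp
  then have "((\<lambda>j. K j * (inner f g - inner (shift j f) g)) has_sum inner f (lapk K g)) UNIV"
    by (simp add: even inner_shift)
  with l show ?thesis by (rule has_sum_unique)
qed

lemma bounded_linear_gen: "bounded_linear (gen K)"
  unfolding gen_def by (rule bounded_linear_compose[OF bounded_linear_scaleC bounded_linear_lapk])

lemma skew_operator_gen: "skew_operator (gen K)"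
  by (intro skew_operator.intro bounded_linear_gen)
     (simp add: gen_def inner_scaleC inner_lapk lapk_scaleC scaleC_minus)

sublocale skew_operator "gen K"
  by (rule skew_operator_gen)

lemma gen_scaleC: "gen K (scaleC c f) = scaleC c (gen K f)"
  by (simp add: gen_def lapk_scaleC scaleC_scaleC mult.commute)

lemma flow_scaleC: "flow (gen K) t (scaleC c f) = scaleC c (flow (gen K) t f)"
  by (intro flow_commute_bounded_linear bounded_linear_scaleC) (simp add: gen_scaleC)

end

text \<open>Convolution operators commute, so the angle between two evolutions is governed by one
  evolution, that of the difference kernel, to which a dispersive estimate can be applied.\<close>

lemma inner_flow_two_kernels:
  assumes K: "even_kernel K" and L: "even_kernel L" and D: "\<And>j. D j = K j - L j"
  shows "inner (flow (gen K) t x) (flow (gen L) t y) = inner (flow (gen D) t x) y"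
proof (rule flow_commuting_difference)
  interpret K: even_kernel K by fact
  interpret L: even_kernel L by fact
  interpret S: bounded_linear "scaleC c" for c by (rule bounded_linear_scaleC)
  have "even_kernel D"
  proof
    show "D summable_on UNIV"
      using summable_on_add[OF K.summable summable_on_uminus[THEN iffD2, OF L.summable]]
      by (simp add: D[abs_def])
  qed (simp add: D K.even L.even)
  then interpret D: even_kernel D .
  show "skew_operator (gen K)" "skew_operator (gen L)" "skew_operator (gen D)"
    by (rule K.skew_operator_gen L.skew_operator_gen D.skew_operator_gen)+
  show "gen L (gen K f) = gen K (gen L f)" for f
    unfolding gen_def by (simp add: K.lapk_scaleC L.lapk_scaleC)
       (simp add: L.lapk_commute[OF K.bounded_linear_lapk K.lapk_shift])
  have "((\<lambda>j. K j *\<^sub>R (f - shift j f) - L j *\<^sub>R (f - shift j f)) has_sum lapk K f - lapk L f) UNIV" for f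
    using has_sum_add[OF K.lapk_has_sum[of f] has_sum_bounded_linear[OF
        bounded_linear_minus[OF bounded_linear_ident] L.lapk_has_sum[of f]]] by simp
  then have "((\<lambda>j. D j *\<^sub>R (f - shift j f)) has_sum lapk K f - lapk L f) UNIV" for f
    by (simp add: D scaleR_diff_left)
  then have "lapk D f = lapk K f - lapk L f" for f
    by (rule has_sum_unique[OF D.lapk_has_sum])
  then show "gen D f = gen K f - gen L f" for f
    by (simp add: gen_def S.diff)
qed

section \<open>The kernels of the fractional and the nearest-neighbour operators\<close>

definition ker :: "ereal \<Rightarrow> int \<Rightarrow> real" where
  "ker \<alpha> j = (if \<alpha> = \<infinity> then if \<bar>j\<bar> = 1 then 1 else 0
    else of_int \<bar>j\<bar> powr - (1 + real_of_ereal \<alpha>))"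

text \<open>\<open>0 powr x\<close> is 0, so finite orders put no weight on the diagonal. The weight
  1 at distance one is common to all orders and will cancel in differences.\<close>

lemma ker_0 [simp]: "ker \<alpha> 0 = 0" and ker_1 [simp]: "ker \<alpha> 1 = 1"
  by (simp_all add: ker_def)

lemma even_kernel_ker:
  assumes "\<alpha> > 0"
  shows "even_kernel (ker \<alpha>)"
proof
  show "ker \<alpha> summable_on UNIV"
  proof (cases "\<alpha> = \<infinity>")
    case True
    have "(\<lambda>j. ker \<alpha> j) summable_on {1, -1}" by simp
    then show ?thesis
      by (rule summable_on_cong_neutral[THEN iffD1, rotated -1]) (auto simp: True ker_def)
  next
    case False
    then have "real_of_ereal \<alpha> > 0" using assms by (cases \<alpha>) auto
    from kernel_summable[OF this] show ?thesis using False by (simp add: ker_def[abs_def])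
  qed
qed (simp add: ker_def)

lemma lap_eq_lapk:
  assumes "\<alpha> > 0"
  shows "lap \<alpha> f = lapk (ker \<alpha>) f"
proof (rule l2_eqI)
  interpret even_kernel "ker \<alpha>" by (rule even_kernel_ker[OF assms])
  fix n
  have l: "((\<lambda>j. ker \<alpha> j *\<^sub>R (seq f n - seq f (n - j))) has_sum seq (lapk (ker \<alpha>) f) n) UNIV"
    by (rule seq_lapk_has_sum)
  show "seq (lap \<alpha> f) n = seq (lapk (ker \<alpha>) f) n"
  proof (cases "\<alpha> = \<infinity>")
    case True
    have "((\<lambda>j. ker \<alpha> j *\<^sub>R (seq f n - seq f (n - j))) has_sum
        (\<Sum>j\<in>{1,-1}. ker \<alpha> j *\<^sub>R (seq f n - seq f (n - j)))) {1,-1}"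
      by (rule has_sum_finite) simp
    then have "((\<lambda>j. ker \<alpha> j *\<^sub>R (seq f n - seq f (n - j))) has_sum
        (\<Sum>j\<in>{1,-1}. ker \<alpha> j *\<^sub>R (seq f n - seq f (n - j)))) UNIV"
      by (rule has_sum_cong_neutral[THEN iffD1, rotated -1]) (auto simp: True ker_def)
    from has_sum_unique[OF this l] show ?thesis
      by (simp add: seq_lap assms lap_seq_def True ker_def algebra_simps)
  next
    case False
    have "bij (\<lambda>m. n - m)"
      by (rule bij_betw_byWitness[where f' = "\<lambda>m. n - m"]) auto
    from has_sum_reindex_bij_betw[OF this, of "\<lambda>j. ker \<alpha> j *\<^sub>R (seq f n - seq f (n - j))"] l
    have "((\<lambda>m. ker \<alpha> (n - m) *\<^sub>R (seq f n - seq f m)) has_sum seq (lapk (ker \<alpha>) f) n) UNIV"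
      by simp
    then have "((\<lambda>m. ker \<alpha> (n - m) *\<^sub>R (seq f n - seq f m)) has_sum seq (lapk (ker \<alpha>) f) n) (-{n})"
      by (rule has_sum_cong_neutral[THEN iffD1, rotated -1]) auto
    then have "((\<lambda>m. (seq f n - seq f m) / of_real (of_int \<bar>n - m\<bar> powr (1 + real_of_ereal \<alpha>)))
        has_sum seq (lapk (ker \<alpha>) f) n) (-{n})"
      using False
      by (simp add: ker_def powr_minus [of _ "1 + real_of_ereal \<alpha>", simplified]
            scaleR_conv_of_real divide_inverse mult.commute flip: of_real_inverse)
    then show ?thesis
      using False by (simp add: seq_lap assms lap_seq_def infsumI)
  qed
qed

lemma propagator_eq_flow:
  assumes "\<alpha> > 0"
  shows "propagator \<alpha> t f = flow (gen (ker \<alpha>)) t f"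
proof -
  interpret even_kernel "ker \<alpha>" by (rule even_kernel_ker[OF assms])
  have g: "(gen (ker \<alpha>) ^^ k) f = scaleC ((- \<i>) ^ k) ((lap \<alpha> ^^ k) f)" for k
  proof (induction k)
    case 0
    show ?case by (intro l2_eqI) (simp add: scaleC.rep_eq)
  next
    case (Suc k)
    then show ?case
      by (simp add: gen_scaleC) (simp add: gen_def lap_eq_lapk[OF assms] scaleC_scaleC mult.commute)
  qed
  have "(t ^ k / fact k) *\<^sub>R (gen (ker \<alpha>) ^^ k) f =
      scaleC ((- \<i> * of_real t) ^ k / fact k) ((lap \<alpha> ^^ k) f)" for k
    unfolding g power_mult_distrib by (simp add: scaleC_scaleC mult.commute flip: scaleC_of_real)
  then show ?thesis unfolding propagator_def flow_def by simp
qed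


section \<open>Van der Corput's lemma\<close>

lemma continuous_on_if_derivative:
  fixes f :: "real \<Rightarrow> real"
  assumes "\<And>x. x \<in> S \<Longrightarrow> (f has_real_derivative f' x) (at x)"
  shows "continuous_on S f"
  by (rule DERIV_continuous_on[OF has_field_derivative_at_within[OF assms]])

lemma norm_integral_cis_uminus:
  fixes \<phi> :: "real \<Rightarrow> real"
  assumes "continuous_on {a..b} \<phi>"
  shows "norm (integral {a..b} (\<lambda>x. cis (- \<phi> x))) = norm (integral {a..b} (\<lambda>x. cis (\<phi> x)))"
proof -
  have "(\<lambda>x. cis (\<phi> x)) integrable_on {a..b}"
    by (intro integrable_continuous_real continuous_intros assms)
  from integral_linear[OF this bounded_linear_cnj]
  have "integral {a..b} (\<lambda>x. cis (- \<phi> x)) = cnj (integral {a..b} (\<lambda>x. cis (\<phi> x)))"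
    by (simp add: o_def cis_cnj)
  then show ?thesis by simp
qed

lemma slope_bound:
  fixes g g' :: "real \<Rightarrow> real"
  assumes "x \<le> y" "\<And>t. t \<in> {x..y} \<Longrightarrow> (g has_real_derivative g' t) (at t)"
    and "\<And>t. t \<in> {x..y} \<Longrightarrow> m \<le> g' t"
  shows "m * (y - x) \<le> g y - g x"
proof (cases "x = y")
  case False
  then have "x < y" using assms(1) by simp
  from MVT2[OF this, of g g'] assms(2) obtain z where "x < z" "z < y" "g y - g x = (y - x) * g' z"
    by auto
  then show ?thesis using assms(1) assms(3)[of z] by (simp add: mult.commute mult_left_mono)
qed simp

text \<open>Integration by parts, with cis(\<phi>) as its own derivative divided by i \<phi>'. The
  two boundary terms are at most 1/\<delta> each; the remaining integrand is dominated by
  \<phi>''/\<phi>'^2, the derivative of -1/\<phi>', whose total increment is at most 2/\<delta>. The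
  sign of \<phi>'' makes this domination possible.\<close>

lemma van_der_Corput_1:
  fixes \<phi> \<phi>1 \<phi>2 :: "real \<Rightarrow> real"
  assumes "a \<le> b" "\<delta> > 0"
    and d1: "\<And>x. x \<in> {a..b} \<Longrightarrow> (\<phi> has_real_derivative \<phi>1 x) (at x)"
    and d2: "\<And>x. x \<in> {a..b} \<Longrightarrow> (\<phi>1 has_real_derivative \<phi>2 x) (at x)"
    and \<delta>: "\<And>x. x \<in> {a..b} \<Longrightarrow> \<delta> \<le> \<bar>\<phi>1 x\<bar>"
    and pos: "\<And>x. x \<in> {a..b} \<Longrightarrow> 0 \<le> \<phi>2 x"
  shows "norm (integral {a..b} (\<lambda>x. cis (\<phi> x))) \<le> 4 / \<delta>"
proof (cases "a = b")
  case True
  then show ?thesis using \<open>\<delta> > 0\<close> by simp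
next
  case False
  then have ab: "a < b" using assms by simp
  have nz: "\<phi>1 x \<noteq> 0" if "x \<in> {a..b}" for x
    using \<delta>[OF that] \<open>\<delta> > 0\<close> by auto
  \<comment> \<open>The integrated term, with 1/i written as -i.\<close>
  define E where "E x = - \<i> * cis (\<phi> x) * of_real (inverse (\<phi>1 x))" for x
  define G where "G x = integral {a..x} (\<lambda>x. cis (\<phi> x)) - E x" for x
  have ctn: "continuous_on {a..b} \<phi>" "continuous_on {a..b} \<phi>1"
    by (rule continuous_on_if_derivative[OF d1] continuous_on_if_derivative[OF d2], assumption)+
  then have cc: "continuous_on {a..b} (\<lambda>x. cis (\<phi> x))"
    by (intro continuous_intros)
  have dE: "(E has_vector_derivative (cis (\<phi> x) + \<i> * cis (\<phi> x) * of_real (\<phi>2 x / (\<phi>1 x)\<^sup>2))) (at x)"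
    if x: "x \<in> {a..b}" for x
  proof -
    have c: "((\<lambda>x. cis (\<phi> x)) has_vector_derivative \<phi>1 x *\<^sub>R (\<i> * cis (\<phi> x))) (at x)"
    proof -
      have "(cis has_vector_derivative \<i> * cis (\<phi> x)) (at (\<phi> x))"
        unfolding has_vector_derivative_def
        by (rule has_derivative_eq_rhs[OF has_derivative_cis[OF has_derivative_ident]])
           (simp add: fun_eq_iff scaleR_conv_of_real mult_ac)
      with d1[OF x, unfolded has_real_derivative_iff_has_vector_derivative]
      have "((cis \<circ> \<phi>) has_vector_derivative \<phi>1 x *\<^sub>R (\<i> * cis (\<phi> x))) (at x)"
        by (rule vector_diff_chain_at)
      then show ?thesis by (simp add: o_def)
    qed
    have i: "((\<lambda>x. complex_of_real (inverse (\<phi>1 x))) has_vector_derivative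
        of_real (- (\<phi>2 x / (\<phi>1 x)\<^sup>2))) (at x)"
      by (rule has_vector_derivative_of_real, rule DERIV_cong[OF DERIV_inverse'[OF d2[OF x] nz[OF x]]])
         (simp add: field_simps power2_eq_square)
    have "((\<lambda>x. (- \<i> * cis (\<phi> x)) * of_real (inverse (\<phi>1 x))) has_vector_derivative
        (- \<i> * cis (\<phi> x)) * of_real (- (\<phi>2 x / (\<phi>1 x)\<^sup>2))
        + (- \<i> * (\<phi>1 x *\<^sub>R (\<i> * cis (\<phi> x)))) * of_real (inverse (\<phi>1 x))) (at x)"
      by (intro has_vector_derivative_mult[OF _ i] bounded_linear.has_vector_derivative[OF bounded_linear_mult_right c])
    moreover have "(- \<i> * (\<phi>1 x *\<^sub>R (\<i> * cis (\<phi> x)))) * of_real (inverse (\<phi>1 x)) = cis (\<phi> x)"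
      using nz[OF x] by (simp add: scaleR_conv_of_real field_simps)
    ultimately show ?thesis by (simp add: E_def[abs_def] add.commute)
  qed
  have dG: "(G has_vector_derivative - (\<i> * cis (\<phi> x) * of_real (\<phi>2 x / (\<phi>1 x)\<^sup>2))) (at x within {a..b})"
    if x: "x \<in> {a..b}" for x
    using has_vector_derivative_diff[OF integral_has_vector_derivative[OF cc x]
        has_vector_derivative_at_within[OF dE[OF x]]]
    by (simp add: G_def[abs_def])
  \<comment> \<open>The mean value inequality with comparison function -1/\<phi>' replaces an
    estimate of the integral of \<phi>''/\<phi>'^2.\<close>
  have GG: "norm (G b - G a) \<le> - inverse (\<phi>1 b) - (- inverse (\<phi>1 a))"
  proof (rule differentiable_bound_general[OF ab])
    show "continuous_on {a..b} G"
      using dG has_vector_derivative_continuous continuous_on_eq_continuous_within by blast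
    show "continuous_on {a..b} (\<lambda>x. - inverse (\<phi>1 x))"
      using nz ctn by (intro continuous_intros) auto
    fix x assume x: "a < x" "x < b"
    then have x': "x \<in> {a..b}" by simp
    show "(G has_vector_derivative - (\<i> * cis (\<phi> x) * of_real (\<phi>2 x / (\<phi>1 x)\<^sup>2))) (at x)"
      using dG[OF x'] at_within_Icc_at[OF x] by simp
    show "((\<lambda>x. - inverse (\<phi>1 x)) has_vector_derivative \<phi>2 x / (\<phi>1 x)\<^sup>2) (at x)"
      using DERIV_minus[OF DERIV_inverse'[OF d2[OF x'] nz[OF x']]]
      by (simp add: has_real_derivative_iff_has_vector_derivative field_simps power2_eq_square)
    show "norm (- (\<i> * cis (\<phi> x) * complex_of_real (\<phi>2 x / (\<phi>1 x)\<^sup>2))) \<le> \<phi>2 x / (\<phi>1 x)\<^sup>2"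
      using pos[OF x'] by (simp add: norm_mult norm_divide norm_power)
  qed
  have inv: "\<bar>inverse (\<phi>1 x)\<bar> \<le> 1 / \<delta>" if "x \<in> {a..b}" for x
    using \<delta>[OF that] \<open>\<delta> > 0\<close> by (simp add: abs_inverse divide_inverse le_imp_inverse_le)
  have nE: "norm (E x) \<le> 1 / \<delta>" if "x \<in> {a..b}" for x
    using inv[OF that] by (simp add: E_def norm_mult norm_inverse)
  have I: "integral {a..b} (\<lambda>x. cis (\<phi> x)) = (G b - G a) + E b - E a"
    by (simp add: G_def)
  have "norm ((G b - G a) + E b - E a) \<le> norm (G b - G a) + norm (E b) + norm (E a)"
    by (meson add_mono norm_triangle_ineq norm_triangle_ineq4 order_refl order_trans)
  moreover have "inverse (\<phi>1 a) \<le> 1 / \<delta>" "- inverse (\<phi>1 b) \<le> 1 / \<delta>" "norm (E a) \<le> 1 / \<delta>" "norm (E b) \<le> 1 / \<delta>"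
    using abs_le_D1[OF inv[of a]] abs_le_D2[OF inv[of b]] nE[of a] nE[of b] ab by simp_all
  ultimately have "norm (integral {a..b} (\<lambda>x. cis (\<phi> x))) \<le> 1 / \<delta> + 1 / \<delta> + 1 / \<delta> + 1 / \<delta>"
    unfolding I using GG by linarith
  then show ?thesis by simp
qed

text \<open>A function whose derivative is at least \<open>m\<close> is of size at least \<open>m\<eta>\<close> away from an interval
  of length \<open>2\<eta>\<close>; there the previous derivative test applies, and the interval
  itself contributes at most its length.\<close>

lemma integral_cut_out:
  fixes f :: "real \<Rightarrow> complex" and g g' :: "real \<Rightarrow> real"
  assumes ab: "a \<le> b" and \<eta>: "\<eta> > 0" and m: "m > 0" and M: "M \<ge> 0"
    and f: "continuous_on {a..b} f" "\<And>x. norm (f x) \<le> 1"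
    and g: "\<And>x. x \<in> {a..b} \<Longrightarrow> (g has_real_derivative g' x) (at x)"
      "\<And>x. x \<in> {a..b} \<Longrightarrow> m \<le> g' x"
    and parts: "\<And>c d. a \<le> c \<Longrightarrow> c \<le> d \<Longrightarrow> d \<le> b \<Longrightarrow>
      (\<forall>x\<in>{c..d}. m * \<eta> \<le> g x) \<or> (\<forall>x\<in>{c..d}. g x \<le> - (m * \<eta>)) \<Longrightarrow> norm (integral {c..d} f) \<le> M"
  shows "norm (integral {a..b} f) \<le> 2 * M + 2 * \<eta>"
proof -
  have sl: "m * (y - x) \<le> g y - g x" if "a \<le> x" "x \<le> y" "y \<le> b" for x y
    using that g by (intro slope_bound[where g' = g']) auto
  \<comment> \<open>z is a zero of g or, if g has one sign, the end point where g is closest to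
    zero; in every case g moves away from zero at rate m on both sides of z.\<close>
  have "\<exists>z\<in>{a..b}. (\<forall>x\<in>{z<..b}. m * (x - z) \<le> g x) \<and> (\<forall>x\<in>{a..<z}. g x \<le> - (m * (z - x)))"
  proof -
    consider "g a \<ge> 0" | "g b \<le> 0" | "g a \<le> 0" "g b \<ge> 0" by linarith
    then show ?thesis
    proof cases
      case 1
      have "m * (x - a) \<le> g x" if "x \<in> {a<..b}" for x using sl[of a x] that 1 by auto
      then show ?thesis using ab by (intro bexI[of _ a]) auto
    next
      case 2
      have "g x \<le> - (m * (b - x))" if "x \<in> {a..<b}" for x using sl[of x b] that 2 by auto
      then show ?thesis using ab by (intro bexI[of _ b]) auto
    next
      case 3
      have "continuous_on {a..b} g"
        using g(1) by (rule continuous_on_if_derivative)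
      then obtain z where z: "a \<le> z" "z \<le> b" "g z = 0"
        using IVT'[of g a 0 b] 3 ab by auto
      have "m * (x - z) \<le> g x" if "x \<in> {z<..b}" for x using sl[of z x] z that by auto
      moreover have "g x \<le> - (m * (z - x))" if "x \<in> {a..<z}" for x using sl[of x z] z that by auto
      ultimately show ?thesis using z by (intro bexI[of _ z]) auto
    qed
  qed
  then obtain z where z: "z \<in> {a..b}" "\<And>x. z < x \<Longrightarrow> x \<le> b \<Longrightarrow> m * (x - z) \<le> g x"
      "\<And>x. a \<le> x \<Longrightarrow> x < z \<Longrightarrow> g x \<le> - (m * (z - x))" by auto
  define c d where "c = max a (z - \<eta>)" and "d = min b (z + \<eta>)"
  have cd: "a \<le> c" "c \<le> d" "d \<le> b" "d - c \<le> 2 * \<eta>"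
    using z(1) \<eta> by (auto simp: c_def d_def)
  have "norm (integral {a..c} f) \<le> M"
  proof (cases "c = a")
    case False
    then have "c = z - \<eta>" by (auto simp: c_def)
    moreover have "m * \<eta> \<le> m * (z - x)" if "x \<le> z - \<eta>" for x
      using that m by simp
    ultimately show ?thesis using cd \<eta> z(3) by (intro parts) (force intro!: disjI2)+
  qed (use M in simp)
  moreover have "norm (integral {d..b} f) \<le> M"
  proof (cases "d = b")
    case False
    then have "d = z + \<eta>" by (auto simp: d_def)
    moreover have "m * \<eta> \<le> m * (x - z)" if "z + \<eta> \<le> x" for x
      using that m by simp
    ultimately show ?thesis using cd \<eta> z(2) by (intro parts) (force intro!: disjI1)+
  qed (use M in simp)
  moreover have "norm (integral {c..d} f) \<le> 1 * (d - c)"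
    using cd f by (intro integral_bound) (auto intro: continuous_on_subset)
  moreover have "integral {a..b} f = integral {a..c} f + integral {c..d} f + integral {d..b} f"
  proof -
    have i: "f integrable_on {a..b}" "f integrable_on {a..d}"
      using f(1) cd by (auto intro!: integrable_continuous_real intro: continuous_on_subset)
    show ?thesis
      using Henstock_Kurzweil_Integration.integral_combine[OF _ cd(3) i(1)]
        Henstock_Kurzweil_Integration.integral_combine[OF cd(1,2) i(2)] cd by simp
  qed
  ultimately show ?thesis
    using cd(4) norm_triangle_ineq[of "integral {a..c} f + integral {c..d} f" "integral {d..b} f"]
      norm_triangle_ineq[of "integral {a..c} f" "integral {c..d} f"] by simp
qed

lemma van_der_Corput_2_pos:
  fixes \<phi> \<phi>1 \<phi>2 :: "real \<Rightarrow> real"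
  assumes "a \<le> b" "m > 0"
    and d1: "\<And>x. x \<in> {a..b} \<Longrightarrow> (\<phi> has_real_derivative \<phi>1 x) (at x)"
    and d2: "\<And>x. x \<in> {a..b} \<Longrightarrow> (\<phi>1 has_real_derivative \<phi>2 x) (at x)"
    and m: "\<And>x. x \<in> {a..b} \<Longrightarrow> m \<le> \<phi>2 x"
  shows "norm (integral {a..b} (\<lambda>x. cis (\<phi> x))) \<le> 10 / sqrt m"
proof -
  \<comment> \<open>Balances the outer parts, 4 / (m \<eta>) each, against the removed interval of
    length 2 \<eta>: all are multiples of 1 / sqrt m, and 2 * 4 + 2 = 10.\<close>
  define \<eta> where "\<eta> = 1 / sqrt m"
  have \<eta>: "\<eta> > 0" "m * \<eta> = sqrt m" using \<open>m > 0\<close> by (auto simp: \<eta>_def field_simps)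
  have "norm (integral {a..b} (\<lambda>x. cis (\<phi> x))) \<le> 2 * (4 / sqrt m) + 2 * \<eta>"
  proof (rule integral_cut_out[OF \<open>a \<le> b\<close> \<eta>(1) \<open>m > 0\<close> _ _ _ d2 m])
    show "continuous_on {a..b} (\<lambda>x. cis (\<phi> x))"
      by (intro continuous_on_cis continuous_on_if_derivative[OF d1])
    fix c d assume cd: "a \<le> c" "c \<le> d" "d \<le> b"
      and "(\<forall>x\<in>{c..d}. m * \<eta> \<le> \<phi>1 x) \<or> (\<forall>x\<in>{c..d}. \<phi>1 x \<le> - (m * \<eta>))"
    then have "sqrt m \<le> \<bar>\<phi>1 x\<bar>" if "x \<in> {c..d}" for x
      using that \<eta>(2) by force
    moreover have "0 \<le> \<phi>2 x" if "x \<in> {c..d}" for x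
      using m[of x] that cd \<open>m > 0\<close> by auto
    ultimately show "norm (integral {c..d} (\<lambda>x. cis (\<phi> x))) \<le> 4 / sqrt m"
      using cd \<open>m > 0\<close> by (intro van_der_Corput_1[of _ _ _ \<phi> \<phi>1 \<phi>2] d1 d2) auto
  qed (use \<open>m > 0\<close> in auto)
  then show ?thesis by (simp add: \<eta>_def)
qed

lemma van_der_Corput_2:
  fixes \<phi> \<phi>1 \<phi>2 :: "real \<Rightarrow> real"
  assumes "a \<le> b" "m > 0"
    and d1: "\<And>x. x \<in> {a..b} \<Longrightarrow> (\<phi> has_real_derivative \<phi>1 x) (at x)"
    and d2: "\<And>x. x \<in> {a..b} \<Longrightarrow> (\<phi>1 has_real_derivative \<phi>2 x) (at x)"
    and m: "(\<forall>x\<in>{a..b}. m \<le> \<phi>2 x) \<or> (\<forall>x\<in>{a..b}. \<phi>2 x \<le> - m)"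
  shows "norm (integral {a..b} (\<lambda>x. cis (\<phi> x))) \<le> 10 / sqrt m"
  using m
proof
  assume "\<forall>x\<in>{a..b}. m \<le> \<phi>2 x"
  then show ?thesis using assms by (intro van_der_Corput_2_pos[of _ _ _ \<phi> \<phi>1 \<phi>2]) auto
next
  assume neg: "\<forall>x\<in>{a..b}. \<phi>2 x \<le> - m"
  have m': "m \<le> - \<phi>2 x" if "a \<le> x" "x \<le> b" for x
    using bspec[OF neg, of x] that by simp
  have "norm (integral {a..b} (\<lambda>x. cis (- \<phi> x))) \<le> 10 / sqrt m"
    using assms
    by (intro van_der_Corput_2_pos[of _ _ _ _ "\<lambda>x. - \<phi>1 x" "\<lambda>x. - \<phi>2 x"]) (auto intro!: DERIV_minus m')
  moreover have "continuous_on {a..b} \<phi>"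
    using d1 by (rule continuous_on_if_derivative)
  ultimately show ?thesis by (simp add: norm_integral_cis_uminus)
qed

lemma van_der_Corput_3_pos:
  fixes \<phi> \<phi>1 \<phi>2 \<phi>3 :: "real \<Rightarrow> real"
  assumes "a \<le> b" "m > 0"
    and d1: "\<And>x. x \<in> {a..b} \<Longrightarrow> (\<phi> has_real_derivative \<phi>1 x) (at x)"
    and d2: "\<And>x. x \<in> {a..b} \<Longrightarrow> (\<phi>1 has_real_derivative \<phi>2 x) (at x)"
    and d3: "\<And>x. x \<in> {a..b} \<Longrightarrow> (\<phi>2 has_real_derivative \<phi>3 x) (at x)"
    and m: "\<And>x. x \<in> {a..b} \<Longrightarrow> m \<le> \<phi>3 x"
  shows "norm (integral {a..b} (\<lambda>x. cis (\<phi> x))) \<le> 22 * m powr (-1/3)"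
proof -
  \<comment> \<open>Balances 10 / sqrt (m \<eta>) against \<eta>: both scale like m^(-1/3), and 2 *
    10 + 2 = 22.\<close>
  define \<eta> where "\<eta> = m powr (-1/3)"
  have \<eta>: "\<eta> > 0" using \<open>m > 0\<close> by (auto simp: \<eta>_def)
  have "m * \<eta> = m powr 1 * m powr (-1/3)" using \<open>m > 0\<close> by (simp add: \<eta>_def)
  also have "\<dots> = m powr (2/3)" unfolding powr_add[symmetric] by simp
  finally have m\<eta>: "m * \<eta> = m powr (2/3)" .
  have "1 / sqrt (m * \<eta>) = 1 / (m powr (2/3)) powr (1/2)"
    using \<open>m > 0\<close> unfolding m\<eta> by (simp add: powr_half_sqrt)
  also have "\<dots> = \<eta>" by (simp add: powr_powr \<eta>_def powr_minus_divide)
  finally have r: "1 / sqrt (m * \<eta>) = \<eta>" .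
  have "norm (integral {a..b} (\<lambda>x. cis (\<phi> x))) \<le> 2 * (10 / sqrt (m * \<eta>)) + 2 * \<eta>"
  proof (rule integral_cut_out[OF \<open>a \<le> b\<close> \<eta>(1) \<open>m > 0\<close> _ _ _ d3 m])
    show "continuous_on {a..b} (\<lambda>x. cis (\<phi> x))"
      by (intro continuous_on_cis continuous_on_if_derivative[OF d1])
    fix c d assume cd: "a \<le> c" "c \<le> d" "d \<le> b"
      and "(\<forall>x\<in>{c..d}. m * \<eta> \<le> \<phi>2 x) \<or> (\<forall>x\<in>{c..d}. \<phi>2 x \<le> - (m * \<eta>))"
    then show "norm (integral {c..d} (\<lambda>x. cis (\<phi> x))) \<le> 10 / sqrt (m * \<eta>)"
      using \<open>m > 0\<close> \<eta> by (intro van_der_Corput_2[of _ _ _ \<phi> \<phi>1 \<phi>2] d1 d2) auto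
  qed (use \<open>m > 0\<close> \<eta> in auto)
  then show ?thesis using r by (simp add: \<eta>_def)
qed

lemma van_der_Corput_3:
  fixes \<phi> \<phi>1 \<phi>2 \<phi>3 :: "real \<Rightarrow> real"
  assumes "a \<le> b" "m > 0"
    and d1: "\<And>x. x \<in> {a..b} \<Longrightarrow> (\<phi> has_real_derivative \<phi>1 x) (at x)"
    and d2: "\<And>x. x \<in> {a..b} \<Longrightarrow> (\<phi>1 has_real_derivative \<phi>2 x) (at x)"
    and d3: "\<And>x. x \<in> {a..b} \<Longrightarrow> (\<phi>2 has_real_derivative \<phi>3 x) (at x)"
    and m: "(\<forall>x\<in>{a..b}. m \<le> \<phi>3 x) \<or> (\<forall>x\<in>{a..b}. \<phi>3 x \<le> - m)"
  shows "norm (integral {a..b} (\<lambda>x. cis (\<phi> x))) \<le> 22 * m powr (-1/3)"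
  using m
proof
  assume "\<forall>x\<in>{a..b}. m \<le> \<phi>3 x"
  then show ?thesis using assms by (intro van_der_Corput_3_pos[of _ _ _ \<phi> \<phi>1 \<phi>2 \<phi>3]) auto
next
  assume neg: "\<forall>x\<in>{a..b}. \<phi>3 x \<le> - m"
  have m': "m \<le> - \<phi>3 x" if "a \<le> x" "x \<le> b" for x
    using bspec[OF neg, of x] that by simp
  have "norm (integral {a..b} (\<lambda>x. cis (- \<phi> x))) \<le> 22 * m powr (-1/3)"
    using assms
    by (intro van_der_Corput_3_pos[of _ _ _ _ "\<lambda>x. - \<phi>1 x" "\<lambda>x. - \<phi>2 x" "\<lambda>x. - \<phi>3 x"])
       (auto intro!: DERIV_minus m')
  moreover have "continuous_on {a..b} \<phi>"
    using d1 by (rule continuous_on_if_derivative)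
  ultimately show ?thesis by (simp add: norm_integral_cis_uminus)
qed

section \<open>Oscillatory integrals over a full period\<close>

lemma norm_integral_cells:
  fixes f :: "real \<Rightarrow> 'a::banach"
  assumes "continuous_on UNIV f" "h \<ge> 0"
    and "\<And>k. norm (integral {a + real k * h..a + real (Suc k) * h} f) \<le> M"
  shows "norm (integral {a..a + real N * h} f) \<le> real N * M"
proof (induction N)
  case (Suc N)
  have "f integrable_on {a..a + real (Suc N) * h}"
    using assms(1) by (intro integrable_continuous_real) (auto intro: continuous_on_subset)
  then have "integral {a..a + real (Suc N) * h} f
      = integral {a..a + real N * h} f + integral {a + real N * h..a + real (Suc N) * h} f"
    using assms(2) by (intro Henstock_Kurzweil_Integration.integral_combine[symmetric])
      (auto simp: algebra_simps)
  then have "norm (integral {a..a + real (Suc N) * h} f) \<le> real N * M + M"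
    using norm_triangle_mono[OF Suc assms(3)[of N]] by simp
  then show ?case by (simp add: algebra_simps)
qed simp

text \<open>The Lipschitz conditions let a lower bound at one point persist on a cell of length
  \<theta> / (2 \<Lambda>). Only \<Lambda> and \<theta> enter the resulting constants, which is how
  uniformity in \<alpha> is carried along.\<close>

definition nondegenerate_phase ::
    "real \<Rightarrow> real \<Rightarrow> (real \<Rightarrow> real) \<Rightarrow> (real \<Rightarrow> real) \<Rightarrow> (real \<Rightarrow> real) \<Rightarrow> (real \<Rightarrow> real) \<Rightarrow> bool" where
  "nondegenerate_phase \<Lambda> \<theta> w w1 w2 w3 \<longleftrightarrow>
    (\<forall>x. (w has_real_derivative w1 x) (at x)) \<and> (\<forall>x. (w1 has_real_derivative w2 x) (at x)) \<and>
    (\<forall>x. (w2 has_real_derivative w3 x) (at x)) \<and>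
    (\<forall>x y. \<bar>w2 x - w2 y\<bar> \<le> \<Lambda> * \<bar>x - y\<bar>) \<and> (\<forall>x y. \<bar>w3 x - w3 y\<bar> \<le> \<Lambda> * \<bar>x - y\<bar>) \<and>
    (\<forall>x. \<theta> \<le> \<bar>w2 x\<bar> \<or> \<theta> \<le> \<bar>w3 x\<bar>)"

text \<open>On so short a cell, whichever of w'' and w''' is large at a keeps its sign and half its
  size, so the test of order 2 or 3 applies; the linear phase has vanished after two derivatives.
  For t \<ge> 1 the rate 1/2 is better than 1/3, and c \<le> 1 lets 1/c dominate both
  constants.\<close>

lemma oscillatory_cell:
  assumes w: "nondegenerate_phase \<Lambda> \<theta> w w1 w2 w3" and t: "t \<ge> 1" and ab: "a \<le> b"
    and \<Lambda>: "\<Lambda> \<ge> 0" "\<Lambda> * (b - a) \<le> \<theta> / 2" and c: "0 < c" "c \<le> 1" "c \<le> \<theta> / 2"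
  shows "norm (integral {a..b} (\<lambda>x. cis (y * x - t * w x))) \<le> 22 / c * t powr (-1/3)"
proof -
  have d: "(w has_real_derivative w1 x) (at x)" "(w1 has_real_derivative w2 x) (at x)"
     "(w2 has_real_derivative w3 x) (at x)" for x
    using w by (auto simp: nondegenerate_phase_def)
  have l: "\<bar>w2 x - w2 a\<bar> \<le> \<theta> / 2" "\<bar>w3 x - w3 a\<bar> \<le> \<theta> / 2" if "x \<in> {a..b}" for x
  proof -
    have "\<Lambda> * \<bar>x - a\<bar> \<le> \<Lambda> * (b - a)" using that \<Lambda> by (intro mult_left_mono) auto
    then show "\<bar>w2 x - w2 a\<bar> \<le> \<theta> / 2" "\<bar>w3 x - w3 a\<bar> \<le> \<theta> / 2"
      using w \<Lambda> unfolding nondegenerate_phase_def by (meson order_trans)+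
  qed
  have ge: "t * c \<le> t * v" if "\<theta> / 2 \<le> v" for v
    using that c t by (intro mult_left_mono) auto
  have tc: "t * c > 0" using t c by simp
  have d1: "((\<lambda>x. y * x - t * w x) has_real_derivative y - t * w1 x) (at x)"
    and d2: "((\<lambda>x. y - t * w1 x) has_real_derivative - t * w2 x) (at x)"
    and d3: "((\<lambda>x. - t * w2 x) has_real_derivative - t * w3 x) (at x)" for x
    using d by (auto intro!: derivative_eq_intros)
  from w consider "\<theta> \<le> \<bar>w2 a\<bar>" | "\<theta> \<le> \<bar>w3 a\<bar>"
    unfolding nondegenerate_phase_def by blast
  then show ?thesis
  proof cases
    case 1
    then have "(\<forall>x\<in>{a..b}. t * c \<le> - t * w2 x) \<or> (\<forall>x\<in>{a..b}. - t * w2 x \<le> - (t * c))"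
    proof (cases "w2 a \<ge> 0")
      case True
      then have "\<theta> / 2 \<le> w2 x" if "x \<in> {a..b}" for x using l(1)[OF that] 1 by linarith
      then show ?thesis using ge by auto
    next
      case False
      then have "\<theta> / 2 \<le> - w2 x" if "x \<in> {a..b}" for x using l(1)[OF that] 1 by linarith
      then show ?thesis using ge by fastforce
    qed
    from van_der_Corput_2[OF ab tc d1 d2 this]
    have "norm (integral {a..b} (\<lambda>x. cis (y * x - t * w x))) \<le> 10 / sqrt (t * c)" .
    also have "\<dots> = 10 * c powr (-1/2) * t powr (-1/2)"
      using t c by (simp add: powr_minus_divide powr_half_sqrt real_sqrt_mult)
    also have "\<dots> \<le> 10 * c powr (-1) * t powr (-1/3)"
      using t c by (intro mult_mono powr_mono powr_mono') auto
    also have "\<dots> \<le> 22 / c * t powr (-1/3)"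
      using c by (intro mult_right_mono) (auto simp: powr_minus_divide divide_right_mono)
    finally show ?thesis .
  next
    case 2
    then have "(\<forall>x\<in>{a..b}. t * c \<le> - t * w3 x) \<or> (\<forall>x\<in>{a..b}. - t * w3 x \<le> - (t * c))"
    proof (cases "w3 a \<ge> 0")
      case True
      then have "\<theta> / 2 \<le> w3 x" if "x \<in> {a..b}" for x using l(2)[OF that] 2 by linarith
      then show ?thesis using ge by auto
    next
      case False
      then have "\<theta> / 2 \<le> - w3 x" if "x \<in> {a..b}" for x using l(2)[OF that] 2 by linarith
      then show ?thesis using ge by fastforce
    qed
    from van_der_Corput_3[OF ab tc d1 d2 d3 this]
    have "norm (integral {a..b} (\<lambda>x. cis (y * x - t * w x))) \<le> 22 * (t * c) powr (-1/3)" .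
    also have "\<dots> = 22 * c powr (-1/3) * t powr (-1/3)"
      using t c by (simp add: powr_mult)
    also have "\<dots> \<le> 22 * c powr (-1) * t powr (-1/3)"
      using t c by (intro mult_mono powr_mono powr_mono') auto
    also have "\<dots> = 22 / c * t powr (-1/3)"
      using c by (simp add: powr_minus_divide)
    finally show ?thesis .
  qed
qed

lemma oscillatory_integral_bound:
  assumes "\<theta> > 0" "\<Lambda> > 0"
  shows "\<exists>C>0. \<forall>w w1 w2 w3 y t. nondegenerate_phase \<Lambda> \<theta> w w1 w2 w3 \<longrightarrow> 1 \<le> \<bar>t\<bar> \<longrightarrow>
    norm (integral {-pi..pi} (\<lambda>x. cis (y * x - t * w x))) \<le> C * \<bar>t\<bar> powr (-1/3)"
proof -
  \<comment> \<open>Enough cells that each has length h = 2 pi / N with \<Lambda> h \<le> \<theta> /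
    2.\<close>
  define N where "N = Suc (nat \<lceil>4 * pi * \<Lambda> / \<theta>\<rceil>)"
  define h where "h = 2 * pi / real N"
  define c where "c = min 1 (\<theta> / 2)"
  have N: "real N > 0" by (simp add: N_def)
  then have h: "h > 0" "real N * h = 2 * pi" by (auto simp: h_def)
  have "4 * pi * \<Lambda> / \<theta> \<le> real N" unfolding N_def by linarith
  then have \<Lambda>h: "\<Lambda> * h \<le> \<theta> / 2"
    using assms N by (simp add: h_def field_simps)
  have c: "0 < c" "c \<le> 1" "c \<le> \<theta> / 2" using assms by (auto simp: c_def)
  show ?thesis
  proof (intro exI[of _ "real N * (22 / c)"] conjI allI impI)
    show "0 < real N * (22 / c)" using c by (simp add: N_def)
    fix w w1 w2 w3 :: "real \<Rightarrow> real" and y t :: real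
    assume w: "nondegenerate_phase \<Lambda> \<theta> w w1 w2 w3" and t: "1 \<le> \<bar>t\<bar>"
    have wc: "continuous_on S w" for S
      by (rule continuous_on_if_derivative[where f' = w1]) (use w in \<open>simp add: nondegenerate_phase_def\<close>)
    have pos: "norm (integral {-pi..pi} (\<lambda>x. cis (y * x - t * w x))) \<le> real N * (22 / c * t powr (-1/3))"
      if "t \<ge> 1" for y t
    proof -
      have "norm (integral {-pi..-pi + real N * h} (\<lambda>x. cis (y * x - t * w x)))
          \<le> real N * (22 / c * t powr (-1/3))"
        using h(1) c \<Lambda>h assms
        by (intro norm_integral_cells oscillatory_cell[OF w that] continuous_intros wc)
           (auto simp: algebra_simps)
      then show ?thesis unfolding h(2) by simp
    qed
    have "norm (integral {-pi..pi} (\<lambda>x. cis (y * x - t * w x))) \<le> real N * (22 / c * \<bar>t\<bar> powr (-1/3))"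
    proof (cases "t \<ge> 0")
      case True
      then show ?thesis using pos[of t y] t by simp
    next
      case False
      \<comment> \<open>Conjugation reverses the sign of y and t together, which reduces negative
        times to positive ones.\<close>
      have "norm (integral {-pi..pi} (\<lambda>x. cis (- (y * x - t * w x))))
          = norm (integral {-pi..pi} (\<lambda>x. cis (y * x - t * w x)))"
        by (intro norm_integral_cis_uminus continuous_intros wc)
      then show ?thesis using pos[of "-t" "-y"] t False by simp
    qed
    then show "norm (integral {-pi..pi} (\<lambda>x. cis (y * x - t * w x))) \<le> real N * (22 / c) * \<bar>t\<bar> powr (-1/3)"
      by (simp add: mult.assoc)
  qed
qed


section \<open>The dispersive estimate\<close>

lemma DERIV_trig_series:
  fixes a :: "nat \<Rightarrow> real"
  assumes a: "summable (\<lambda>n. \<bar>a n\<bar> * real (Suc n))"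
  shows "((\<lambda>x. \<Sum>n. a n * sin (real (Suc n) * x)) has_real_derivative
      (\<Sum>n. a n * real (Suc n) * cos (real (Suc n) * x))) (at x)" (is ?s)
    and "((\<lambda>x. \<Sum>n. a n * cos (real (Suc n) * x)) has_real_derivative
      (\<Sum>n. - (a n * real (Suc n)) * sin (real (Suc n) * x))) (at x)" (is ?c)
proof -
  have le: "\<bar>a n * v\<bar> \<le> \<bar>a n\<bar> * real (Suc n)" if "\<bar>v\<bar> \<le> 1" for n v
    using that by (auto simp: abs_mult intro!: mult_left_mono)
  have le': "\<bar>a n * real (Suc n) * v\<bar> \<le> \<bar>a n\<bar> * real (Suc n)" if "\<bar>v\<bar> \<le> 1" for n v
    using mult_left_mono[OF that, of "\<bar>a n\<bar> * real (Suc n)"] by (simp add: abs_mult)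
  have sm: "summable (\<lambda>n. a n * v n)" if "\<And>n. \<bar>v n\<bar> \<le> 1" for v
    by (rule summable_comparison_test'[OF a, of 0]) (use le[OF that] in simp)
  show ?s
    unfolding has_real_derivative_iff_has_vector_derivative
  proof (rule has_vector_derivative_series[where S = UNIV])
    show "((\<lambda>x. a n * sin (real (Suc n) * x)) has_vector_derivative
        a n * real (Suc n) * cos (real (Suc n) * x)) (at x)" for n x
      unfolding has_real_derivative_iff_has_vector_derivative[symmetric]
      by (auto intro!: derivative_eq_intros)
    show "uniform_limit UNIV (\<lambda>n x. \<Sum>i<n. a i * real (Suc i) * cos (real (Suc i) * x))
        (\<lambda>x. \<Sum>n. a n * real (Suc n) * cos (real (Suc n) * x)) sequentially"
      by (rule Weierstrass_m_test[OF _ a]) (use le' in auto)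
    show "summable (\<lambda>n. a n * sin (real (Suc n) * x))" for x
      by (rule sm) simp
  qed auto
  show ?c
    unfolding has_real_derivative_iff_has_vector_derivative
  proof (rule has_vector_derivative_series[where S = UNIV])
    show "((\<lambda>x. a n * cos (real (Suc n) * x)) has_vector_derivative
        - (a n * real (Suc n)) * sin (real (Suc n) * x)) (at x)" for n x
      unfolding has_real_derivative_iff_has_vector_derivative[symmetric]
      by (auto intro!: derivative_eq_intros)
    show "uniform_limit UNIV (\<lambda>n x. \<Sum>i<n. - (a i * real (Suc i)) * sin (real (Suc i) * x))
        (\<lambda>x. \<Sum>n. - (a n * real (Suc n)) * sin (real (Suc n) * x)) sequentially"
      by (rule Weierstrass_m_test[OF _ a]) (use le' in auto)
    show "summable (\<lambda>n. a n * cos (real (Suc n) * x))" for x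
      by (rule sm) simp
  qed auto
qed

text \<open>Two of the eight factors telescope, since 1/(j+1)^2 \<le> 1/j - 1/(j+1); the other six
  are frozen at the first term of the tail. This gives 1/64 for m = 1 and about 0.18 for m =
  2.\<close>

lemma tail_bound:
  fixes m :: nat
  assumes m: "m \<in> {1, 2}"
  shows "summable (\<lambda>k. (real m / real (Suc (k + m))) ^ 8)"
    and "(\<Sum>k. (real m / real (Suc (k + m))) ^ 8) \<le> 1 / 4"
proof -
  define f where "f k = 1 / real (k + m)" for k
  define \<rho> where "\<rho> = (real m / real (Suc m)) ^ 6 * (real m)\<^sup>2"
  have m0: "m > 0" using m by auto
  have "f \<longlonglongrightarrow> 0" unfolding f_def by real_asymp
  from telescope_sums'[OF this] have "(\<lambda>k. f k - f (Suc k)) sums (f 0 - 0)" .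
  from sums_mult[OF this, of \<rho>] have s: "(\<lambda>k. \<rho> * (f k - f (Suc k))) sums (\<rho> * (1 / real m))"
    by (simp add: f_def)
  have le: "(real m / real (Suc (k + m))) ^ 8 \<le> \<rho> * (f k - f (Suc k))" for k
  proof -
    have "(real m / real (Suc (k + m))) ^ 8 = (real m / real (Suc (k + m))) ^ 6 * (real m / real (Suc (k + m))) ^ 2"
      unfolding power_add[symmetric] by simp
    also have "\<dots> \<le> (real m / real (Suc m)) ^ 6 * ((real m)\<^sup>2 * (f k - f (Suc k)))"
    proof (intro mult_mono power_mono divide_left_mono)
      have "f k - f (Suc k) = 1 / (real (k + m) * real (Suc (k + m)))"
        using m0 by (simp add: f_def field_simps)
      moreover have le: "1 / (real (Suc (k + m)))\<^sup>2 \<le> 1 / (real (k + m) * real (Suc (k + m)))"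
        using m0 unfolding power2_eq_square by (intro divide_left_mono mult_right_mono) auto
      ultimately show "(real m / real (Suc (k + m))) ^ 2 \<le> (real m)\<^sup>2 * (f k - f (Suc k))"
        using mult_left_mono[OF le, of "(real m)\<^sup>2"] by (simp add: power_divide)
    qed (use m0 in auto)
    finally show ?thesis by (simp add: \<rho>_def)
  qed
  show sm: "summable (\<lambda>k. (real m / real (Suc (k + m))) ^ 8)"
    by (rule summable_comparison_test'[OF sums_summable[OF s], of 0]) (use le in auto)
  have "(\<Sum>k. (real m / real (Suc (k + m))) ^ 8) \<le> \<rho> * (1 / real m)"
    unfolding sums_unique[OF s] using sm s le by (intro suminf_le) (auto simp: sums_iff)
  also have "\<dots> \<le> 1 / 4" using m by (auto simp: \<rho>_def power_divide)
  finally show "(\<Sum>k. (real m / real (Suc (k + m))) ^ 8) \<le> 1 / 4" .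
qed

text \<open>Index n stands for distance n + 1: \<open>v (m - 1)\<close> is the term at distance m,
  \<open>v (k + m)\<close> the one at distance k + m + 1. In use M is the coefficient of the leading
  term, so the tail amounts to at most a quarter of it.\<close>

lemma leading_term:
  fixes v :: "nat \<Rightarrow> real"
  assumes m: "m \<in> {1, 2}"
    and v0: "\<And>i. Suc i < m \<Longrightarrow> v i = 0"
    and tail: "\<And>k. \<bar>v (k + m)\<bar> \<le> M * (real m / real (Suc (k + m))) ^ 8"
  shows "summable (\<lambda>n. \<bar>v n\<bar>)" and "\<bar>(\<Sum>n. v n) - v (m - 1)\<bar> \<le> M / 4"
proof -
  note tb = tail_bound[OF m]
  have st: "summable (\<lambda>k. \<bar>v (k + m)\<bar>)"
    by (rule summable_comparison_test'[OF summable_mult[OF tb(1), of M], of 0]) (use tail in auto)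
  then show sm: "summable (\<lambda>n. \<bar>v n\<bar>)"
    by (rule summable_iff_shift[THEN iffD1])
  have M: "M \<ge> 0"
  proof -
    have "0 \<le> M * (real m / real (Suc (0 + m))) ^ 8" using tail[of 0] by linarith
    then show ?thesis using m by (auto simp: zero_le_mult_iff)
  qed
  have "(\<Sum>i<m. v i) = v (m - 1)"
    using m v0 by (auto simp: numeral_2_eq_2)
  then have "(\<Sum>n. v n) - v (m - 1) = (\<Sum>k. v (k + m))"
    using suminf_split_initial_segment[OF summable_rabs_cancel[OF sm], of m] by simp
  also have "\<bar>\<dots>\<bar> \<le> (\<Sum>k. \<bar>v (k + m)\<bar>)"
    by (rule summable_rabs[OF st])
  also have "\<dots> \<le> (\<Sum>k. M * (real m / real (Suc (k + m))) ^ 8)"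
    by (intro suminf_le tail st summable_mult tb)
  also have "\<dots> \<le> M * (1 / 4)"
    unfolding suminf_mult[OF tb(1)] by (intro mult_left_mono tb M)
  finally show "\<bar>(\<Sum>n. v n) - v (m - 1)\<bar> \<le> M / 4" by simp
qed

section \<open>The Fourier multiplier of \<open>lapk K\<close> and its derivatives\<close>

definition symbol :: "(int \<Rightarrow> real) \<Rightarrow> real \<Rightarrow> real" where
  "symbol K x = (\<Sum>n. 2 * K (int (Suc n)) * (1 - cos (real (Suc n) * x)))"

text \<open>\<open>m = 1\<close> covers the operators themselves, and \<open>m = 2\<close> the difference of a fractional operator
  and the nearest-neighbour one.\<close>

locale decaying_kernel = even_kernel +
  fixes c :: real and m :: nat
  assumes m: "m \<in> {1, 2}" and c: "c > 0"
    and K_small: "\<And>j. 0 < j \<Longrightarrow> j < m \<Longrightarrow> K (int j) = 0"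
    and K_m: "K (int m) = c"
    and K_large: "\<And>j. m < j \<Longrightarrow> \<bar>K (int j)\<bar> \<le> c * (real m / real j) ^ 12"
begin

abbreviation "a n \<equiv> 2 * K (int (Suc n))"

text \<open>p counts derivatives of the symbol and v is the bounded trigonometric factor. Fourth
  derivatives occur as Lipschitz constants of third ones; twelve powers of decay minus four leave
  the eight of \<open>tail_bound\<close>.\<close>

lemma symbol_terms:
  assumes p: "p \<le> 4" and v: "\<And>n. \<bar>v n\<bar> \<le> 1"
  shows "summable (\<lambda>n. \<bar>a n * real (Suc n) ^ p * v n\<bar>)"
    and "\<bar>(\<Sum>n. a n * real (Suc n) ^ p * v n) - 2 * c * real m ^ p * v (m - 1)\<bar> \<le> c * real m ^ p / 2"
proof -
  have m0: "m > 0" using m by auto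
  have tail: "\<bar>a (k + m) * real (Suc (k + m)) ^ p * v (k + m)\<bar>
      \<le> (2 * c * real m ^ p) * (real m / real (Suc (k + m))) ^ 8" for k
  proof -
    define q where "q = real m / real (Suc (k + m))"
    have q: "0 < q" "q \<le> 1" "real (Suc (k + m)) * q = real m" using m0 by (auto simp: q_def)
    have "q ^ 12 * real (Suc (k + m)) ^ p = (real (Suc (k + m)) * q) ^ p * q ^ (12 - p)"
      using p by (simp add: power_mult_distrib flip: power_add)
    also have "\<dots> \<le> real m ^ p * q ^ 8"
      unfolding q(3) using q p by (intro mult_left_mono power_decreasing) auto
    finally have 1: "q ^ 12 * real (Suc (k + m)) ^ p \<le> real m ^ p * q ^ 8" .
    have "\<bar>a (k + m) * real (Suc (k + m)) ^ p * v (k + m)\<bar>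
        = 2 * \<bar>K (int (Suc (k + m)))\<bar> * real (Suc (k + m)) ^ p * \<bar>v (k + m)\<bar>"
      by (simp add: abs_mult)
    also have "\<dots> \<le> 2 * (c * q ^ 12) * real (Suc (k + m)) ^ p * 1"
      unfolding q_def using c v by (intro mult_mono K_large) auto
    also have "\<dots> = 2 * c * (q ^ 12 * real (Suc (k + m)) ^ p)" by simp
    also have "\<dots> \<le> 2 * c * (real m ^ p * q ^ 8)"
      using c 1 by (intro mult_left_mono) auto
    finally show ?thesis by (simp add: q_def mult_ac)
  qed
  have z: "a i * real (Suc i) ^ p * v i = 0" if "Suc i < m" for i
    using K_small[of "Suc i"] that by simp
  from leading_term[OF m z tail]
  show "summable (\<lambda>n. \<bar>a n * real (Suc n) ^ p * v n\<bar>)"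
    "\<bar>(\<Sum>n. a n * real (Suc n) ^ p * v n) - 2 * c * real m ^ p * v (m - 1)\<bar> \<le> c * real m ^ p / 2"
    using m0 K_m by simp_all
qed

lemma summable_a: "p \<le> 4 \<Longrightarrow> summable (\<lambda>n. \<bar>a n * real (Suc n) ^ p\<bar>)"
  using symbol_terms(1)[of p "\<lambda>_. 1"] by simp

text \<open>Up to c m^p / 2, the p-th derivative is 2 c m^p times a sine or cosine of m x, apart
  from sign. Since m \<le> 2 and p \<le> 4, it is at most 5/2 * 16 c = 40 c. Of sine and cosine one
  is at least 1/2 in modulus, and there c m^p - c m^p / 2 \<ge> c / 2.\<close>

lemma symbol_nondegenerate:
  "\<exists>w1 w2 w3. nondegenerate_phase (40 * c) (c / 2) (symbol K) w1 w2 w3"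
proof -
  have m0: "m > 0" and m2: "m \<le> 2" using m by auto
  define w1 where "w1 x = (\<Sum>n. a n * real (Suc n) ^ 1 * sin (real (Suc n) * x))" for x
  define w2 where "w2 x = (\<Sum>n. a n * real (Suc n) ^ 2 * cos (real (Suc n) * x))" for x
  define w3 where "w3 x = (\<Sum>n. a n * real (Suc n) ^ 3 * (- sin (real (Suc n) * x)))" for x
  define w4 where "w4 x = (\<Sum>n. a n * real (Suc n) ^ 4 * (- cos (real (Suc n) * x)))" for x
  have sm: "summable (\<lambda>n. \<bar>a n * real (Suc n) ^ p\<bar> * real (Suc n))" if "p \<le> 3" for p
    using summable_a[of "Suc p"] that by (simp add: abs_mult mult_ac)
  have d0: "(symbol K has_real_derivative w1 x) (at x)" for x
  proof -
    have "symbol K = (\<lambda>x. (\<Sum>n. a n) - (\<Sum>n. a n * real (Suc n) ^ 0 * cos (real (Suc n) * x)))"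
      unfolding symbol_def
      using summable_rabs_cancel[OF summable_a[of 0]]
        summable_rabs_cancel[OF symbol_terms(1)[of 0 "\<lambda>n. cos (real (Suc n) * _)"]]
      by (subst suminf_diff) (auto simp: algebra_simps)
    moreover have "((\<lambda>x. (\<Sum>n. a n) - (\<Sum>n. a n * real (Suc n) ^ 0 * cos (real (Suc n) * x)))
        has_real_derivative 0 - (\<Sum>n. - (a n * real (Suc n) ^ 0 * real (Suc n)) * sin (real (Suc n) * x))) (at x)"
      by (intro DERIV_diff DERIV_const DERIV_trig_series sm) simp
    moreover have "0 - (\<Sum>n. - (a n * real (Suc n) ^ 0 * real (Suc n)) * sin (real (Suc n) * x)) = w1 x"
    proof -
      have "summable (\<lambda>n. a n * real (Suc n) ^ 1 * sin (real (Suc n) * x))"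
        by (rule summable_rabs_cancel[OF symbol_terms(1)]) auto
      from suminf_minus[OF this] show ?thesis by (simp add: w1_def)
    qed
    ultimately show ?thesis by metis
  qed
  have d1: "(w1 has_real_derivative w2 x) (at x)" for x
    using DERIV_trig_series(1)[OF sm[of 1], of x] by (simp add: w1_def[abs_def] w2_def power2_eq_square mult_ac)
  have d2: "(w2 has_real_derivative w3 x) (at x)" for x
    using DERIV_trig_series(2)[OF sm[of 2], of x]
    by (simp add: w2_def[abs_def] w3_def power2_eq_square power3_eq_cube mult_ac)
  have d3: "(w3 has_real_derivative w4 x) (at x)" for x
  proof -
    have "w3 = (\<lambda>x. - (\<Sum>n. a n * real (Suc n) ^ 3 * sin (real (Suc n) * x)))"
      unfolding w3_def using summable_rabs_cancel[OF symbol_terms(1)[of 3 "\<lambda>n. sin (real (Suc n) * _)"]]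
      by (simp add: suminf_minus)
    moreover have "w4 x = - (\<Sum>n. a n * real (Suc n) ^ 3 * real (Suc n) * cos (real (Suc n) * x))"
      unfolding w4_def using summable_rabs_cancel[OF symbol_terms(1)[of 4 "\<lambda>n. cos (real (Suc n) * x)"]]
      by (simp add: suminf_minus mult_ac power_numeral_reduce)
    ultimately show ?thesis
      using DERIV_minus[OF DERIV_trig_series(1)[OF sm[of 3], of x]] by simp
  qed
  have sz: "real (Suc (m - 1)) = real m" using m0 by simp
  have b: "\<bar>w2 x - 2 * c * real m ^ 2 * cos (real m * x)\<bar> \<le> c * real m ^ 2 / 2"
    "\<bar>w3 x - 2 * c * real m ^ 3 * (- sin (real m * x))\<bar> \<le> c * real m ^ 3 / 2"
    "\<bar>w4 x - 2 * c * real m ^ 4 * (- cos (real m * x))\<bar> \<le> c * real m ^ 4 / 2" for x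
    unfolding w2_def w3_def w4_def
    using symbol_terms(2)[of 2 "\<lambda>n. cos (real (Suc n) * x)"]
      symbol_terms(2)[of 3 "\<lambda>n. - sin (real (Suc n) * x)"]
      symbol_terms(2)[of 4 "\<lambda>n. - cos (real (Suc n) * x)"] unfolding sz by auto
  have up: "\<bar>u\<bar> \<le> 40 * c"
    if "\<bar>u - 2 * c * real m ^ p * s\<bar> \<le> c * real m ^ p / 2" "\<bar>s\<bar> \<le> 1" "p \<le> 4" for u s :: real and p
  proof -
    have "\<bar>2 * c * real m ^ p * s\<bar> \<le> 2 * c * real m ^ p * 1"
      unfolding abs_mult using c that by (intro mult_mono) auto
    moreover have "real m ^ p \<le> 2 ^ 4"
      using m0 m2 that(3) by (intro order_trans[OF power_increasing[of p 4 "real m"] power_mono]) auto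
    then have "c * real m ^ p \<le> c * 2 ^ 4" using c by (intro mult_left_mono) auto
    moreover have "\<bar>u\<bar> \<le> 40 * c"
      if "\<bar>X\<bar> \<le> 2 * Y" "Y \<le> c * 16" "\<bar>u - X\<bar> \<le> Y / 2" for X Y :: real
      using that by linarith
    ultimately show ?thesis
      using that(1) by (simp add: mult.assoc)
  qed
  have lip: "\<bar>g x - g y\<bar> \<le> 40 * c * \<bar>x - y\<bar>"
    if "\<And>x. (g has_real_derivative g' x) (at x)" "\<And>x. \<bar>g' x\<bar> \<le> 40 * c" for g g' :: "real \<Rightarrow> real" and x y
    using field_differentiable_bound[of UNIV g g' "40 * c" x y] that by auto
  have lo: "c / 2 \<le> \<bar>u\<bar>" if "\<bar>u - 2 * c * real m ^ p * s\<bar> \<le> c * real m ^ p / 2" "1 / 2 \<le> \<bar>s\<bar>" for u s :: real and p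
  proof -
    have "2 * c * real m ^ p * (1 / 2) \<le> 2 * c * real m ^ p * \<bar>s\<bar>"
      using that(2) c by (intro mult_left_mono) auto
    also have "\<dots> = \<bar>2 * c * real m ^ p * s\<bar>" using c by (simp add: abs_mult)
    finally have "c * real m ^ p / 2 \<le> \<bar>u\<bar>" using that(1) by linarith
    moreover have "c * 1 \<le> c * real m ^ p" using c m0 by (intro mult_left_mono) auto
    ultimately show ?thesis by simp
  qed
  have "c / 2 \<le> \<bar>w2 x\<bar> \<or> c / 2 \<le> \<bar>w3 x\<bar>" for x
  proof -
    have "1 / 2 \<le> \<bar>cos (real m * x)\<bar> \<or> 1 / 2 \<le> \<bar>- sin (real m * x)\<bar>"
    proof (rule ccontr)
      assume "\<not> ?thesis"
      then have "\<bar>cos (real m * x)\<bar>\<^sup>2 < (1 / 2)\<^sup>2" "\<bar>sin (real m * x)\<bar>\<^sup>2 < (1 / 2)\<^sup>2"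
        by (intro power_strict_mono; simp)+
      then show False using sin_cos_squared_add[of "real m * x"] by (simp add: power2_eq_square)
    qed
    then show ?thesis using lo b by blast
  qed
  then have "nondegenerate_phase (40 * c) (c / 2) (symbol K) w1 w2 w3"
    unfolding nondegenerate_phase_def
    using d0 d1 d2 lip[OF d2 up[OF b(2)]] lip[OF d3 up[OF b(3)]] by auto
  then show ?thesis by blast
qed

end


section \<open>Fourier representation of the flow\<close>

lemma integral_cis_int:
  "integral {-pi..pi} (\<lambda>x. cis (of_int n * x)) = (if n = 0 then 2 * pi else 0)"
proof (cases "n = 0")
  case False
  have "((\<lambda>x. cis (of_int n * x)) has_integral
      - \<i> * cis (of_int n * pi) / of_int n - (- \<i> * cis (of_int n * (- pi)) / of_int n)) {-pi..pi}"
  proof (rule fundamental_theorem_of_calculus)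
    fix x
    have "((\<lambda>x. cis (of_int n * x)) has_derivative (\<lambda>h. (of_int n * h) *\<^sub>R (\<i> * cis (of_int n * x))))
        (at x within {-pi..pi})"
      by (auto intro!: derivative_eq_intros)
    then have "((\<lambda>x. cis (of_int n * x)) has_vector_derivative of_int n *\<^sub>R (\<i> * cis (of_int n * x)))
        (at x within {-pi..pi})"
      unfolding has_vector_derivative_def by (rule has_derivative_eq_rhs) (auto simp: mult_ac)
    from bounded_linear.has_vector_derivative[OF bounded_linear_mult_right[of "- \<i> / of_int n"] this]
    show "((\<lambda>x. - \<i> * cis (of_int n * x) / of_int n) has_vector_derivative cis (of_int n * x))
        (at x within {-pi..pi})"
      using False by (simp add: scaleR_conv_of_real)
  qed simp
  moreover have "cis (of_int n * pi) = cis (of_int n * (- pi))"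
    using sin_npi_int[of n] by (simp add: complex_eq_iff mult.commute)
  ultimately show ?thesis using False by (simp add: integral_unique)
qed (simp add: scaleR_conv_of_real)

context even_kernel
begin

lemma summable_K_Suc: "summable (\<lambda>i. \<bar>K (int (Suc i))\<bar>)"
proof -
  have "(\<lambda>j. \<bar>K j\<bar>) summable_on range (\<lambda>i. int (Suc i))"
    using abs_summable by (rule summable_on_subset_banach) auto
  then have "((\<lambda>j. \<bar>K j\<bar>) \<circ> (\<lambda>i. int (Suc i))) summable_on UNIV"
    by (subst (asm) summable_on_reindex) (auto simp: inj_on_def)
  then show ?thesis by (intro summable_on_imp_summable) (simp add: o_def)
qed

text \<open>Pairing j with -j turns the unordered sum into a series over distances, whose partial
  sums correspond to those of the symbol.\<close>

lemma seq_lapk_sums: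
  "(\<lambda>i. of_real (K (int (Suc i))) * (2 * seq f n - seq f (n - int (Suc i)) - seq f (n + int (Suc i))))
    sums seq (lapk K f) n"
proof -
  define g where "g j = K j *\<^sub>R (seq f n - seq f (n - j))" for j
  have g: "(g has_sum seq (lapk K f) n) UNIV"
    unfolding g_def by (rule seq_lapk_has_sum)
  have inj: "inj (\<lambda>i. int (Suc i))" "inj (\<lambda>i. - int (Suc i))" by (auto simp: inj_on_def)
  let ?P = "range (\<lambda>i. int (Suc i))" and ?N = "range (\<lambda>i. - int (Suc i))"
  have sg: "(g has_sum infsum g A) A" for A
    using g by (meson has_sum_infsum has_sum_imp_summable subset_UNIV summable_on_subset_banach)
  have P: "((\<lambda>i. g (int (Suc i))) has_sum infsum g ?P) UNIV"
    using sg[of ?P] has_sum_reindex[OF inj(1), of g "infsum g ?P"] by (simp add: o_def)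
  have N: "((\<lambda>i. g (- int (Suc i))) has_sum infsum g ?N) UNIV"
    using sg[of ?N] has_sum_reindex[OF inj(2), of g "infsum g ?N"] by (simp add: o_def)
  have "(g has_sum infsum g ?P + infsum g ?N) (?P \<union> ?N)"
    by (intro has_sum_Un_disjoint sg) auto
  moreover have "g j = 0" if "j \<notin> ?P \<union> ?N" for j
  proof -
    consider "j = int (Suc (nat (j - 1)))" | "j = - int (Suc (nat (- j - 1)))" | "j = 0" by linarith
    then show ?thesis
    proof cases
      case 3
      then show ?thesis by (simp add: g_def)
    qed (use that in blast)+
  qed
  ultimately have "(g has_sum infsum g ?P + infsum g ?N) UNIV"
    by (intro has_sum_cong_neutral[THEN iffD1, of UNIV "?P \<union> ?N" g g]) auto
  then have "seq (lapk K f) n = infsum g ?P + infsum g ?N"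
    by (rule has_sum_unique[OF g])
  moreover have "(\<lambda>i. g (int (Suc i)) + g (- int (Suc i))) sums (infsum g ?P + infsum g ?N)"
    by (intro has_sum_imp_sums has_sum_add P N)
  moreover have "g (int (Suc i)) + g (- int (Suc i))
      = of_real (K (int (Suc i))) * (2 * seq f n - seq f (n - int (Suc i)) - seq f (n + int (Suc i)))" for i
    using even[of "int (Suc i)"] by (simp add: g_def scaleR_conv_of_real algebra_simps)
  ultimately show ?thesis by simp
qed

lemma symbol_uniform_limit:
  "uniform_limit S (\<lambda>N x. \<Sum>n<N. 2 * K (int (Suc n)) * (1 - cos (real (Suc n) * x))) (symbol K) sequentially"
  unfolding symbol_def[abs_def]
proof (rule Weierstrass_m_test[OF _ summable_mult[OF summable_K_Suc, of 4]])
  fix n x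
  have "\<bar>1 - cos (real (Suc n) * x)\<bar> \<le> 2"
    using cos_le_one[of "real (Suc n) * x"] cos_ge_minus_one[of "real (Suc n) * x"] by linarith
  then have "2 * \<bar>K (int (Suc n))\<bar> * \<bar>1 - cos (real (Suc n) * x)\<bar> \<le> 2 * \<bar>K (int (Suc n))\<bar> * 2"
    by (intro mult_left_mono) auto
  then show "norm (2 * K (int (Suc n)) * (1 - cos (real (Suc n) * x))) \<le> 4 * \<bar>K (int (Suc n))\<bar>"
    by (simp add: abs_mult)
qed

lemma continuous_symbol: "continuous_on S (symbol K)"
  by (rule uniform_limit_theorem[OF _ symbol_uniform_limit]) (auto intro!: always_eventually continuous_intros)

text \<open>A pair of translations by j and -j multiplies h by a multiple of 1 - cos (j x); uniform
  convergence of the symbol carries this through the integral. The class of sequences with a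
  continuous transform h contains the deltas and is preserved by the operator.\<close>

lemma lapk_fourier:
  assumes h: "continuous_on {-pi..pi} h"
    and f: "\<And>n. seq f n = integral {-pi..pi} (\<lambda>x. h x * cis (of_int n * x))"
  shows "seq (lapk K f) n = integral {-pi..pi} (\<lambda>x. of_real (symbol K x) * h x * cis (of_int n * x))"
proof -
  let ?I = "{-pi..pi}"
  define s where "s N x = (\<Sum>i<N. 2 * K (int (Suc i)) * (1 - cos (real (Suc i) * x)))" for N x
  define F where "F N x = complex_of_real (s N x) * (h x * cis (of_int n * x))" for N x
  have hc: "continuous_on ?I (\<lambda>x. h x * cis (of_int n * x))" for n
    by (intro continuous_intros h)
  have bdd: "bounded ((\<lambda>x. h x * cis (of_int n * x)) ` ?I)"
    by (intro compact_imp_bounded compact_continuous_image hc) simp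
  have "bounded ((\<lambda>x. complex_of_real (symbol K x)) ` ?I)"
    by (intro compact_imp_bounded compact_continuous_image continuous_intros continuous_symbol) simp
  moreover have "uniform_limit ?I (\<lambda>N x. complex_of_real (s N x)) (\<lambda>x. complex_of_real (symbol K x)) sequentially"
    unfolding s_def by (intro bounded_linear.uniform_limit[OF bounded_linear_of_real] symbol_uniform_limit)
  ultimately have ul: "uniform_limit ?I F (\<lambda>x. of_real (symbol K x) * (h x * cis (of_int n * x))) sequentially"
    unfolding F_def by (intro uniform_lim_mult uniform_limit_const bdd)
  have "continuous_on ?I (F N)" for N
    unfolding F_def s_def by (intro continuous_intros h)
  from uniform_limit_integral[OF ul this sequentially_bot] obtain I J where IJ: "\<And>N. (F N has_integral I N) ?I"
      "((\<lambda>x. of_real (symbol K x) * (h x * cis (of_int n * x))) has_integral J) ?I" "I \<longlonglongrightarrow> J"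
    by blast
  have ii: "(\<lambda>x. h x * cis (of_int n * x)) integrable_on ?I" for n
    by (intro integrable_continuous_real hc)
  have IN: "I N = (\<Sum>i<N. of_real (K (int (Suc i))) *
      (2 * seq f n - seq f (n - int (Suc i)) - seq f (n + int (Suc i))))" for N
  proof -
    have "((\<lambda>x. \<Sum>i<N. of_real (K (int (Suc i))) * (2 * (h x * cis (of_int n * x))
        - h x * cis (of_int (n - int (Suc i)) * x) - h x * cis (of_int (n + int (Suc i)) * x))) has_integral
      (\<Sum>i<N. of_real (K (int (Suc i))) *
      (2 * seq f n - seq f (n - int (Suc i)) - seq f (n + int (Suc i))))) ?I"
      unfolding f
      by (intro has_integral_sum has_integral_mult_right has_integral_diff integrable_integral ii) simp
    moreover have "(\<Sum>i<N. of_real (K (int (Suc i))) * (2 * (h x * cis (of_int n * x))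
        - h x * cis (of_int (n - int (Suc i)) * x) - h x * cis (of_int (n + int (Suc i)) * x))) = F N x" for x
    proof -
      have "cis (of_int (n - int (Suc i)) * x) + cis (of_int (n + int (Suc i)) * x)
          = 2 * of_real (cos (real (Suc i) * x)) * cis (of_int n * x)" for i
      proof -
        have e: "of_int (n - int (Suc i)) * x = of_int n * x - real (Suc i) * x"
          "of_int (n + int (Suc i)) * x = of_int n * x + real (Suc i) * x"
          by (simp_all add: algebra_simps)
        show ?thesis unfolding e
          by (simp add: complex_eq_iff cos_add sin_add cos_diff sin_diff)
      qed
      note e = this
      have tri: "2 * (u * E) - u * A - u * B = 2 * (1 - v) * (u * E)"
        if "A + B = 2 * v * E" for u v A B E :: complex
        using arg_cong[OF that, of "\<lambda>z. u * z"] by (simp add: algebra_simps)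
      have "2 * (h x * cis (of_int n * x))
        - h x * cis (of_int (n - int (Suc i)) * x) - h x * cis (of_int (n + int (Suc i)) * x)
        = 2 * (1 - of_real (cos (real (Suc i) * x))) * (h x * cis (of_int n * x))" for i
        by (rule tri[OF e])
      then show ?thesis
        unfolding F_def s_def of_real_sum sum_distrib_right
        by (intro sum.cong refl) (simp add: mult_ac)
    qed
    ultimately show ?thesis using has_integral_unique[OF IJ(1)[of N]] by simp
  qed
  have "I \<longlonglongrightarrow> seq (lapk K f) n"
    using seq_lapk_sums[of f n] unfolding sums_def IN[symmetric] .
  then have "J = seq (lapk K f) n"
    using IJ(3) LIMSEQ_unique by blast
  then show ?thesis using IJ(2) by (simp add: integral_unique mult.assoc)
qed

text \<open>By induction the k-th power of the generator multiplies the transform of a delta by the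
  k-th power of -i times the symbol; the exponential series then converges uniformly over the
  period.\<close>

lemma flow_kernel:
  "seq (flow (gen K) t (delta a)) n =
    integral {-pi..pi} (\<lambda>x. cis (of_int (n - a) * x - t * symbol K x)) / (2 * pi)"
proof -
  let ?I = "{-pi..pi}"
  \<comment> \<open>The transform of \<open>delta a\<close>; it carries the normalisation 1 / (2
    pi).\<close>
  define e where "e x = cis (- of_int a * x) / (2 * pi)" for x
  define z where "z x = - \<i> * complex_of_real (symbol K x)" for x
  have ec: "continuous_on ?I e" unfolding e_def by (intro continuous_intros) auto
  have zc: "continuous_on ?I z" unfolding z_def by (intro continuous_intros continuous_symbol)
  have pow: "seq ((gen K ^^ k) (delta a)) n = integral ?I (\<lambda>x. z x ^ k * e x * cis (of_int n * x))" for k n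
  proof (induction k arbitrary: n)
    case 0
    have "(\<lambda>x. e x * cis (of_int n * x)) = (\<lambda>x. cis (of_int (n - a) * x) / (2 * pi))"
      by (simp add: e_def cis_mult algebra_simps)
    then show ?case
      using integral_cis_int[of "n - a"] by (simp add: delta.rep_eq)
  next
    case (Suc k)
    have "seq ((gen K ^^ Suc k) (delta a)) n = - \<i> * seq (lapk K ((gen K ^^ k) (delta a))) n"
      by (simp add: gen_def scaleC.rep_eq)
    also have "\<dots> = - \<i> * integral ?I (\<lambda>x. of_real (symbol K x) * (z x ^ k * e x) * cis (of_int n * x))"
      by (subst lapk_fourier[OF _ Suc.IH]) (auto intro!: continuous_intros ec zc)
    also have "\<dots> = integral ?I (\<lambda>x. - \<i> * (of_real (symbol K x) * (z x ^ k * e x) * cis (of_int n * x)))"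
      by (rule integral_mult_right[symmetric])
    finally show ?case by (simp add: z_def mult_ac)
  qed
  define G where "G N x = (\<Sum>k<N. (of_real t * z x) ^ k /\<^sub>R fact k) * (e x * cis (of_int n * x))" for N x
  have "bounded (symbol K ` ?I)"
    by (intro compact_imp_bounded compact_continuous_image continuous_symbol) simp
  then obtain W where W: "\<And>x. x \<in> ?I \<Longrightarrow> \<bar>symbol K x\<bar> \<le> W"
    unfolding bounded_iff by (metis image_eqI real_norm_def)
  have bdd: "bounded ((\<lambda>x. e x * cis (of_int n * x)) ` ?I)"
    by (intro compact_imp_bounded compact_continuous_image continuous_intros ec) simp
  have "bounded ((\<lambda>x. exp (of_real t * z x)) ` ?I)"
    by (intro compact_imp_bounded compact_continuous_image continuous_intros zc) simp
  moreover have "uniform_limit ?I (\<lambda>N x. \<Sum>k<N. (of_real t * z x) ^ k /\<^sub>R fact k) (\<lambda>x. exp (of_real t * z x)) sequentially"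
    unfolding exp_def
  proof (rule Weierstrass_m_test)
    show "summable (\<lambda>k. (\<bar>t\<bar> * W) ^ k /\<^sub>R fact k)" by (rule summable_exp_generic)
    fix k x assume "x \<in> ?I"
    then have "norm (of_real t * z x) \<le> \<bar>t\<bar> * W"
      using W by (simp add: z_def norm_mult mult_left_mono)
    then show "norm ((of_real t * z x) ^ k /\<^sub>R fact k) \<le> (\<bar>t\<bar> * W) ^ k /\<^sub>R fact k"
      by (simp add: norm_power mult_left_mono power_mono)
  qed
  ultimately have ul: "uniform_limit ?I G (\<lambda>x. exp (of_real t * z x) * (e x * cis (of_int n * x))) sequentially"
    unfolding G_def by (intro uniform_lim_mult uniform_limit_const bdd)
  have "continuous_on ?I (G N)" for N
    unfolding G_def by (intro continuous_intros ec zc)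
  from uniform_limit_integral[OF ul this sequentially_bot] obtain I J where IJ: "\<And>N. (G N has_integral I N) ?I"
      "((\<lambda>x. exp (of_real t * z x) * (e x * cis (of_int n * x))) has_integral J) ?I" "I \<longlonglongrightarrow> J"
    by blast
  have IN: "I N = (\<Sum>k<N. (t ^ k / fact k) *\<^sub>R seq ((gen K ^^ k) (delta a)) n)" for N
  proof -
    have "((\<lambda>x. \<Sum>k<N. (t ^ k / fact k) *\<^sub>R (z x ^ k * e x * cis (of_int n * x))) has_integral
        (\<Sum>k<N. (t ^ k / fact k) *\<^sub>R seq ((gen K ^^ k) (delta a)) n)) ?I"
      unfolding pow
      by (intro has_integral_sum has_integral_cmul integrable_integral integrable_continuous_real
          continuous_intros ec zc) simp
    moreover have "(\<lambda>x. \<Sum>k<N. (t ^ k / fact k) *\<^sub>R (z x ^ k * e x * cis (of_int n * x))) = G N"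
      by (simp add: G_def fun_eq_iff sum_distrib_right sum_distrib_left scaleR_conv_of_real power_mult_distrib divide_inverse mult_ac)
    ultimately show ?thesis using has_integral_unique[OF IJ(1)[of N]] by simp
  qed
  have "(\<lambda>k. seq ((t ^ k / fact k) *\<^sub>R (gen K ^^ k) (delta a)) n) sums seq (flow (gen K) t (delta a)) n"
    unfolding flow_def by (intro bounded_linear.sums[OF bounded_linear_seq] summable_sums summable_flow)
  then have "I \<longlonglongrightarrow> seq (flow (gen K) t (delta a)) n"
    unfolding sums_def scaleR_l2.rep_eq IN[symmetric] .
  then have "J = seq (flow (gen K) t (delta a)) n"
    using IJ(3) LIMSEQ_unique by blast
  moreover have "exp (of_real t * z x) * (e x * cis (of_int n * x))
      = cis (of_int (n - a) * x - t * symbol K x) / (2 * pi)" for x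
  proof -
    have "exp (of_real t * z x) = cis (- t * symbol K x)"
      by (simp add: cis_conv_exp z_def mult_ac)
    then show ?thesis by (simp add: e_def cis_mult algebra_simps)
  qed
  ultimately have "seq (flow (gen K) t (delta a)) n
      = integral ?I (\<lambda>x. cis (of_int (n - a) * x - t * symbol K x) / (2 * pi))"
    using integral_unique[OF IJ(2)] by simp
  then show ?thesis by (simp only: integral_divide)
qed

end

text \<open>\<Lambda> and \<theta> depend on c alone, and the sites enter only the linear part of
  the phase. Hence one C serves all kernels with the same c, and in particular all orders \<alpha>,
  where c = 1.\<close>

theorem dispersive_decay:
  assumes "c > 0"
  shows "\<exists>C>0. \<forall>K m a b t. decaying_kernel K c m \<longrightarrow> 1 \<le> \<bar>t\<bar> \<longrightarrow>
    cmod (seq (flow (gen K) t (delta a)) b) \<le> C * \<bar>t\<bar> powr (-1/3)"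
proof -
  have "c / 2 > 0" "40 * c > 0" using assms by auto
  from oscillatory_integral_bound[OF this] obtain C where C: "C > 0"
    "\<And>w w1 w2 w3 y t. nondegenerate_phase (40 * c) (c / 2) w w1 w2 w3 \<Longrightarrow> 1 \<le> \<bar>t\<bar> \<Longrightarrow>
    norm (integral {-pi..pi} (\<lambda>x. cis (y * x - t * w x))) \<le> C * \<bar>t\<bar> powr (-1/3)"
    by blast
  show ?thesis
  proof (intro exI[of _ C] conjI C(1) allI impI)
    fix K m a b and t :: real assume "decaying_kernel K c m" and t: "1 \<le> \<bar>t\<bar>"
    then interpret decaying_kernel K c m by simp
    obtain w1 w2 w3 where "nondegenerate_phase (40 * c) (c / 2) (symbol K) w1 w2 w3"
      using symbol_nondegenerate by blast
    from C(2)[OF this t]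
    have "norm (integral {-pi..pi} (\<lambda>x. cis (of_int (b - a) * x - t * symbol K x))) \<le> C * \<bar>t\<bar> powr (-1/3)" .
    moreover have "v / (2 * pi) \<le> v" if "v \<ge> 0" for v :: real
      using that pi_gt3 by (simp add: divide_le_eq mult_le_cancel_left1)
    ultimately show "cmod (seq (flow (gen K) t (delta a)) b) \<le> C * \<bar>t\<bar> powr (-1/3)"
      by (simp add: flow_kernel norm_divide norm_mult) (meson norm_ge_zero order_trans)
  qed
qed

text \<open>The origin of the number 11: it makes 1 + \<alpha> at least 12.\<close>

lemma decaying_kernel_ker:
  assumes "\<alpha> > 11"
  shows "decaying_kernel (ker \<alpha>) 1 1"
proof -
  interpret even_kernel "ker \<alpha>"
    using assms by (intro even_kernel_ker) (auto intro: less_trans[of 0 11])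
  show ?thesis
  proof
    fix j :: nat assume j: "1 < j"
    show "\<bar>ker \<alpha> (int j)\<bar> \<le> 1 * (real 1 / real j) ^ 12"
    proof (cases "\<alpha> = \<infinity>")
      case False
      then have "real_of_ereal \<alpha> \<ge> 11" using assms by (cases \<alpha>) auto
      then have "real j powr - (1 + real_of_ereal \<alpha>) \<le> real j powr - real 12"
        using j by (intro powr_mono) auto
      also have "\<dots> = (1 / real j) ^ 12"
        using j by (subst powr_minus, subst powr_realpow) (auto simp: power_divide inverse_eq_divide)
      finally show ?thesis using False by (simp add: ker_def)
    qed (use j in \<open>simp add: ker_def\<close>)
  qed auto
qed

text \<open>The weights at distance one cancel. Relative to the weight at distance two the others
  are (j/2)^(-(1+a)), at most (2/j)^12. The leading weight depends on a, and with it the constant of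
  the resulting decay.\<close>

lemma decaying_kernel_ker_diff:
  assumes "a > 11"
  shows "decaying_kernel (\<lambda>j. ker (ereal a) j - ker \<infinity> j) (2 powr - (1 + a)) 2"
proof -
  interpret A: even_kernel "ker (ereal a)"
    using assms by (intro even_kernel_ker) auto
  interpret B: even_kernel "ker \<infinity>"
    by (intro even_kernel_ker) auto
  show ?thesis
  proof
    show "(\<lambda>j. ker (ereal a) j - ker \<infinity> j) summable_on UNIV"
      using summable_on_add[OF A.summable summable_on_uminus[THEN iffD2, OF B.summable]] by simp
    show "ker (ereal a) (int j) - ker \<infinity> (int j) = 0" if "0 < j" "j < 2" for j
    proof -
      have "j = 1" using that by simp
      then show ?thesis by (simp add: ker_def)
    qed
    fix j :: nat assume j: "2 < j"
    have "real j powr - (1 + a) = (2 * (real j / 2)) powr - (1 + a)" by simp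
    also have "\<dots> = 2 powr - (1 + a) * (real j / 2) powr - (1 + a)"
      using j by (subst powr_mult) auto
    also have "(real j / 2) powr - (1 + a) \<le> (real j / 2) powr - real 12"
      using j assms by (intro powr_mono) auto
    also have "(real j / 2) powr - real 12 = (real 2 / real j) ^ 12"
      using j by (subst powr_minus, subst powr_realpow) (auto simp: power_divide inverse_eq_divide)
    finally show "\<bar>ker (ereal a) (int j) - ker \<infinity> (int j)\<bar> \<le> 2 powr - (1 + a) * (real 2 / real j) ^ 12"
      using j by (simp add: ker_def)
  qed (auto simp: ker_def A.even B.even)
qed


section \<open>Discrete Strichartz estimates\<close>

text \<open>Every distance occurs at most once on each side of k, hence the factor 2.\<close>

lemma sum_by_distance:
  fixes f :: "nat \<Rightarrow> real"
  assumes S: "finite S" and D: "finite D" "\<And>l. l \<in> S \<Longrightarrow> Suc (nat \<bar>k - l\<bar>) \<in> D"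
    and f: "\<And>d. 0 \<le> f d"
  shows "(\<Sum>l\<in>S. f (Suc (nat \<bar>k - l\<bar>))) \<le> 2 * (\<Sum>d\<in>D. f d)"
proof -
  let ?g = "\<lambda>l. f (Suc (nat \<bar>k - l\<bar>))"
  define P N where "P = {l \<in> S. l \<le> k}" and "N = {l \<in> S. k < l}"
  have part: "(\<Sum>l\<in>A. ?g l) \<le> (\<Sum>d\<in>D. f d)"
    if A: "A \<subseteq> S" "inj_on (\<lambda>l. Suc (nat \<bar>k - l\<bar>)) A" for A
  proof -
    have "(\<Sum>l\<in>A. ?g l) = (\<Sum>d\<in>(\<lambda>l. Suc (nat \<bar>k - l\<bar>)) ` A. f d)"
      by (subst sum.reindex[OF A(2)]) (simp add: o_def)
    also have "\<dots> \<le> (\<Sum>d\<in>D. f d)"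
      using D A f by (intro sum_mono2) auto
    finally show ?thesis .
  qed
  have "(\<Sum>l\<in>P. ?g l) \<le> (\<Sum>d\<in>D. f d)" "(\<Sum>l\<in>N. ?g l) \<le> (\<Sum>d\<in>D. f d)"
    by (rule part; auto simp: P_def N_def inj_on_def)+
  moreover have "(\<Sum>l\<in>S. ?g l) = (\<Sum>l\<in>P. ?g l) + (\<Sum>l\<in>N. ?g l)"
    using S by (subst sum.union_disjoint[symmetric]) (auto simp: P_def N_def intro!: sum.cong)
  ultimately show ?thesis by linarith
qed

lemma sum_powr_third: "(\<Sum>d\<in>{1..n}. real d powr (-1/3)) \<le> 3 / 2 * real n powr (2/3)"
proof (induction n)
  case (Suc n)
  have "real (Suc n) powr (-1/3) \<le> 3 / 2 * (real (Suc n) powr (2/3) - real n powr (2/3))"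
  proof (cases "n = 0")
    case False
    then have "real n < real (Suc n)" "real n > 0" by auto
    have "((\<lambda>x. x powr (2/3)) has_real_derivative 2/3 * x powr (2/3 - 1)) (at x)" if "real n \<le> x" for x
      using that \<open>real n > 0\<close> by (intro has_real_derivative_powr) auto
    from MVT2[OF \<open>real n < real (Suc n)\<close> this] obtain z where z: "real n < z" "z < real (Suc n)"
      "real (Suc n) powr (2/3) - real n powr (2/3) = (real (Suc n) - real n) * (2/3 * z powr (2/3 - 1))"
      by blast
    have "real (Suc n) powr (-1/3) \<le> z powr (-1/3)"
      using z \<open>real n > 0\<close> by (intro powr_mono2') auto
    then show ?thesis using z(3) by simp
  qed simp
  then show ?case using Suc by (simp add: algebra_simps)
qed simp

lemma sum_inverse_squares:
  assumes "0 < n"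
  shows "(\<Sum>d\<in>{n<..M}. 1 / (real d)\<^sup>2) \<le> 1 / real n"
proof -
  have "(\<Sum>d\<in>{n<..n+k}. 1 / (real d)\<^sup>2) \<le> 1 / real n - 1 / real (n + k)" for k
  proof (induction k)
    case (Suc k)
    have "{n<..n + Suc k} = insert (n + Suc k) {n<..n + k}" by auto
    then have "(\<Sum>d\<in>{n<..n + Suc k}. 1 / (real d)\<^sup>2)
        = 1 / (real (n + Suc k))\<^sup>2 + (\<Sum>d\<in>{n<..n+k}. 1 / (real d)\<^sup>2)" by simp
    also have "1 / (real (n + Suc k))\<^sup>2 \<le> 1 / (real (n + k) * real (n + Suc k))"
      using assms unfolding power2_eq_square by (intro divide_left_mono mult_right_mono) auto
    also have "1 / (real (n + k) * real (n + Suc k)) = 1 / real (n + k) - 1 / real (n + Suc k)"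
      using assms by (simp add: field_simps)
    finally show ?case using Suc by simp
  qed simp
  from this[of "M - n"] show ?thesis
  proof (cases "n \<le> M")
    case True
    then show ?thesis
      using \<open>(\<Sum>d\<in>{n<..n+(M-n)}. 1 / (real d)\<^sup>2) \<le> 1 / real n - 1 / real (n + (M - n))\<close>
      by (simp add: order_trans[of _ "1 / real n - 1 / real M"])
  qed simp
qed

text \<open>One of the two terms alone dominates the product, according to whether y lies below or
  above \<tau> x^(1/r). It is used with r = 5 for the exponents 6/5 and 6, and with r = 4 for 5/4
  and 5.\<close>

lemma Young_weighted:
  fixes x y \<tau> :: real
  assumes "x \<ge> 0" "y \<ge> 0" "\<tau> > 0" "r > 0"
  shows "x * y \<le> \<tau> * x powr (1 + 1 / real r) + y ^ Suc r / \<tau> ^ r"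
proof (cases "x = 0")
  case True
  then show ?thesis using assms by simp
next
  case False
  then have x: "x > 0" using assms by simp
  have nonneg: "0 \<le> \<tau> * x powr (1 + 1 / real r)" "0 \<le> y ^ Suc r / \<tau> ^ r"
    using assms by auto
  show ?thesis
  proof (cases "y \<le> \<tau> * x powr (1 / real r)")
    case True
    have "x * y \<le> x * (\<tau> * x powr (1 / real r))" using True x by (intro mult_left_mono) auto
    also have "\<dots> = \<tau> * x powr (1 + 1 / real r)" using x by (simp add: powr_add)
    finally show ?thesis using nonneg by linarith
  next
    case False
    then have "x powr (1 / real r) \<le> y / \<tau>" using assms by (simp add: field_simps)
    then have "(x powr (1 / real r)) ^ r \<le> (y / \<tau>) ^ r" by (intro power_mono) auto
    moreover have "(x powr (1 / real r)) ^ r = x"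
      using x assms by (simp add: powr_power)
    ultimately have "x * y \<le> (y / \<tau>) ^ r * y" using assms by (intro mult_right_mono) auto
    also have "\<dots> = y ^ Suc r / \<tau> ^ r" by (simp add: power_divide)
    finally show ?thesis using nonneg by linarith
  qed
qed

text \<open>Only the smaller weights are summed against a given weight \<open>b\<close>: near the diagonal they are
  bounded by \<open>b\<close> itself, and far away Young's inequality applies, with the two
  regions separated at distance \<open>R = b powr (-6/5)\<close>.\<close>

lemma HLS_row:
  fixes a :: "int \<Rightarrow> real"
  assumes S: "finite S" and a: "\<And>l. l \<in> S \<Longrightarrow> 0 \<le> a l" and s: "(\<Sum>l\<in>S. a l powr (6/5)) \<le> 1"
    and b: "0 < b" "b \<le> 1"
  shows "(\<Sum>l\<in>{l\<in>S. a l \<le> b}. a l * real (Suc (nat \<bar>k - l\<bar>)) powr (-1/3)) \<le> 8 * b powr (1/5)"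
proof -
  define R where "R = b powr (-6/5)"
  have R1: "R \<ge> 1" unfolding R_def using b powr_mono'[of "-6/5" 0 b] by simp
  define n where "n = nat \<lfloor>R\<rfloor>"
  have "1 \<le> n" using R1 unfolding n_def by linarith
  moreover have "real n \<le> R" "R < real n + 1" using R1 unfolding n_def by linarith+
  ultimately have n: "n > 0" "real n \<le> R" "R \<le> 2 * real n" by simp_all
  let ?d = "\<lambda>l. Suc (nat \<bar>k - l\<bar>)"
  define S1 where "S1 = {l\<in>S. a l \<le> b \<and> ?d l \<le> n}"
  define S2 where "S2 = {l\<in>S. a l \<le> b \<and> n < ?d l}"
  have fin: "finite S1" "finite S2" using S by (auto simp: S1_def S2_def)
  have "(\<Sum>l\<in>S1. a l * real (?d l) powr (-1/3)) \<le> (\<Sum>l\<in>S1. b * real (?d l) powr (-1/3))"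
    by (intro sum_mono mult_right_mono) (auto simp: S1_def)
  also have "\<dots> = b * (\<Sum>l\<in>S1. real (?d l) powr (-1/3))" by (simp add: sum_distrib_left)
  also have "\<dots> \<le> b * (2 * (\<Sum>d\<in>{1..n}. real d powr (-1/3)))"
    using b fin by (intro mult_left_mono sum_by_distance) (auto simp: S1_def)
  also have "\<dots> \<le> b * (2 * (3 / 2 * R powr (2/3)))"
    using b n order_trans[OF sum_powr_third[of n] mult_left_mono[OF powr_mono2[of "2/3" "real n" R]]]
    by (intro mult_left_mono) auto
  also have "\<dots> = 3 * (b powr 1 * R powr (2/3))" using b by simp
  also have "\<dots> = 3 * b powr (1/5)"
    unfolding R_def powr_powr powr_add[symmetric] by simp
  finally have near: "(\<Sum>l\<in>S1. a l * real (?d l) powr (-1/3)) \<le> 3 * b powr (1/5)" .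
  \<comment> \<open>This weight makes the two terms of Young's inequality, \<tau> and 4 / (R
    \<tau>^5), comparable, because R \<tau>^6 = 1.\<close>
  define \<tau> where "\<tau> = b powr (1/5)"
  have \<tau>: "\<tau> > 0" using b by (simp add: \<tau>_def)
  have p6: "(real d powr (-1/3)) ^ 6 = 1 / (real d)\<^sup>2" if "d > 0" for d
    using that by (simp add: powr_power powr_minus_divide power_divide)
  have "(\<Sum>l\<in>S2. a l * real (?d l) powr (-1/3))
      \<le> (\<Sum>l\<in>S2. \<tau> * a l powr (6/5) + (real (?d l) powr (-1/3)) ^ 6 / \<tau> ^ 5)"
    using a \<tau> Young_weighted[of "a _" "real (?d _) powr (-1/3)" \<tau> 5]
    by (intro sum_mono) (simp add: S2_def)
  also have "\<dots> = \<tau> * (\<Sum>l\<in>S2. a l powr (6/5)) + (\<Sum>l\<in>S2. 1 / (real (?d l))\<^sup>2) / \<tau> ^ 5"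
    by (simp only: p6[OF zero_less_Suc] sum.distrib sum_distrib_left sum_divide_distrib)
  also have "\<dots> \<le> \<tau> * 1 + (4 / R) / \<tau> ^ 5"
  proof (intro add_mono mult_left_mono divide_right_mono)
    have "(\<Sum>l\<in>S2. a l powr (6/5)) \<le> (\<Sum>l\<in>S. a l powr (6/5))"
      using S by (intro sum_mono2) (auto simp: S2_def)
    then show "(\<Sum>l\<in>S2. a l powr (6/5)) \<le> 1" using s by simp
    define M where "M = Max (insert 0 (?d ` S2))"
    have "(\<Sum>l\<in>S2. 1 / (real (?d l))\<^sup>2) \<le> 2 * (\<Sum>d\<in>{n<..M}. 1 / (real d)\<^sup>2)"
      using fin by (intro sum_by_distance) (auto simp: M_def S2_def intro!: Max_ge)
    also have "\<dots> \<le> 2 * (1 / real n)" using n by (intro mult_left_mono sum_inverse_squares) auto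
    also have "\<dots> \<le> 4 / R" using n R1 by (simp add: field_simps)
    finally show "(\<Sum>l\<in>S2. 1 / (real (?d l))\<^sup>2) \<le> 4 / R" .
  qed (use \<tau> in auto)
  also have "(4 / R) / \<tau> ^ 5 = 4 * \<tau>"
  proof -
    have "R * \<tau> ^ 6 = 1"
      using b unfolding R_def \<tau>_def by (simp add: powr_power flip: powr_add)
    then show ?thesis using R1 \<tau> by (simp add: field_simps eval_nat_numeral)
  qed
  finally have far: "(\<Sum>l\<in>S2. a l * real (?d l) powr (-1/3)) \<le> 5 * b powr (1/5)"
    by (simp add: \<tau>_def)
  have "{l\<in>S. a l \<le> b} = S1 \<union> S2" "S1 \<inter> S2 = {}" by (auto simp: S1_def S2_def)
  then show ?thesis using near far fin by (simp add: sum.union_disjoint)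
qed

text \<open>By symmetry each pair may be charged to its larger weight, so \<open>HLS_row\<close>
  applies with b = \<open>a k\<close>. Rows contribute 8 (a k)^(6/5), thus 8 in all, and 16 after
  symmetrisation. The normalisation also keeps every weight at most 1, as the row bound
  requires.\<close>

lemma HLS_normalized:
  fixes a :: "int \<Rightarrow> real"
  assumes S: "finite S" and a: "\<And>l. l \<in> S \<Longrightarrow> 0 \<le> a l" and s: "(\<Sum>l\<in>S. a l powr (6/5)) \<le> 1"
  shows "(\<Sum>k\<in>S. \<Sum>l\<in>S. a k * a l * real (Suc (nat \<bar>k - l\<bar>)) powr (-1/3)) \<le> 16"
proof -
  define h where "h k l = a k * a l * real (Suc (nat \<bar>k - l\<bar>)) powr (-1/3)" for k l
  define g where "g k l = (if a l \<le> a k then h k l else 0)" for k l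
  have h0: "0 \<le> h k l" if "k \<in> S" "l \<in> S" for k l using a that by (simp add: h_def)
  have hs: "h k l = h l k" for k l by (simp add: h_def mult.commute abs_minus_commute)
  have row: "(\<Sum>l\<in>S. g k l) \<le> 8 * a k powr (6/5)" if k: "k \<in> S" for k
  proof (cases "a k = 0")
    case True
    then show ?thesis by (simp add: g_def h_def cong: if_cong)
  next
    case False
    then have ak: "0 < a k" using a[OF k] by simp
    have "a k powr (6/5) \<le> (\<Sum>l\<in>S. a l powr (6/5))"
      using S k by (intro member_le_sum) auto
    then have "a k powr (6/5) \<le> 1" using s by simp
    then have ak1: "a k \<le> 1"
      using ak powr_le_one_le[of "a k" 1] by (meson gr_one_powr linorder_not_less zero_less_divide_iff zero_less_numeral)
    have "(\<Sum>l\<in>S. g k l) = (\<Sum>l\<in>{l\<in>S. a l \<le> a k}. h k l)"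
      using S unfolding g_def by (simp add: sum.inter_filter)
    also have "\<dots> = a k * (\<Sum>l\<in>{l\<in>S. a l \<le> a k}. a l * real (Suc (nat \<bar>k - l\<bar>)) powr (-1/3))"
      by (simp add: h_def sum_distrib_left mult.assoc)
    also have "\<dots> \<le> a k * (8 * a k powr (1/5))"
      using ak ak1 k by (intro mult_left_mono HLS_row S a s) auto
    also have "\<dots> = 8 * (a k powr 1 * a k powr (1/5))" using ak by simp
    also have "\<dots> = 8 * a k powr (6/5)" unfolding powr_add[symmetric] by simp
    finally show ?thesis .
  qed
  have "(\<Sum>k\<in>S. \<Sum>l\<in>S. h k l) \<le> (\<Sum>k\<in>S. \<Sum>l\<in>S. g k l + g l k)"
    using h0 hs by (intro sum_mono) (auto simp: g_def)
  also have "\<dots> = 2 * (\<Sum>k\<in>S. \<Sum>l\<in>S. g k l)"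
    using sum.swap[of "\<lambda>k l. g l k" S S] by (simp add: sum.distrib)
  also have "\<dots> \<le> 2 * (\<Sum>k\<in>S. 8 * a k powr (6/5))"
    by (intro mult_left_mono sum_mono row) auto
  also have "\<dots> \<le> 16" using s by (simp flip: sum_distrib_left)
  finally show ?thesis by (simp add: h_def)
qed

text \<open>Both sides are homogeneous of degree 2 = 6/5 * 5/3, so dividing by \<sigma> reduces to
  the normalised case.\<close>

lemma HLS:
  fixes a :: "int \<Rightarrow> real"
  assumes S: "finite S" and a: "\<And>l. l \<in> S \<Longrightarrow> 0 \<le> a l"
  shows "(\<Sum>k\<in>S. \<Sum>l\<in>S. a k * a l * real (Suc (nat \<bar>k - l\<bar>)) powr (-1/3))
    \<le> 16 * (\<Sum>l\<in>S. a l powr (6/5)) powr (5/3)"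
proof -
  define A where "A = (\<Sum>l\<in>S. a l powr (6/5))"
  have A0: "A \<ge> 0" unfolding A_def by (intro sum_nonneg) auto
  show ?thesis
  proof (cases "A = 0")
    case True
    then have "\<forall>l\<in>S. a l powr (6/5) = 0"
      using S unfolding A_def by (subst (asm) sum_nonneg_eq_0_iff) auto
    then have "\<forall>l\<in>S. a l = 0" by simp
    then show ?thesis by simp
  next
    case False
    then have A: "A > 0" using A0 by simp
    define \<sigma> where "\<sigma> = A powr (5/6)"
    have \<sigma>: "\<sigma> > 0" "\<sigma> powr (6/5) = A" "\<sigma> * \<sigma> = A powr (5/3)"
      using A by (auto simp: \<sigma>_def powr_powr simp flip: powr_add)
    have "(\<Sum>k\<in>S. \<Sum>l\<in>S. (a k / \<sigma>) * (a l / \<sigma>) * real (Suc (nat \<bar>k - l\<bar>)) powr (-1/3)) \<le> 16"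
    proof (rule HLS_normalized[OF S])
      have "(\<Sum>l\<in>S. (a l / \<sigma>) powr (6/5)) = (\<Sum>l\<in>S. a l powr (6/5) / A)"
        using a \<sigma> by (intro sum.cong refl) (simp add: powr_divide)
      also have "\<dots> = 1" using A by (simp add: A_def flip: sum_divide_distrib)
      finally show "(\<Sum>l\<in>S. (a l / \<sigma>) powr (6/5)) \<le> 1" by simp
    qed (use a \<sigma> in auto)
    moreover have "(\<Sum>k\<in>S. \<Sum>l\<in>S. a k * a l * real (Suc (nat \<bar>k - l\<bar>)) powr (-1/3))
      = (\<sigma> * \<sigma>) * (\<Sum>k\<in>S. \<Sum>l\<in>S. (a k / \<sigma>) * (a l / \<sigma>) * real (Suc (nat \<bar>k - l\<bar>)) powr (-1/3))"
      using \<sigma>(1) unfolding sum_distrib_left by (intro sum.cong refl) simp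
    ultimately have "(\<Sum>k\<in>S. \<Sum>l\<in>S. a k * a l * real (Suc (nat \<bar>k - l\<bar>)) powr (-1/3)) \<le> (\<sigma> * \<sigma>) * 16"
      using \<sigma>(1) by simp
    then show ?thesis using \<sigma>(3) by (simp add: A_def mult.commute)
  qed
qed

section \<open>The sup norm and Strichartz' inequality at integer times\<close>

definition linf :: "l2 \<Rightarrow> real" where
  "linf f = (SUP n. cmod (seq f n))"

lemma bdd_above_seq: "bdd_above (range (\<lambda>n. cmod (seq f n)))"
  using seq_le_norm by (intro bdd_aboveI2)

lemma linf_ge: "cmod (seq f n) \<le> linf f"
  unfolding linf_def by (rule cSUP_upper[OF _ bdd_above_seq]) simp

lemma linf_le: "(\<And>n. cmod (seq f n) \<le> M) \<Longrightarrow> linf f \<le> M"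
  unfolding linf_def by (rule cSUP_least) auto

lemma linf_nonneg: "0 \<le> linf f"
  using linf_ge[of f 0] norm_ge_zero order_trans by blast

lemma linf_le_norm: "linf f \<le> norm f"
  by (rule linf_le) (rule seq_le_norm)

text \<open>Choosing such a site at each time reduces sup norms to point evaluations, at the price
  of a factor 2.\<close>

lemma linf_half_attained: "\<exists>n. linf f / 2 \<le> cmod (seq f n)"
proof (rule ccontr)
  assume "\<not> ?thesis"
  then have lt: "cmod (seq f n) < linf f / 2" for n by (simp add: not_le)
  then have "linf f \<le> linf f / 2" by (intro linf_le less_imp_le)
  then show False using lt[of 0] norm_ge_zero[of "seq f 0"] by linarith
qed

text \<open>Besides the decay, a bound on the sup norm is required: it controls solutions within a
  unit time interval. Both constants are shared by all orders above 11.\<close>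

locale dispersive_kernel = even_kernel +
  fixes D :: real
  assumes D: "1 \<le> D"
    and dispersive: "cmod (seq (flow (gen K) t (delta a)) b) \<le> D * (1 + \<bar>t\<bar>) powr (-1/3)"
    and lapk_sup: "(\<And>n. cmod (seq f n) \<le> M) \<Longrightarrow> cmod (seq (lapk K f) n) \<le> 5 * M"
begin

lemma inner_flow_deltas:
  "\<bar>inner (flow (gen K) s (scaleC c (delta a))) (flow (gen K) t (scaleC d (delta b)))\<bar>
    \<le> cmod c * cmod d * (D * (1 + \<bar>s - t\<bar>) powr (-1/3))"
proof -
  have "inner (flow (gen K) s (scaleC c (delta a))) (flow (gen K) t (scaleC d (delta b)))
      = inner (flow (gen K) (s - t) (scaleC c (delta a))) (scaleC d (delta b))"
    using flow_adjoint[of "- t" "flow (gen K) s (scaleC c (delta a))" "scaleC d (delta b)"]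
      flow_add_time[of "- t" s "scaleC c (delta a)"] by simp
  also have "\<dots> = Re (c * seq (flow (gen K) (s - t) (delta a)) b * cnj d)"
    unfolding inner_delta flow_scaleC scaleC.rep_eq ..
  also have "\<bar>\<dots>\<bar> \<le> cmod (c * seq (flow (gen K) (s - t) (delta a)) b * cnj d)"
    by (rule abs_Re_le_cmod)
  also have "\<dots> = cmod c * cmod d * cmod (seq (flow (gen K) (s - t) (delta a)) b)"
    by (simp add: norm_mult)
  also have "\<dots> \<le> cmod c * cmod d * (D * (1 + \<bar>s - t\<bar>) powr (-1/3))"
    by (intro mult_left_mono dispersive) auto
  finally show ?thesis .
qed

text \<open>The TT* argument: the squared norm is a double sum of matrix elements of the flow at
  time differences, to which \<open>HLS\<close> applies; 4 sqrt D is the root of 16 D. This is the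
  dual form of the l6 bound in time.\<close>

lemma norm_superposition:
  fixes c :: "nat \<Rightarrow> complex" and idx :: "nat \<Rightarrow> int"
  assumes T: "finite T"
  shows "norm (\<Sum>k\<in>T. flow (gen K) (- real k) (scaleC (c k) (delta (idx k))))
    \<le> 4 * sqrt D * (\<Sum>k\<in>T. cmod (c k) powr (6/5)) powr (5/6)"
proof -
  let ?y = "\<lambda>k. flow (gen K) (- real k) (scaleC (c k) (delta (idx k)))"
  let ?A = "\<Sum>k\<in>T. cmod (c k) powr (6/5)"
  define a where "a j = cmod (c (nat j))" for j :: int
  have reindex: "(\<Sum>k\<in>T. g k) = (\<Sum>j\<in>int ` T. g (nat j))" for g :: "nat \<Rightarrow> real"
    by (subst sum.reindex) auto
  have "(norm (\<Sum>k\<in>T. ?y k))\<^sup>2 = (\<Sum>k\<in>T. \<Sum>l\<in>T. inner (?y k) (?y l))"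
    unfolding power2_norm_eq_inner inner_sum_left inner_sum_right by (rule sum.swap)
  also have "\<dots> \<le> (\<Sum>k\<in>T. \<Sum>l\<in>T. cmod (c k) * cmod (c l) * (D * real (Suc (nat \<bar>int k - int l\<bar>)) powr (-1/3)))"
  proof (intro sum_mono)
    fix k l :: nat
    have "1 + \<bar>- real k - - real l\<bar> = real (Suc (nat \<bar>int k - int l\<bar>))" by linarith
    then show "inner (?y k) (?y l)
        \<le> cmod (c k) * cmod (c l) * (D * real (Suc (nat \<bar>int k - int l\<bar>)) powr (-1/3))"
      using inner_flow_deltas[of "- real k" "c k" "idx k" "- real l" "c l" "idx l"]
      by (metis abs_le_D1)
  qed
  also have "\<dots> = D * (\<Sum>k\<in>int ` T. \<Sum>l\<in>int ` T. a k * a l * real (Suc (nat \<bar>k - l\<bar>)) powr (-1/3))"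
    unfolding reindex sum_distrib_left by (intro sum.cong refl) (auto simp: a_def mult_ac)
  also have "\<dots> \<le> D * (16 * (\<Sum>l\<in>int ` T. a l powr (6/5)) powr (5/3))"
    using D T by (intro mult_left_mono HLS) (auto simp: a_def)
  also have "\<dots> = D * (16 * ?A powr (5/3))"
    unfolding reindex a_def ..
  also have "\<dots> = (4 * sqrt D * ?A powr (5/6))\<^sup>2"
    using D by (simp add: power_mult_distrib) (simp add: power2_eq_square flip: powr_add)
  finally show ?thesis
    using D by (rule_tac power2_le_imp_le) auto
qed

text \<open>The sum S of sixth powers is a pairing of F with y. Summation by parts moves the
  difference from the tail sums Y, which are bounded by S^(5/6), onto F; the last boundary term is
  an empty tail. Dividing by S^(5/6) leaves the initial value of F plus its variation.\<close>

lemma Strichartz_pointwise: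
  fixes F :: "nat \<Rightarrow> l2" and idx :: "nat \<Rightarrow> int"
  shows "(\<Sum>k<N. cmod (seq (flow (gen K) (real k) (F k)) (idx k)) ^ 6)
    \<le> (4 * sqrt D * (norm (F 0) + (\<Sum>k<N-1. norm (F (Suc k) - F k)))) ^ 6"
proof (cases N)
  case 0
  then show ?thesis using D by simp
next
  case (Suc M)
  define a where "a k = seq (flow (gen K) (real k) (F k)) (idx k)" for k
  \<comment> \<open>Dual to a in l6: the 6/5 powers of c are again the sixth powers of a, and
    pairing a with c returns S.\<close>
  define c where "c k = of_real (cmod (a k) ^ 4) * a k" for k
  define y where "y k = flow (gen K) (- real k) (scaleC (c k) (delta (idx k)))" for k
  define Y where "Y j = (\<Sum>k\<in>{j..<N}. y k)" for j
  define S where "S = (\<Sum>k<N. cmod (a k) ^ 6)"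
  define V where "V = norm (F 0) + (\<Sum>k<M. norm (F (Suc k) - F k))"
  have S0: "S \<ge> 0" unfolding S_def by (intro sum_nonneg) auto
  have c6: "cmod (c k) powr (6/5) = cmod (a k) ^ 6" for k
  proof (cases "a k = 0")
    case False
    have "cmod (c k) = cmod (a k) ^ 5"
      by (simp add: c_def norm_mult eval_nat_numeral)
    also have "\<dots> = cmod (a k) powr 5" using False by simp
    finally show ?thesis using False by (simp only: powr_powr) simp
  qed (simp add: c_def)
  have nY: "norm (Y j) \<le> 4 * sqrt D * S powr (5/6)" for j
  proof -
    have "norm (Y j) \<le> 4 * sqrt D * (\<Sum>k\<in>{j..<N}. cmod (a k) ^ 6) powr (5/6)"
      unfolding Y_def y_def using norm_superposition[of "{j..<N}" c idx] by (simp add: c6)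
    also have "\<dots> \<le> 4 * sqrt D * S powr (5/6)"
      unfolding S_def using D by (intro mult_left_mono powr_mono2 sum_mono2 sum_nonneg) auto
    finally show ?thesis .
  qed
  have "inner (F k) (y k) = cmod (a k) ^ 6" for k
  proof -
    have "inner (F k) (y k) = inner (flow (gen K) (real k) (F k)) (scaleC (c k) (delta (idx k)))"
      by (simp add: y_def flow_adjoint)
    also have "\<dots> = Re (a k * cnj (c k))"
      unfolding inner_delta a_def ..
    also have "a k * cnj (c k) = of_real (cmod (a k) ^ 4) * (a k * cnj (a k))"
      by (simp add: c_def)
    also have "\<dots> = of_real (cmod (a k) ^ 6)"
      unfolding complex_norm_square[symmetric] by (simp flip: of_real_power of_real_mult power_add)
    finally show ?thesis by simp
  qed
  then have "S = (\<Sum>k<Suc M. inner (F k) (y k))"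
    by (simp add: S_def Suc)
  also have "\<dots> = (\<Sum>k<Suc M. inner (F k) (Y k - Y (Suc k)))"
  proof (intro sum.cong refl)
    fix k assume "k \<in> {..<Suc M}"
    then have "k < N" by (simp add: Suc)
    then have "Y k = y k + Y (Suc k)" unfolding Y_def by (rule sum.atLeast_Suc_lessThan)
    then show "inner (F k) (y k) = inner (F k) (Y k - Y (Suc k))" by simp
  qed
  also have "\<dots> = inner (F 0) (Y 0) + (\<Sum>k<M. inner (F (Suc k) - F k) (Y (Suc k))) - inner (F M) (Y (Suc M))"
  proof -
    have "(\<Sum>k<Suc n. inner (F k) (Y k - Y (Suc k))) =
      inner (F 0) (Y 0) + (\<Sum>k<n. inner (F (Suc k) - F k) (Y (Suc k))) - inner (F n) (Y (Suc n))" for n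
      by (induction n) (auto simp: inner_diff_left inner_diff_right)
    then show ?thesis .
  qed
  also have "Y (Suc M) = 0" by (simp add: Y_def Suc)
  also have "inner (F 0) (Y 0) + (\<Sum>k<M. inner (F (Suc k) - F k) (Y (Suc k))) - inner (F M) 0
      \<le> norm (F 0) * (4 * sqrt D * S powr (5/6))
        + (\<Sum>k<M. norm (F (Suc k) - F k) * (4 * sqrt D * S powr (5/6)))"
  proof -
    have "inner x (Y j) \<le> norm x * (4 * sqrt D * S powr (5/6))" for x j
      using norm_cauchy_schwarz[of x "Y j"] mult_left_mono[OF nY[of j], of "norm x"] by simp
    then show ?thesis by (auto intro!: add_mono sum_mono)
  qed
  also have "\<dots> = 4 * sqrt D * V * S powr (5/6)"
    by (simp add: V_def algebra_simps sum_distrib_left)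
  finally have SV: "S \<le> 4 * sqrt D * V * S powr (5/6)" .
  have V0: "V \<ge> 0" unfolding V_def by (intro add_nonneg_nonneg sum_nonneg) auto
  have "S \<le> (4 * sqrt D * V) ^ 6"
  proof (cases "S = 0")
    case False
    then have S: "S > 0" using S0 by simp
    have "S powr (1/6) * S powr (5/6) = S" using S by (simp flip: powr_add)
    then have "S powr (1/6) * S powr (5/6) \<le> 4 * sqrt D * V * S powr (5/6)" using SV by simp
    then have "S powr (1/6) \<le> 4 * sqrt D * V" using S by simp
    then have "(S powr (1/6)) ^ 6 \<le> (4 * sqrt D * V) ^ 6" by (intro power_mono) auto
    then show ?thesis using S by (simp add: powr_power)
  qed (use V0 D in simp)
  then show ?thesis by (simp add: S_def a_def V_def Suc)
qed

lemma Strichartz: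
  "(\<Sum>k<N. linf (flow (gen K) (real k) (F k)) ^ 6)
    \<le> (8 * sqrt D * (norm (F 0) + (\<Sum>k<N-1. norm (F (Suc k) - F k)))) ^ 6"
proof -
  have "\<forall>k. \<exists>n. linf (flow (gen K) (real k) (F k)) / 2 \<le> cmod (seq (flow (gen K) (real k) (F k)) n)"
    by (intro allI linf_half_attained)
  from choice[OF this] obtain idx where idx: "\<And>k. linf (flow (gen K) (real k) (F k)) / 2
      \<le> cmod (seq (flow (gen K) (real k) (F k)) (idx k))"
    by blast
  have "(\<Sum>k<N. (linf (flow (gen K) (real k) (F k)) / 2) ^ 6)
      \<le> (\<Sum>k<N. cmod (seq (flow (gen K) (real k) (F k)) (idx k)) ^ 6)"
    by (intro sum_mono power_mono idx) (simp add: linf_nonneg)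
  also have "\<dots> \<le> (4 * sqrt D * (norm (F 0) + (\<Sum>k<N-1. norm (F (Suc k) - F k)))) ^ 6"
    by (rule Strichartz_pointwise)
  finally show ?thesis
    by (simp add: power_divide power_mult_distrib flip: sum_divide_distrib)
qed

end

text \<open>For |t| < 1 unitarity gives the bound, afterwards the dispersive estimate; the factor 2
  in D pays for replacing |t| by 1 + |t|.\<close>

theorem dispersive_kernel_ker: "\<exists>D. \<forall>\<alpha>>11. dispersive_kernel (ker \<alpha>) D"
proof -
  from dispersive_decay[OF zero_less_one] obtain C where C: "C > 0" "\<And>K m a b t. decaying_kernel K 1 m \<Longrightarrow> 1 \<le> \<bar>t\<bar> \<Longrightarrow>
      cmod (seq (flow (gen K) t (delta a)) b) \<le> C * \<bar>t\<bar> powr (-1/3)"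
    by blast
  define D where "D = 2 * (C + 1)"
  have "dispersive_kernel (ker \<alpha>) D" if \<alpha>: "\<alpha> > 11" for \<alpha>
  proof -
    interpret decaying_kernel "ker \<alpha>" 1 1 by (rule decaying_kernel_ker[OF \<alpha>])
    show ?thesis
    proof
      show "1 \<le> D" using C by (simp add: D_def)
      fix t :: real and a b
      have half: "1 / 2 \<le> (2::real) powr (-1/3)"
        using powr_mono[of "-1" "-1/3" "2::real"] by (simp add: powr_minus_divide)
      show "cmod (seq (flow (gen (ker \<alpha>)) t (delta a)) b) \<le> D * (1 + \<bar>t\<bar>) powr (-1/3)"
      proof (cases "1 \<le> \<bar>t\<bar>")
        case True
        have "\<bar>t\<bar> powr (-1/3) * (1 / 2) \<le> \<bar>t\<bar> powr (-1/3) * 2 powr (-1/3)"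
          using half by (intro mult_left_mono) auto
        also have "\<dots> = (2 * \<bar>t\<bar>) powr (-1/3)" by (simp add: powr_mult mult.commute)
        also have "\<dots> \<le> (1 + \<bar>t\<bar>) powr (-1/3)" using True by (intro powr_mono2') auto
        finally have "\<bar>t\<bar> powr (-1/3) \<le> 2 * (1 + \<bar>t\<bar>) powr (-1/3)" by simp
        then have "C * \<bar>t\<bar> powr (-1/3) \<le> C * (2 * (1 + \<bar>t\<bar>) powr (-1/3))"
          using C(1) by (intro mult_left_mono) auto
        also have "\<dots> \<le> D * (1 + \<bar>t\<bar>) powr (-1/3)" by (simp add: D_def algebra_simps)
        finally show ?thesis using C(2)[OF decaying_kernel_axioms True, of a b] by simp
      next
        case False
        have "2 powr (-1/3) \<le> (1 + \<bar>t\<bar>) powr (-1/3)" using False by (intro powr_mono2') auto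
        then have "1 \<le> 2 * (1 + \<bar>t\<bar>) powr (-1/3)" using half by linarith
        also have "\<dots> \<le> D * (1 + \<bar>t\<bar>) powr (-1/3)" using C(1) by (intro mult_right_mono) (auto simp: D_def)
        finally show ?thesis
          using seq_le_norm[of "flow (gen (ker \<alpha>)) t (delta a)" b] by (simp add: norm_flow)
      qed
    next
      fix f M n assume f: "\<And>n. cmod (seq f n) \<le> M"
      let ?a = "\<lambda>i. \<bar>ker \<alpha> (int (Suc i))\<bar>"
      let ?v = "\<lambda>i. of_real (ker \<alpha> (int (Suc i))) * (2 * seq f n - seq f (n - int (Suc i)) - seq f (n + int (Suc i)))"
      have v: "norm (?v i) \<le> ?a i * (4 * M)" for i
      proof -
        have "norm (2 * seq f n - seq f (n - int (Suc i)) - seq f (n + int (Suc i))) \<le> 2 * M + M + M"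
          using f by (intro order_trans[OF norm_triangle_ineq4] add_mono) (auto simp: norm_mult)
        then show ?thesis by (simp add: norm_mult mult_left_mono)
      qed
      have sa: "summable (\<lambda>i. ?a i * (4 * M))" by (intro summable_mult2 summable_K_Suc)
      have "norm (seq (lapk (ker \<alpha>) f) n) \<le> (\<Sum>i. ?a i * (4 * M))"
        unfolding sums_unique[OF seq_lapk_sums[of f n]]
        by (rule norm_suminf_le[OF v sa])
      also have "\<dots> = (\<Sum>i. ?a i) * (4 * M)" by (rule suminf_mult2[symmetric, OF summable_K_Suc])
      also have "\<dots> \<le> (5 / 4) * (4 * M)"
      proof (intro mult_right_mono)
        \<comment> \<open>The signs of the kernel serve as the bounded factor in
          \<open>symbol_terms\<close> without derivatives: twice the sum of the absolute weights
          differs from 2 by at most 1/2, so that sum is at most 5/4.\<close>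
        have "(\<lambda>i. 2 * ker \<alpha> (int (Suc i)) * real (Suc i) ^ 0 * sgn (ker \<alpha> (int (Suc i)))) = (\<lambda>i. 2 * ?a i)"
          by (auto simp: sgn_if abs_if)
        moreover have "\<bar>sgn (ker \<alpha> (int (Suc i)))\<bar> \<le> 1" for i by (simp add: abs_sgn_eq)
        ultimately have le: "\<bar>(\<Sum>i. 2 * ?a i) - 2 * sgn (ker \<alpha> (int (Suc 0)))\<bar> \<le> 1 / 2"
          using symbol_terms(2)[of 0 "\<lambda>i. sgn (ker \<alpha> (int (Suc i)))"] by simp
        have "(\<Sum>i. 2 * ?a i) = 2 * (\<Sum>i. ?a i)" by (rule suminf_mult[OF summable_K_Suc])
        then show "(\<Sum>i. ?a i) \<le> 5 / 4" using abs_le_D1[OF le] by simp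
        show "0 \<le> 4 * M" using f[of 0] norm_ge_zero[of "seq f 0"] by linarith
      qed
      finally show "cmod (seq (lapk (ker \<alpha>) f) n) \<le> 5 * M" by simp
    qed
  qed
  then show ?thesis by blast
qed


section \<open>Decay in l5\<close>

text \<open>Each term is at most the total A, so a^r \<le> a A^(r-1).\<close>

lemma infsum_powr_le:
  fixes a :: "int \<Rightarrow> real"
  assumes a: "\<And>n. 0 \<le> a n" "a summable_on UNIV" and r: "r \<ge> 1"
  shows "(\<lambda>n. a n powr r) summable_on UNIV" "(\<Sum>\<^sub>\<infinity>n. a n powr r) \<le> (\<Sum>\<^sub>\<infinity>n. a n) powr r"
proof -
  define A where "A = (\<Sum>\<^sub>\<infinity>n. a n)"
  have A0: "A \<ge> 0" unfolding A_def by (intro infsum_nonneg a)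
  have le: "a n \<le> A" for n
    using finite_sum_le_infsum[of a UNIV "{n}"] a by (simp add: A_def)
  have pt: "a n powr r \<le> a n * A powr (r - 1)" for n
  proof (cases "a n = 0")
    case False
    then have "a n powr r = a n * a n powr (r - 1)"
      using a(1)[of n] powr_add[of "a n" 1 "r - 1"] by simp
    also have "\<dots> \<le> a n * A powr (r - 1)"
      using a(1) r le by (intro mult_left_mono powr_mono2) auto
    finally show ?thesis .
  qed simp
  have sm: "(\<lambda>n. a n * A powr (r - 1)) summable_on UNIV"
    by (intro summable_on_cmult_left a)
  show s: "(\<lambda>n. a n powr r) summable_on UNIV"
    by (rule summable_on_comparison_test[OF sm]) (use pt in auto)
  have "(\<Sum>\<^sub>\<infinity>n. a n powr r) \<le> (\<Sum>\<^sub>\<infinity>n. a n * A powr (r - 1))"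
    by (intro infsum_mono s sm pt)
  also have "\<dots> = A * A powr (r - 1)" by (simp add: infsum_cmult_left' A_def)
  also have "\<dots> = A powr r" using A0 powr_add[of A 1 "r - 1"] by (cases "A = 0") auto
  finally show "(\<Sum>\<^sub>\<infinity>n. a n powr r) \<le> (\<Sum>\<^sub>\<infinity>n. a n) powr r" by (simp add: A_def)
qed

lemma lq_norm_mono:
  assumes f: "in_lq q f" and q: "0 < q" "q \<le> r"
  shows "in_lq r f" "lq_norm r f \<le> lq_norm q f"
proof -
  have r1: "r / q \<ge> 1" using q by simp
  have e: "(cmod (f n) powr q) powr (r / q) = cmod (f n) powr r" for n
    using q by (simp add: powr_powr)
  note le = infsum_powr_le[OF _ f[unfolded in_lq_def] r1, unfolded e]
  show "in_lq r f" unfolding in_lq_def by (rule le) simp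
  have "lq_norm r f \<le> ((\<Sum>\<^sub>\<infinity>n. cmod (f n) powr q) powr (r / q)) powr (1 / r)"
    unfolding lq_norm_def using q by (intro powr_mono2 le infsum_nonneg) auto
  also have "\<dots> = lq_norm q f"
    using q by (simp add: powr_powr lq_norm_def)
  finally show "lq_norm r f \<le> lq_norm q f" .
qed

lemma in_l5_seq: "in_lq 5 (seq f)"
  by (rule lq_norm_mono(1)[OF in_l2_seq]) auto

text \<open>Hoelder's inequality up to the factor 2, obtained by optimising \<tau> in
  \<open>Young_weighted\<close> after summation.\<close>

lemma inner_l54_l5:
  assumes x: "in_lq (5/4) (seq x)"
  shows "\<bar>inner x y\<bar> \<le> 2 * lq_norm (5/4) (seq x) * lq_norm 5 (seq y)"
proof -
  define X Y where "X = (\<Sum>\<^sub>\<infinity>n. cmod (seq x n) powr (5/4))" and "Y = (\<Sum>\<^sub>\<infinity>n. cmod (seq y n) powr 5)"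
  have sx: "(\<lambda>n. cmod (seq x n) powr (5/4)) summable_on UNIV" using x by (simp add: in_lq_def)
  have sy: "(\<lambda>n. cmod (seq y n) powr 5) summable_on UNIV" using in_l5_seq[of y] by (simp only: in_lq_def)
  have XY0: "X \<ge> 0" "Y \<ge> 0" unfolding X_def Y_def by (auto intro!: infsum_nonneg)
  have si: "(\<lambda>n. seq x n \<bullet> seq y n) summable_on UNIV" by (intro inner_summable in_l2_seq)
  have si': "(\<lambda>n. \<bar>seq x n \<bullet> seq y n\<bar>) summable_on UNIV"
    using si summable_on_iff_abs_summable_on_real by force
  have b: "\<bar>inner x y\<bar> \<le> \<tau> * X + Y / \<tau> ^ 4" if \<tau>: "\<tau> > 0" for \<tau>
  proof -
    have pt: "\<bar>seq x n \<bullet> seq y n\<bar> \<le> \<tau> * cmod (seq x n) powr (5/4) + cmod (seq y n) powr 5 / \<tau> ^ 4" for n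
    proof -
      have "\<bar>seq x n \<bullet> seq y n\<bar> \<le> cmod (seq x n) * cmod (seq y n)"
        by (rule Cauchy_Schwarz_ineq2)
      also have "\<dots> \<le> \<tau> * cmod (seq x n) powr (1 + 1 / real 4) + cmod (seq y n) ^ Suc 4 / \<tau> ^ 4"
        using \<tau> by (intro Young_weighted) auto
      finally show ?thesis by simp
    qed
    have s: "(\<lambda>n. \<tau> * cmod (seq x n) powr (5/4) + cmod (seq y n) powr 5 / \<tau> ^ 4) summable_on UNIV"
      unfolding divide_inverse[of _ "\<tau> ^ 4"]
      by (intro summable_on_add summable_on_cmult_right summable_on_cmult_left sx sy)
    have "\<bar>inner x y\<bar> \<le> (\<Sum>\<^sub>\<infinity>n. \<bar>seq x n \<bullet> seq y n\<bar>)"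
      unfolding inner_l2_def using norm_infsum_bound[of "\<lambda>n. seq x n \<bullet> seq y n"] si' by simp
    also have "\<dots> \<le> (\<Sum>\<^sub>\<infinity>n. \<tau> * cmod (seq x n) powr (5/4) + cmod (seq y n) powr 5 / \<tau> ^ 4)"
      by (intro infsum_mono si' s pt)
    also have "\<dots> = \<tau> * X + Y / \<tau> ^ 4"
      unfolding divide_inverse[of _ "\<tau> ^ 4"] X_def Y_def
      by (subst infsum_add) (intro summable_on_cmult_right summable_on_cmult_left sx sy
          | simp only: infsum_cmult_right' infsum_cmult_left')+
    finally show ?thesis .
  qed
  show ?thesis
  proof (cases "X = 0 \<or> Y = 0")
    case True
    have "\<bar>inner x y\<bar> \<le> 0"
    proof (rule field_le_epsilon, simp)
      fix e :: real assume e: "e > 0"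
      show "\<bar>inner x y\<bar> \<le> e"
      proof (cases "X = 0")
        case True
        \<comment> \<open>With X = 0 only Y / \<tau>^4 remains, and \<tau> may be taken as large as
          desired; with Y = 0 it is taken small instead.\<close>
        define \<tau> where "\<tau> = (Y / e + 1)"
        have \<tau>: "\<tau> \<ge> 1" using e XY0 by (simp add: \<tau>_def)
        have "Y / \<tau> ^ 4 \<le> Y / \<tau>" using \<tau> XY0 by (intro divide_left_mono) (auto simp: self_le_power)
        also have "\<dots> \<le> e" using e XY0 \<tau> by (simp add: \<tau>_def field_simps)
        finally show ?thesis using b[of \<tau>] True \<tau> by simp
      next
        case False
        then have "Y = 0" "X > 0" using XY0 \<open>X = 0 \<or> Y = 0\<close> by auto
        then show ?thesis using b[of "e / X"] e by simp
      qed
    qed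
    then show ?thesis by (simp add: lq_norm_def)
  next
    case False
    then have XY: "X > 0" "Y > 0" using XY0 by auto
    \<comment> \<open>The value at which \<tau> X and Y / \<tau>^4 agree.\<close>
    define \<tau> where "\<tau> = Y powr (1/5) / X powr (1/5)"
    have \<tau>: "\<tau> > 0" using XY by (simp add: \<tau>_def)
    have "\<tau> * X = X powr (4/5) * Y powr (1/5)"
    proof -
      have "X = X powr (1/5) * X powr (4/5)" using XY by (simp flip: powr_add)
      then have "\<tau> * X = \<tau> * (X powr (1/5) * X powr (4/5))" by simp
      then show ?thesis using XY by (simp add: \<tau>_def)
    qed
    moreover have "Y / \<tau> ^ 4 = X powr (4/5) * Y powr (1/5)"
    proof -
      have "\<tau> ^ 4 = Y powr (4/5) / X powr (4/5)" using XY by (simp add: \<tau>_def power_divide powr_power)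
      moreover have "Y / Y powr (4/5) = Y powr (1/5)" using XY powr_diff[of Y 1 "4/5"] by simp
      ultimately show ?thesis by (simp add: mult.commute flip: times_divide_eq_left)
    qed
    ultimately have "\<bar>inner x y\<bar> \<le> 2 * (X powr (4/5) * Y powr (1/5))" using b[OF \<tau>] by linarith
    then show ?thesis by (simp add: lq_norm_def X_def Y_def mult_ac)
  qed
qed

section \<open>Finite combinations and duality between l5 and l5/4\<close>

definition comb :: "(int \<Rightarrow> complex) \<Rightarrow> int set \<Rightarrow> l2" where
  "comb v F = (\<Sum>n\<in>F. scaleC (v n) (delta n))"

lemma inner_comb: "inner x (comb v F) = (\<Sum>n\<in>F. Re (seq x n * cnj (v n)))"
  unfolding comb_def inner_sum_right inner_delta ..

lemma seq_comb: "finite F \<Longrightarrow> seq (comb v F) n = (if n \<in> F then v n else 0)"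
  by (simp add: comb_def seq_sum scaleC.rep_eq delta.rep_eq mult_delta_right)

lemma norm_comb: "finite F \<Longrightarrow> (norm (comb v F))\<^sup>2 = (\<Sum>n\<in>F. (cmod (v n))\<^sup>2)"
  unfolding power2_norm_eq_inner inner_comb
  by (intro sum.cong refl) (simp add: seq_comb inner_complex_def)

text \<open>The dual norm is used for the continuity argument below because it is visibly Lipschitz
  with respect to the \<open>l2\<close> norm, so that Minkowski's inequality in \<open>l5\<close> is not needed.\<close>

definition unit_l54 :: "l2 set" where
  "unit_l54 = {comb v F | v F. finite F \<and> (\<Sum>n\<in>F. cmod (v n) powr (5/4)) \<le> 1}"

definition dual5 :: "l2 \<Rightarrow> real" where
  "dual5 x = (SUP w\<in>unit_l54. inner x w)"

lemma zero_in_unit_l54: "0 \<in> unit_l54"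
  unfolding unit_l54_def by (intro CollectI exI[of _ "\<lambda>_. 0"] exI[of _ "{}"]) (simp add: comb_def)

lemma norm_unit_l54: "w \<in> unit_l54 \<Longrightarrow> norm w \<le> 1"
proof -
  assume "w \<in> unit_l54"
  then obtain v F where w: "w = comb v F" "finite F" and s: "(\<Sum>n\<in>F. cmod (v n) powr (5/4)) \<le> 1"
    by (auto simp: unit_l54_def)
  have "(cmod (v n))\<^sup>2 \<le> cmod (v n) powr (5/4)" if n: "n \<in> F" for n
  proof -
    have "cmod (v n) powr (5/4) \<le> (\<Sum>n\<in>F. cmod (v n) powr (5/4))"
      using w n by (intro member_le_sum) auto
    then have "(cmod (v n) powr (5/4)) powr (4/5) \<le> 1 powr (4/5)" using s by (intro powr_mono2) auto
    then have "cmod (v n) \<le> 1" by (simp add: powr_powr)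
    then have "cmod (v n) powr 2 \<le> cmod (v n) powr (5/4)" by (intro powr_mono') auto
    then show ?thesis by simp
  qed
  then have "(\<Sum>n\<in>F. (cmod (v n))\<^sup>2) \<le> 1" using s sum_mono by (metis (no_types, lifting) order_trans)
  then have "(norm w)\<^sup>2 \<le> 1\<^sup>2" using w norm_comb by simp
  then show ?thesis by (rule power2_le_imp_le) simp
qed

lemma inner_unit_l54_le_norm: "w \<in> unit_l54 \<Longrightarrow> inner x w \<le> norm x"
  using norm_cauchy_schwarz[of x w] norm_unit_l54[of w] mult_left_mono[of "norm w" 1 "norm x"] by simp

lemma dual5_ge: "w \<in> unit_l54 \<Longrightarrow> inner x w \<le> dual5 x"
  unfolding dual5_def by (rule cSUP_upper) (auto intro!: bdd_aboveI2 inner_unit_l54_le_norm)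

lemma dual5_le: "(\<And>w. w \<in> unit_l54 \<Longrightarrow> inner x w \<le> B) \<Longrightarrow> dual5 x \<le> B"
  unfolding dual5_def using zero_in_unit_l54 by (intro cSUP_least) auto

lemma dual5_nonneg: "0 \<le> dual5 x"
  using dual5_ge[OF zero_in_unit_l54, of x] by simp

lemma dual5_le_norm: "dual5 x \<le> norm x"
  by (intro dual5_le inner_unit_l54_le_norm)

lemma dual5_lipschitz: "\<bar>dual5 x - dual5 y\<bar> \<le> norm (x - y)"
proof -
  have "dual5 x \<le> dual5 y + norm (x - y)" for x y
  proof (rule dual5_le)
    fix w assume w: "w \<in> unit_l54"
    have "inner x w = inner y w + inner (x - y) w" by (simp add: inner_diff_left)
    then show "inner x w \<le> dual5 y + norm (x - y)"
      using dual5_ge[OF w, of y] inner_unit_l54_le_norm[OF w, of "x - y"] by simp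
  qed
  from this[of x y] this[of y x] show ?thesis by (simp add: norm_minus_commute abs_le_iff)
qed

lemma lq5_le_dual5: "lq_norm 5 (seq x) \<le> dual5 x"
proof -
  have fin: "(\<Sum>n\<in>F. cmod (seq x n) ^ 5) \<le> dual5 x ^ 5" if F: "finite F" for F
  proof -
    define P where "P = (\<Sum>n\<in>F. cmod (seq x n) ^ 5)"
    have P0: "P \<ge> 0" unfolding P_def by (intro sum_nonneg) auto
    show ?thesis
    proof (cases "P = 0")
      case True
      then show ?thesis using dual5_nonneg by (simp add: P_def)
    next
      case False
      then have P: "P > 0" using P0 by simp
      \<comment> \<open>The extremal test sequence on F: |x|^3 x divided by P^(4/5) is normalised in
        l5/4 and pairs with x to P^(1/5).\<close>
      define v where "v n = of_real (cmod (seq x n) ^ 3 / P powr (4/5)) * seq x n" for n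
      have "cmod (v n) powr (5/4) = cmod (seq x n) ^ 5 / P" for n
      proof (cases "seq x n = 0")
        case False
        have "cmod (v n) = cmod (seq x n) ^ 4 / P powr (4/5)"
          by (simp add: v_def norm_mult norm_divide norm_power eval_nat_numeral)
        also have "\<dots> = cmod (seq x n) powr 4 / P powr (4/5)" using False by simp
        finally have "cmod (v n) powr (5/4) = (cmod (seq x n) powr 4) powr (5/4) / (P powr (4/5)) powr (5/4)"
          by (simp only: powr_divide powr_ge_zero)
        then show ?thesis using P False by (simp only: powr_powr) simp
      qed (simp add: v_def)
      then have "(\<Sum>n\<in>F. cmod (v n) powr (5/4)) = 1"
        using P by (simp add: P_def flip: sum_divide_distrib)
      then have w: "comb v F \<in> unit_l54" unfolding unit_l54_def using F by fastforce
      have "Re (seq x n * cnj (v n)) = cmod (seq x n) ^ 5 / P powr (4/5)" for n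
      proof -
        have "seq x n * cnj (v n) = of_real (cmod (seq x n) ^ 3 / P powr (4/5)) * (seq x n * cnj (seq x n))"
          by (simp add: v_def)
        also have "\<dots> = of_real (cmod (seq x n) ^ 3 / P powr (4/5) * (cmod (seq x n))\<^sup>2)"
          unfolding complex_norm_square[symmetric] by simp
        finally show ?thesis by (simp add: eval_nat_numeral)
      qed
      then have "inner x (comb v F) = P / P powr (4/5)"
        unfolding inner_comb P_def by (simp flip: sum_divide_distrib)
      also have "\<dots> = P powr 1 / P powr (4/5)" using P by simp
      also have "\<dots> = P powr (1/5)" unfolding powr_diff[symmetric] by simp
      finally have "P powr (1/5) \<le> dual5 x" using dual5_ge[OF w, of x] by simp
      then have "(P powr (1/5)) ^ 5 \<le> dual5 x ^ 5" by (intro power_mono) auto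
      then show ?thesis using P by (simp add: powr_power P_def)
    qed
  qed
  have "(\<Sum>\<^sub>\<infinity>n. cmod (seq x n) powr 5) \<le> dual5 x ^ 5"
    using in_l5_seq[of x] fin unfolding in_lq_def by (intro infsum_le_finite_sums) auto
  then have "lq_norm 5 (seq x) \<le> (dual5 x ^ 5) powr (1/5)"
    unfolding lq_norm_def by (intro powr_mono2 infsum_nonneg) auto
  also have "\<dots> = dual5 x"
  proof (cases "dual5 x = 0")
    case False
    then have "dual5 x ^ 5 = dual5 x powr 5" using dual5_nonneg[of x] by simp
    then show ?thesis using False dual5_nonneg[of x] by (simp only: powr_powr) simp
  qed simp
  finally show ?thesis .
qed

section \<open>Dyadic levels and interpolation\<close>

lemma geometric_dyadic:
  fixes J :: "int set"
  assumes "finite J" "\<And>j. j \<in> J \<Longrightarrow> 2 powr real_of_int j \<le> X" "0 \<le> X"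
  shows "(\<Sum>j\<in>J. (2 powr real_of_int j) ^ 3) \<le> 2 * X ^ 3"
  using assms
proof (induction J arbitrary: X rule: finite_linorder_max_induct)
  case (insert b A)
  let ?q = "2 powr real_of_int b"
  \<comment> \<open>Below the largest exponent b all others are at most b - 1, so the induction
    hypothesis applies with half of ?q, and its cube is an eighth.\<close>
  have "(\<Sum>j\<in>A. (2 powr real_of_int j) ^ 3) \<le> 2 * (?q / 2) ^ 3"
  proof (rule insert.IH)
    fix j assume "j \<in> A"
    then have "j \<le> b - 1" using insert.hyps by auto
    then have "2 powr real_of_int j \<le> 2 powr real_of_int (b - 1)" by (intro powr_mono) auto
    also have "\<dots> = ?q / 2" by (simp add: powr_diff)
    finally show "2 powr real_of_int j \<le> ?q / 2" .
  qed simp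
  moreover have "b \<notin> A" using insert.hyps by auto
  ultimately have "(\<Sum>j\<in>insert b A. (2 powr real_of_int j) ^ 3) \<le> ?q ^ 3 + 2 * (?q / 2) ^ 3"
    using insert.hyps by simp
  also have "\<dots> \<le> 2 * ?q ^ 3" by (simp add: power_divide)
  also have "\<dots> \<le> 2 * X ^ 3" using insert.prems by (intro mult_left_mono power_mono) auto
  finally show ?case .
qed simp

lemma dyadic_level:
  assumes "g > (0::real)"
  obtains j :: int where "2 powr real_of_int j < g" "g \<le> 2 * 2 powr real_of_int j"
proof -
  define j where "j = \<lceil>log 2 g\<rceil> - 1"
  have "real_of_int j < log 2 g" "log 2 g \<le> real_of_int j + 1" unfolding j_def by linarith+
  then have "2 powr real_of_int j < g" "g \<le> 2 powr (real_of_int j + 1)"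
    using assms by (simp_all add: less_log_iff log_le_iff)
  then show ?thesis by (intro that[of j]) (auto simp: powr_add mult.commute)
qed

text \<open>Real interpolation between the bounds \<open>l2 \<rightarrow> l2\<close> and \<open>l1 \<rightarrow> l\<infinity>\<close>:
  at height \<open>\<lambda>\<close> the input is cut at the size \<open>(2 A S / \<lambda>)^4\<close>, which makes the
  contribution of its large part at most \<open>\<lambda> / 2\<close>.\<close>

locale interpolation =
  fixes T :: "l2 \<Rightarrow> l2" and A :: real
  assumes T: "bounded_linear T" and T2: "norm (T x) \<le> norm x" and A: "A > 0"
    and T1: "cmod (seq (T (scaleC c (delta a))) b) \<le> A * cmod c"
begin

interpretation T: bounded_linear T by (rule T)

lemma sup_comb: "cmod (seq (T (comb v F)) m) \<le> A * (\<Sum>n\<in>F. cmod (v n))"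
proof -
  have "seq (T (comb v F)) m = (\<Sum>n\<in>F. seq (T (scaleC (v n) (delta n))) m)"
    unfolding comb_def T.sum seq_sum ..
  also have "cmod \<dots> \<le> (\<Sum>n\<in>F. cmod (seq (T (scaleC (v n) (delta n))) m))" by (rule norm_sum)
  also have "\<dots> \<le> (\<Sum>n\<in>F. A * cmod (v n))" by (intro sum_mono T1)
  finally show ?thesis by (simp add: sum_distrib_left)
qed

lemma level_set:
  assumes F: "finite F" and M: "finite M" and l: "l > 0"
    and S: "S = (\<Sum>n\<in>F. cmod (v n) powr (5/4))" "S > 0"
  shows "real (card {m\<in>M. l < cmod (seq (T (comb v F)) m)}) * l\<^sup>2
    \<le> 4 * (\<Sum>n\<in>{n\<in>F. cmod (v n) \<le> (2 * A * S / l) ^ 4}. (cmod (v n))\<^sup>2)"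
proof -
  define h where "h = (2 * A * S / l) ^ 4"
  have h: "h > 0" using A S l by (simp add: h_def)
  \<comment> \<open>Where the image exceeds l, the large coefficients account for at most l / 2
    pointwise, so the small ones exceed l / 2 and Chebyshev's inequality in l2 counts the sites;
    this is the factor 4.\<close>
  define Fb Fs where "Fb = {n\<in>F. h < cmod (v n)}" and "Fs = {n\<in>F. cmod (v n) \<le> h}"
  have fin: "finite Fb" "finite Fs" using F by (auto simp: Fb_def Fs_def)
  have "(\<Sum>n\<in>Fb. cmod (v n)) \<le> (\<Sum>n\<in>Fb. cmod (v n) powr (5/4) * h powr (-1/4))"
  proof (intro sum_mono)
    fix n assume "n \<in> Fb"
    then have n: "h < cmod (v n)" by (simp add: Fb_def)
    have "cmod (v n) = cmod (v n) powr (5/4) * cmod (v n) powr (-1/4)"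
      using n h by (simp flip: powr_add)
    also have "\<dots> \<le> cmod (v n) powr (5/4) * h powr (-1/4)"
      using n h by (intro mult_left_mono powr_mono2') auto
    finally show "cmod (v n) \<le> cmod (v n) powr (5/4) * h powr (-1/4)" .
  qed
  also have "\<dots> \<le> S * h powr (-1/4)"
    unfolding S(1) sum_distrib_right[symmetric] using F by (intro mult_right_mono sum_mono2) (auto simp: Fb_def)
  also have "h powr (-1/4) = l / (2 * A * S)"
  proof -
    have "h powr (1/4) = 2 * A * S / l"
    proof -
      have "h = (2 * A * S / l) powr 4" using A S l by (simp add: h_def)
      then show ?thesis using A S l by (simp only: powr_powr) simp
    qed
    then show ?thesis using A S l by (simp add: powr_minus_divide)
  qed
  finally have "A * (\<Sum>n\<in>Fb. cmod (v n)) \<le> A * (S * (l / (2 * A * S)))"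
    using A by (intro mult_left_mono) auto
  also have "\<dots> = l / 2" using A S by simp
  finally have big: "cmod (seq (T (comb v Fb)) m) \<le> l / 2" for m
    using sup_comb[of v Fb m] by simp
  have "comb v F = comb v Fb + comb v Fs"
  proof -
    have "F = Fb \<union> Fs" "Fb \<inter> Fs = {}" by (auto simp: Fb_def Fs_def)
    then show ?thesis using fin by (simp add: comb_def sum.union_disjoint)
  qed
  then have split: "seq (T (comb v F)) m = seq (T (comb v Fb)) m + seq (T (comb v Fs)) m" for m
    by (simp add: T.add plus_l2.rep_eq)
  define M' where "M' = {m\<in>M. l < cmod (seq (T (comb v F)) m)}"
  have M': "finite M'" using M by (simp add: M'_def)
  have "(l / 2)\<^sup>2 \<le> (cmod (seq (T (comb v Fs)) m))\<^sup>2" if "m \<in> M'" for m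
  proof (intro power_mono)
    have "l < cmod (seq (T (comb v F)) m)" using that by (simp add: M'_def)
    also have "\<dots> \<le> cmod (seq (T (comb v Fb)) m) + cmod (seq (T (comb v Fs)) m)"
      unfolding split by (rule norm_triangle_ineq)
    finally show "l / 2 \<le> cmod (seq (T (comb v Fs)) m)" using big[of m] by simp
  qed (use l in auto)
  then have "(\<Sum>m\<in>M'. (l / 2)\<^sup>2) \<le> (\<Sum>m\<in>M'. (cmod (seq (T (comb v Fs)) m))\<^sup>2)"
    by (intro sum_mono)
  also have "\<dots> \<le> (norm (T (comb v Fs)))\<^sup>2" by (rule sum_le_norm_l2[OF M'])
  also have "\<dots> \<le> (norm (comb v Fs))\<^sup>2" by (intro power_mono T2) auto
  also have "\<dots> = (\<Sum>n\<in>Fs. (cmod (v n))\<^sup>2)" by (rule norm_comb[OF fin(2)])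
  finally show ?thesis by (simp add: M'_def Fs_def h_def power_divide)
qed

text \<open>Sum \<open>level_set\<close> over dyadic heights q and exchange the sums: a coefficient
  v n is counted at heights up to X = 2 A S |v n|^(-1/4) only. Cubes of dyadic numbers below X sum
  to at most 2 X^3, and X^3 |v n|^2 = 8 A^3 S^3 |v n|^(5/4); altogether 128 * 16 = 2048.\<close>

lemma strong_type:
  assumes F: "finite F" and M: "finite M"
  shows "(\<Sum>m\<in>M. cmod (seq (T (comb v F)) m) ^ 5) \<le> 2048 * A ^ 3 * (\<Sum>n\<in>F. cmod (v n) powr (5/4)) ^ 4"
proof -
  define S where "S = (\<Sum>n\<in>F. cmod (v n) powr (5/4))"
  have S0: "S \<ge> 0" unfolding S_def by (intro sum_nonneg) auto
  define g where "g m = cmod (seq (T (comb v F)) m)" for m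
  show ?thesis
  proof (cases "S = 0")
    case True
    then have "\<forall>n\<in>F. cmod (v n) powr (5/4) = 0"
      using F unfolding S_def by (subst (asm) sum_nonneg_eq_0_iff) auto
    then have "(\<Sum>n\<in>F. cmod (v n)) = 0" by simp
    then have "g m = 0" for m using sup_comb[of v F m] by (simp add: g_def)
    then show ?thesis using S0 A by (simp add: g_def S_def)
  next
    case False
    then have S: "S > 0" using S0 by simp
    define q where "q j = 2 powr real_of_int j" for j :: int
    have q0: "q j > 0" for j by (simp add: q_def)
    define M1 where "M1 = {m\<in>M. g m > 0}"
    have M1: "finite M1" using M by (simp add: M1_def)
    have "\<forall>m. \<exists>j. g m > 0 \<longrightarrow> q j < g m \<and> g m \<le> 2 * q j"
      unfolding q_def using dyadic_level by metis
    from choice[OF this] obtain lv where lv: "\<And>m. g m > 0 \<Longrightarrow> q (lv m) < g m \<and> g m \<le> 2 * q (lv m)"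
      by blast
    define J where "J = lv ` M1"
    have J: "finite J" using M1 by (simp add: J_def)
    have lev: "32 * q j ^ 5 * real (card {m\<in>M. q j < g m})
        \<le> 128 * q j ^ 3 * (\<Sum>n\<in>{n\<in>F. cmod (v n) \<le> (2 * A * S / q j) ^ 4}. (cmod (v n))\<^sup>2)" for j
    proof -
      have "32 * q j ^ 5 * real (card {m\<in>M. q j < g m})
          = 32 * q j ^ 3 * (real (card {m\<in>M. q j < g m}) * (q j)\<^sup>2)"
        by (simp add: eval_nat_numeral)
      also have "\<dots> \<le> 32 * q j ^ 3 * (4 * (\<Sum>n\<in>{n\<in>F. cmod (v n) \<le> (2 * A * S / q j) ^ 4}. (cmod (v n))\<^sup>2))"
        using q0[of j] unfolding g_def by (intro mult_left_mono level_set[OF F M q0 S_def S]) auto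
      finally show ?thesis by simp
    qed
    have geo: "(\<Sum>j\<in>{j\<in>J. cmod (v n) \<le> (2 * A * S / q j) ^ 4}. q j ^ 3) * (cmod (v n))\<^sup>2
        \<le> 16 * A ^ 3 * S ^ 3 * cmod (v n) powr (5/4)" for n
    proof (cases "v n = 0")
      case False
      define X where "X = 2 * A * S * cmod (v n) powr (-1/4)"
      have "(\<Sum>j\<in>{j\<in>J. cmod (v n) \<le> (2 * A * S / q j) ^ 4}. q j ^ 3) \<le> 2 * X ^ 3"
        unfolding q_def
      proof (rule geometric_dyadic)
        fix j assume "j \<in> {j \<in> J. cmod (v n) \<le> (2 * A * S / 2 powr real_of_int j) ^ 4}"
        then have le: "cmod (v n) \<le> (2 * A * S / q j) ^ 4" by (simp add: q_def)
        have "(2 * A * S / q j) ^ 4 = (2 * A * S / q j) powr 4" using A S q0[of j] by simp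
        with le have "cmod (v n) powr (1/4) \<le> ((2 * A * S / q j) powr 4) powr (1/4)"
          by (intro powr_mono2) auto
        also have "\<dots> = 2 * A * S / q j" using A S q0[of j] by (simp only: powr_powr) simp
        finally have "cmod (v n) powr (1/4) * q j \<le> 2 * A * S"
          using q0[of j] by (simp add: field_simps)
        then have "q j \<le> 2 * A * S / cmod (v n) powr (1/4)"
          using False by (simp add: pos_le_divide_eq mult.commute)
        then show "2 powr real_of_int j \<le> X"
          by (simp add: X_def powr_minus_divide q_def)
      qed (use J A S in \<open>auto simp: X_def\<close>)
      then have "(\<Sum>j\<in>{j\<in>J. cmod (v n) \<le> (2 * A * S / q j) ^ 4}. q j ^ 3) * (cmod (v n))\<^sup>2
          \<le> 2 * X ^ 3 * (cmod (v n))\<^sup>2" by (intro mult_right_mono) auto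
      also have "\<dots> = 16 * A ^ 3 * S ^ 3 * ((cmod (v n) powr (-1/4)) ^ 3 * cmod (v n) powr 2)"
        by (simp add: X_def power_mult_distrib)
      also have "(cmod (v n) powr (-1/4)) ^ 3 * cmod (v n) powr 2 = cmod (v n) powr (5/4)"
      proof -
        have "(cmod (v n) powr (-1/4)) ^ 3 = cmod (v n) powr (-3/4)" using False by (simp add: powr_power)
        then show ?thesis by (simp only: flip: powr_add) simp
      qed
      finally show ?thesis .
    qed simp
    have "(\<Sum>m\<in>M. g m ^ 5) = (\<Sum>m\<in>M1. g m ^ 5)"
      using M by (intro sum.mono_neutral_right) (auto simp: M1_def g_def)
    also have "\<dots> \<le> (\<Sum>m\<in>M1. 32 * q (lv m) ^ 5)"
    proof (intro sum_mono)
      fix m assume "m \<in> M1"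
      then have "g m ^ 5 \<le> (2 * q (lv m)) ^ 5" using lv[of m] by (intro power_mono) (auto simp: M1_def)
      then show "g m ^ 5 \<le> 32 * q (lv m) ^ 5" by (simp add: power_mult_distrib)
    qed
    also have "\<dots> = (\<Sum>j\<in>J. \<Sum>m\<in>{m\<in>M1. lv m = j}. 32 * q (lv m) ^ 5)"
      unfolding J_def by (rule sum.image_gen[OF M1])
    also have "\<dots> = (\<Sum>j\<in>J. 32 * q j ^ 5 * real (card {m\<in>M1. lv m = j}))"
      by (intro sum.cong refl) (simp add: mult.commute)
    also have "\<dots> \<le> (\<Sum>j\<in>J. 32 * q j ^ 5 * real (card {m\<in>M. q j < g m}))"
      using q0 M lv by (intro sum_mono mult_left_mono of_nat_mono card_mono)
        (auto simp: M1_def less_imp_le)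
    also have "\<dots> \<le> (\<Sum>j\<in>J. 128 * q j ^ 3 * (\<Sum>n\<in>{n\<in>F. cmod (v n) \<le> (2 * A * S / q j) ^ 4}. (cmod (v n))\<^sup>2))"
      by (intro sum_mono lev)
    also have "\<dots> = (\<Sum>j\<in>J. \<Sum>n\<in>{n\<in>F. cmod (v n) \<le> (2 * A * S / q j) ^ 4}. 128 * (q j ^ 3 * (cmod (v n))\<^sup>2))"
      by (simp add: sum_distrib_left mult.assoc)
    also have "\<dots> = (\<Sum>n\<in>F. \<Sum>j\<in>{j\<in>J. cmod (v n) \<le> (2 * A * S / q j) ^ 4}. 128 * (q j ^ 3 * (cmod (v n))\<^sup>2))"
      by (rule sum.swap_restrict[OF J F])
    also have "\<dots> = (\<Sum>n\<in>F. 128 * ((\<Sum>j\<in>{j\<in>J. cmod (v n) \<le> (2 * A * S / q j) ^ 4}. q j ^ 3) * (cmod (v n))\<^sup>2))"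
      by (simp add: sum_distrib_left sum_distrib_right mult.assoc)
    also have "\<dots> \<le> (\<Sum>n\<in>F. 128 * (16 * A ^ 3 * S ^ 3 * cmod (v n) powr (5/4)))"
      by (intro sum_mono mult_left_mono geo) auto
    also have "\<dots> = 2048 * A ^ 3 * S ^ 3 * S" by (simp add: S_def flip: sum_distrib_left)
    finally show ?thesis by (simp add: g_def S_def eval_nat_numeral mult_ac)
  qed
qed

end

context dispersive_kernel
begin

text \<open>In the fifth root of \<open>strong_type\<close> the factor A^(3/5) turns the rate 1/3
  into 1/5; 2048 is rounded up to 3125 = 5^5.\<close>

lemma lq5_flow_unit:
  assumes w: "w \<in> unit_l54"
  shows "lq_norm 5 (seq (flow (gen K) t w)) \<le> 5 * D * (1 + \<bar>t\<bar>) powr (-1/5)"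
proof -
  define A where "A = D * (1 + \<bar>t\<bar>) powr (-1/3)"
  have A: "A > 0" using D by (simp add: A_def)
  interpret interpolation "flow (gen K) t" A
  proof (rule interpolation.intro)
    show "cmod (seq (flow (gen K) t (scaleC c (delta a))) b) \<le> A * cmod c" for c a b
      using mult_left_mono[OF dispersive[of t a b], of "cmod c"]
      by (simp add: flow_scaleC scaleC.rep_eq norm_mult A_def mult_ac)
  qed (auto simp: norm_flow A bounded_linear_flow)
  obtain v F where vF: "w = comb v F" "finite F" "(\<Sum>n\<in>F. cmod (v n) powr (5/4)) \<le> 1"
    using w by (auto simp: unit_l54_def)
  have fin: "(\<Sum>m\<in>M. cmod (seq (flow (gen K) t w) m) ^ 5) \<le> 3125 * A ^ 3" if "finite M" for M
  proof -
    have "(\<Sum>m\<in>M. cmod (seq (flow (gen K) t w) m) ^ 5) \<le> 2048 * A ^ 3 * (\<Sum>n\<in>F. cmod (v n) powr (5/4)) ^ 4"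
      unfolding vF(1) by (rule strong_type[OF vF(2) that])
    also have "\<dots> \<le> 2048 * A ^ 3 * 1"
      using A vF(3) by (intro mult_left_mono power_le_one sum_nonneg) auto
    also have "\<dots> \<le> 3125 * A ^ 3" using A by simp
    finally show ?thesis .
  qed
  have "(\<Sum>\<^sub>\<infinity>m. cmod (seq (flow (gen K) t w) m) powr 5) \<le> 3125 * A ^ 3"
    using in_l5_seq[of "flow (gen K) t w"] fin unfolding in_lq_def by (intro infsum_le_finite_sums) auto
  then have "lq_norm 5 (seq (flow (gen K) t w)) \<le> (3125 * A ^ 3) powr (1/5)"
    unfolding lq_norm_def by (intro powr_mono2 infsum_nonneg) auto
  also have "\<dots> = 5 * A powr (3/5)"
  proof -
    have "3125 * A ^ 3 = 5 powr 5 * A powr 3" using A by simp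
    then show ?thesis using A by (simp only: powr_mult powr_powr) simp
  qed
  also have "\<dots> = 5 * (D powr (3/5) * (1 + \<bar>t\<bar>) powr (-1/5))"
    using D by (simp add: A_def powr_mult powr_powr)
  also have "\<dots> \<le> 5 * (D powr 1 * (1 + \<bar>t\<bar>) powr (-1/5))"
    using D by (intro mult_left_mono mult_right_mono powr_mono) auto
  finally show ?thesis using D by simp
qed

end

section \<open>The continuity argument for decay\<close>

lemma bootstrap:
  fixes h :: "real \<Rightarrow> real"
  assumes cont: "continuous_on {0..} h" and h0: "h 0 < M"
    and step: "\<And>t. 0 \<le> t \<Longrightarrow> (\<And>s. s \<in> {0..t} \<Longrightarrow> h s \<le> M) \<Longrightarrow> h t < M"
    and t: "0 \<le> t"
  shows "h t < M"
proof (rule ccontr)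
  assume "\<not> h t < M"
  then have ht: "M \<le> h t" by simp
  define Z where "Z = {s\<in>{0..t}. h s = M}"
  have ct: "continuous_on {0..t'} h" for t'
    using cont by (rule continuous_on_subset) auto
  have ex: "\<exists>s\<in>Z. s \<le> t'" if "0 \<le> t'" "t' \<le> t" "M \<le> h t'" for t'
  proof -
    have "\<exists>s\<ge>0. s \<le> t' \<and> h s = M"
      using IVT'[of h 0 M t'] h0 that ct by auto
    then obtain s where "0 \<le> s" "s \<le> t'" "h s = M" by blast
    then show ?thesis using that by (intro bexI[of _ s]) (auto simp: Z_def)
  qed
  have "closed Z"
    unfolding Z_def by (rule continuous_closed_preimage_constant[OF ct]) simp
  moreover have "bounded Z" unfolding Z_def by (rule bounded_subset[of "{0..t}"]) auto
  ultimately have cZ: "compact Z" by (simp add: compact_eq_bounded_closed)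
  have nZ: "Z \<noteq> {}" using ex[OF t order_refl ht] by auto
  \<comment> \<open>The first time with h = M. An earlier excess over M would, by the intermediate
    value theorem, yield a still earlier such time; so \<open>step\<close> applies at s0 and
    contradicts h s0 = M.\<close>
  obtain s0 where s0: "s0 \<in> Z" "\<And>s. s \<in> Z \<Longrightarrow> s0 \<le> s"
    using compact_attains_inf[OF cZ nZ] by auto
  have "h s \<le> M" if "s \<in> {0..s0}" for s
  proof (rule ccontr)
    assume "\<not> h s \<le> M"
    moreover have "0 \<le> s" "s \<le> t" using that s0(1) by (auto simp: Z_def)
    ultimately obtain z where "z \<in> Z" "z \<le> s" using ex[of s] by fastforce
    then have "s = s0" using s0(2)[of z] that by simp
    then show False using s0(1) \<open>\<not> h s \<le> M\<close> by (simp add: Z_def)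
  qed
  then have "h s0 < M" using s0(1) by (intro step) (auto simp: Z_def)
  then show False using s0(1) by (simp add: Z_def)
qed

context dispersive_kernel
begin

text \<open>A bootstrap for (1 + s)^(1/5) times the dual norm, below twice the linear contribution.
  Under this hypothesis the forcing decays in l5/4 like (1 + s)^(-7/5), since p \<ge> 7, which is
  integrable and faster than the rate to be proved.\<close>

lemma l5_decay_forward:
  assumes u: "\<And>t. (u has_vector_derivative gen K (u t) + n t) (at t)"
    and n: "\<And>t. in_lq (5/4) (seq (n t))" "\<And>t. lq_norm (5/4) (seq (n t)) \<le> dual5 (u t) powr p"
    and p: "p \<ge> 7"
    and f: "in_lq (5/4) (seq (u 0))" "0 < lq_norm (5/4) (seq (u 0))"
      "5600 * D\<^sup>2 * lq_norm (5/4) (seq (u 0)) \<le> 1"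
    and t: "t \<ge> 0"
  shows "dual5 (u t) \<le> 20 * D * (1 + t) powr (-1/5) * lq_norm (5/4) (seq (u 0))"
proof -
  define e where "e = lq_norm (5/4) (seq (u 0))"
  \<comment> \<open>The size of the linear part: 2 from \<open>inner_l54_l5\<close> times 5 D from
    \<open>lq5_flow_unit\<close> times e.\<close>
  define a where "a = 10 * D * e"
  define h where "h s = (1 + s) powr (1/5) * dual5 (u s)" for s
  have e: "e > 0" using f by (simp add: e_def)
  have a: "a > 0" "560 * D * a \<le> 1" using e D f(3) by (auto simp: a_def e_def power2_eq_square)
  have "560 * 1 * a \<le> 560 * D * a" using a D by (intro mult_right_mono mult_left_mono) auto
  then have a1: "2 * a \<le> 1" using a by linarith
  have Dp: "D > 0" using D by simp
  have "h s < 2 * a" if s: "0 \<le> s" for s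
  proof (rule bootstrap[OF _ _ _ s])
    have cu: "continuous_on {0..} u"
      using has_vector_derivative_continuous[OF u] 
      by (intro continuous_at_imp_continuous_on ballI)
    have "continuous_on UNIV dual5"
      by (rule lipschitz_on_continuous_on[of 1])
         (auto intro!: lipschitz_onI simp: dist_norm dual5_lipschitz)
    from continuous_on_compose2[OF this cu] have "continuous_on {0..} (\<lambda>s. dual5 (u s))" by simp
    then show "continuous_on {0..} h"
      unfolding h_def by (intro continuous_intros) auto
    have "h 0 \<le> norm (u 0)" by (simp add: h_def dual5_le_norm)
    also have "\<dots> \<le> e"
      unfolding norm_l2_def e_def by (rule lq_norm_mono(2)[OF f(1)]) auto
    also have "\<dots> \<le> 10 * D * e" using D e mult_right_mono[of 1 "10 * D" e] by simp
    also have "\<dots> < 2 * a" using a by (simp add: a_def)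
    finally show "h 0 < 2 * a" .
    fix t assume t: "0 \<le> t" and hs: "\<And>s. s \<in> {0..t} \<Longrightarrow> h s \<le> 2 * a"
    define B where "B = 10 * D * (2 * a) powr p"
    have B: "B \<ge> 0" using D by (simp add: B_def)
    have us: "dual5 (u s) \<le> 2 * a * (1 + s) powr (-1/5)" if "s \<in> {0..t}" for s
      using hs[OF that] that by (simp add: h_def powr_minus_divide field_simps)
    have ns: "lq_norm (5/4) (seq (n s)) \<le> (2 * a) powr p * (1 + s) powr (-7/5)" if "s \<in> {0..t}" for s
    proof -
      have "lq_norm (5/4) (seq (n s)) \<le> (2 * a * (1 + s) powr (-1/5)) powr p"
        using p us[OF that] dual5_nonneg by (intro order_trans[OF n(2)] powr_mono2) auto
      also have "\<dots> = (2 * a) powr p * (1 + s) powr (- p / 5)"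
        using a by (simp add: powr_mult powr_powr)
      also have "\<dots> \<le> (2 * a) powr p * (1 + s) powr (-7/5)"
        using p that by (intro mult_left_mono powr_mono) auto
      finally show ?thesis .
    qed
    have "dual5 (u t) \<le> (3 / 2 * a) * (1 + t) powr (-1/5)"
    proof (rule dual5_le)
      fix w assume w: "w \<in> unit_l54"
      \<comment> \<open>Pairs the solution with the free solution equal to w at time t: \<phi> t is
        the quantity wanted, \<phi> 0 the linear part, and the derivative is the Duhamel
        integrand.\<close>
      define \<phi> where "\<phi> s = inner (u s) (flow (gen K) (s - t) w)" for s
      have d\<phi>: "(\<phi> has_real_derivative inner (n s) (flow (gen K) (s - t) w)) (at s)" for s
        using weak_duhamel[where t = s and c = "- t" and y = w, OF u] by (simp add: \<phi>_def[abs_def])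
      have d\<phi>_le: "\<bar>inner (n s) (flow (gen K) (s - t) w)\<bar> \<le> B * ((1 + s) powr (-7/5) * (1 + (t - s)) powr (-1/5))"
        if "s \<in> {0..t}" for s
      proof -
        have "\<bar>inner (n s) (flow (gen K) (s - t) w)\<bar>
            \<le> 2 * lq_norm (5/4) (seq (n s)) * lq_norm 5 (seq (flow (gen K) (s - t) w))"
          by (rule inner_l54_l5[OF n(1)])
        also have "\<dots> \<le> 2 * ((2 * a) powr p * (1 + s) powr (-7/5)) * (5 * D * (1 + \<bar>s - t\<bar>) powr (-1/5))"
          using ns[OF that] D by (intro mult_mono lq5_flow_unit w) (auto simp: lq_norm_def)
        finally show ?thesis using that by (simp add: B_def mult_ac)
      qed
      have cont: "continuous_on S \<phi>" for S
        by (rule continuous_on_if_derivative[OF d\<phi>])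
      have vd: "(\<phi> has_vector_derivative inner (n s) (flow (gen K) (s - t) w)) (at s)" for s
        using d\<phi> has_real_derivative_iff_has_vector_derivative by blast
      \<comment> \<open>Up to t/2 the flow has at least t/2 time left to decay, and the forcing is
        integrated, with mass at most 5/2.\<close>
      have first: "\<bar>\<phi> (t/2) - \<phi> 0\<bar> \<le> 5/2 * B * (1 + t/2) powr (-1/5)"
      proof (cases "t = 0")
        case False
        define \<psi> where "\<psi> s = - (5/2) * B * (1 + t/2) powr (-1/5) * (1 + s) powr (-2/5)" for s
        have d\<psi>: "(\<psi> has_real_derivative B * ((1 + t/2) powr (-1/5) * (1 + s) powr (-7/5))) (at s)" if "0 \<le> s" for s
          unfolding \<psi>_def using that by (auto intro!: derivative_eq_intros)
        have "norm (\<phi> (t/2) - \<phi> 0) \<le> \<psi> (t/2) - \<psi> 0"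
        proof (rule differentiable_bound_general[OF _ cont _ vd])
          show "continuous_on {0..t/2} \<psi>" by (rule continuous_on_if_derivative[OF d\<psi>]) simp
          fix s assume s: "0 < s" "s < t/2"
          show "(\<psi> has_vector_derivative B * ((1 + t/2) powr (-1/5) * (1 + s) powr (-7/5))) (at s)"
            using d\<psi>[of s] s has_real_derivative_iff_has_vector_derivative by (metis less_imp_le)
          have "(1 + s) powr (-7/5) * (1 + (t - s)) powr (-1/5) \<le> (1 + s) powr (-7/5) * (1 + t/2) powr (-1/5)"
            using s by (intro mult_left_mono powr_mono2') auto
          then have "B * ((1 + s) powr (-7/5) * (1 + (t - s)) powr (-1/5)) \<le> B * ((1 + t/2) powr (-1/5) * (1 + s) powr (-7/5))"
            using B by (intro mult_left_mono) (auto simp: mult.commute)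
          then show "norm (inner (n s) (flow (gen K) (s - t) w)) \<le> B * ((1 + t/2) powr (-1/5) * (1 + s) powr (-7/5))"
            using d\<phi>_le[of s] s by simp
        qed (use False t in auto)
        also have "\<dots> \<le> 5/2 * B * (1 + t/2) powr (-1/5)" using B by (simp add: \<psi>_def)
        finally show ?thesis by simp
      qed (use B in simp)
      \<comment> \<open>After t/2 the forcing itself is small: (1 + t/2)^(-7/5) times the length of
        the interval leaves (1 + t/2)^(-2/5).\<close>
      have second: "\<bar>\<phi> t - \<phi> (t/2)\<bar> \<le> B * (1 + t/2) powr (-1/5)"
      proof (cases "t = 0")
        case False
        define c where "c = B * (1 + t/2) powr (-7/5)"
        have c: "c \<ge> 0" using B by (simp add: c_def)
        have "norm (\<phi> t - \<phi> (t/2)) \<le> c * t - c * (t/2)"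
        proof (rule differentiable_bound_general[OF _ cont _ vd])
          show "continuous_on {t/2..t} (\<lambda>s. c * s)" by (intro continuous_intros)
          fix s assume s: "t/2 < s" "s < t"
          show "((\<lambda>s. c * s) has_vector_derivative c) (at s)"
            by (auto intro!: derivative_eq_intros)
          have "(1 + s) powr (-7/5) * (1 + (t - s)) powr (-1/5) \<le> (1 + t/2) powr (-7/5) * 1 powr (-1/5)"
            using s t by (intro mult_mono powr_mono2') auto
          then have "B * ((1 + s) powr (-7/5) * (1 + (t - s)) powr (-1/5)) \<le> c"
            using B unfolding c_def by (intro mult_left_mono) auto
          then show "norm (inner (n s) (flow (gen K) (s - t) w)) \<le> c"
            using d\<phi>_le[of s] s t by simp
        qed (use False t in auto)
        also have "\<dots> = c * (t/2)" by simp
        also have "\<dots> \<le> c * (1 + t/2)" using c by (intro mult_left_mono) auto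
        also have "\<dots> = B * ((1 + t/2) powr (-7/5) * (1 + t/2) powr 1)" using t by (simp add: c_def)
        also have "\<dots> = B * (1 + t/2) powr (-2/5)" unfolding powr_add[symmetric] by simp
        also have "\<dots> \<le> B * (1 + t/2) powr (-1/5)" using B t by (intro mult_left_mono powr_mono) auto
        finally show ?thesis by simp
      qed (use B in simp)
      have "\<bar>\<phi> 0\<bar> \<le> 2 * e * (5 * D * (1 + \<bar>0 - t\<bar>) powr (-1/5))"
        unfolding \<phi>_def e_def using f(2)
        by (intro order_trans[OF inner_l54_l5[OF f(1)]] mult_left_mono lq5_flow_unit w) auto
      then have zero: "\<bar>\<phi> 0\<bar> \<le> a * (1 + t) powr (-1/5)" using t by (simp add: a_def mult_ac)
      have half: "(1 + t/2) powr (-1/5) \<le> 2 * (1 + t) powr (-1/5)"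
      proof -
        have "(1 + t/2) powr (-1/5) \<le> ((1 + t) / 2) powr (-1/5)" using t by (intro powr_mono2') auto
        also have "\<dots> = (1 + t) powr (-1/5) * 2 powr (1/5)"
          using t by (simp add: powr_divide powr_minus_divide)
        also have "\<dots> \<le> (1 + t) powr (-1/5) * 2 powr 1" by (intro mult_left_mono powr_mono) auto
        finally show ?thesis by simp
      qed
      have "7/2 * B * (1 + t/2) powr (-1/5) \<le> 7/2 * B * (2 * (1 + t) powr (-1/5))"
        using B half by (intro mult_left_mono) auto
      then have "\<phi> t \<le> (a + 7 * B) * (1 + t) powr (-1/5)"
        using abs_le_D1[OF first] abs_le_D1[OF second] abs_le_D1[OF zero] by (simp add: algebra_simps)
      \<comment> \<open>The smallness constant is fixed here: 70 D (2 a)^2 = (560 D a) (a / 2), and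
        560 D a = 5600 D^2 e.\<close>
      also have "7 * B \<le> a / 2"
      proof -
        have "(2 * a) powr p \<le> (2 * a) powr 2" using a a1 p by (intro powr_mono') auto
        then have "10 * D * (2 * a) powr p \<le> 10 * D * (2 * a) powr 2" using D by (intro mult_left_mono) auto
        then have "7 * B \<le> 70 * D * (2 * a)\<^sup>2" using a by (simp add: B_def)
        also have "\<dots> = (560 * D * a) * (a / 2)" by (simp add: power2_eq_square)
        also have "\<dots> \<le> 1 * (a / 2)" using a by (intro mult_right_mono) auto
        finally show ?thesis by simp
      qed
      finally show "inner (u t) w \<le> 3 / 2 * a * (1 + t) powr (-1/5)"
        by (simp add: \<phi>_def flow_0 mult_right_mono)
    qed
    then have "h t \<le> (1 + t) powr (1/5) * ((3 / 2 * a) * (1 + t) powr (-1/5))"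
      unfolding h_def by (intro mult_left_mono) auto
    also have "\<dots> = 3 / 2 * a" using t by (simp add: powr_minus_divide)
    finally show "h t < 2 * a" using a by simp
  qed
  from this[OF t] have "(1 + t) powr (1/5) * dual5 (u t) < 2 * a" by (simp add: h_def)
  then show ?thesis using t by (simp add: powr_minus_divide field_simps a_def e_def)
qed

lemma gen_uminus: "gen (\<lambda>j. - K j) f = - gen K f"
  by (simp add: gen_def lapk_def infsum_uminus scaleC_minus bounded_linear_scaleC[THEN bounded_linear.linear, THEN linear_neg])

text \<open>Time reversal: u (- t) solves the equation with kernel -K, which extends the decay to
  negative times.\<close>

lemma dispersive_kernel_uminus: "dispersive_kernel (\<lambda>j. - K j) D"
proof
  show "(\<lambda>j. - K j) summable_on UNIV" using summable by (simp add: summable_on_uminus)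
  show "cmod (seq (flow (gen (\<lambda>j. - K j)) t (delta a)) b) \<le> D * (1 + \<bar>t\<bar>) powr (-1/3)" for t a b
    using dispersive[of "- t" a b] unfolding gen_uminus[abs_def] by (simp add: flow_uminus)
  show "cmod (seq (lapk (\<lambda>j. - K j) f) n) \<le> 5 * M" if "\<And>n. cmod (seq f n) \<le> M" for f M n
    using lapk_sup[OF that] by (simp add: lapk_def infsum_uminus uminus_l2.rep_eq)
qed (use D even in auto)

theorem l5_decay:
  assumes u: "\<And>t. (u has_vector_derivative gen K (u t) + n t) (at t)"
    and n: "\<And>t. in_lq (5/4) (seq (n t))" "\<And>t. lq_norm (5/4) (seq (n t)) \<le> dual5 (u t) powr p"
    and p: "p \<ge> 7"
    and f: "in_lq (5/4) (seq (u 0))" "0 < lq_norm (5/4) (seq (u 0))"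
      "5600 * D\<^sup>2 * lq_norm (5/4) (seq (u 0)) \<le> 1"
  shows "lq_norm 5 (seq (u t)) \<le> 20 * D * (1 + \<bar>t\<bar>) powr (-1/5) * lq_norm (5/4) (seq (u 0))"
proof (cases "t \<ge> 0")
  case True
  then show ?thesis
    using l5_decay_forward[OF u n p f True] lq5_le_dual5[of "u t"] by simp
next
  case False
  interpret R: dispersive_kernel "\<lambda>j. - K j" D by (rule dispersive_kernel_uminus)
  have d: "((\<lambda>t. u (- t)) has_vector_derivative gen (\<lambda>j. - K j) (u (- t)) + - n (- t)) (at t)" for t
  proof -
    have "(uminus has_vector_derivative -1) (at t)"
      by (auto intro!: derivative_eq_intros simp: has_vector_derivative_def)
    from vector_diff_chain_at[OF this u] show ?thesis by (simp add: o_def gen_uminus)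
  qed
  have "dual5 (u (- (- t))) \<le> 20 * D * (1 + (- t)) powr (-1/5) * lq_norm (5/4) (seq (u (- 0)))"
    using False n f p
    by (intro R.l5_decay_forward[OF d]) (auto simp: in_lq_def lq_norm_def uminus_l2.rep_eq)
  then show ?thesis using False lq5_le_dual5[of "u t"] by simp
qed

end


section \<open>Small solutions\<close>

lemma norm_l2_mono:
  assumes "\<And>n. cmod (seq x n) \<le> c * cmod (seq y n)" "0 \<le> c"
  shows "norm x \<le> c * norm y"
proof (rule norm_l2_leI)
  fix F :: "int set" assume F: "finite F"
  have "(\<Sum>n\<in>F. (cmod (seq x n))\<^sup>2) \<le> (\<Sum>n\<in>F. (c * cmod (seq y n))\<^sup>2)"
    using assms by (intro sum_mono power_mono) auto
  also have "\<dots> = c\<^sup>2 * (\<Sum>n\<in>F. (cmod (seq y n))\<^sup>2)"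
    by (simp add: power_mult_distrib sum_distrib_left)
  also have "\<dots> \<le> c\<^sup>2 * (norm y)\<^sup>2"
    by (intro mult_left_mono sum_le_norm_l2 F) auto
  finally show "(\<Sum>n\<in>F. (cmod (seq x n))\<^sup>2) \<le> (c * norm y)\<^sup>2" by (simp add: power_mult_distrib)
qed (use assms in auto)

text \<open>The factor b is the modulus that accompanies this difference in the next lemma; it
  restores the power lost in the mean value theorem.\<close>

lemma powr_diff_le:
  fixes a b q :: real
  assumes "0 \<le> b" "b \<le> a" "1 \<le> q"
  shows "(a powr q - b powr q) * b \<le> q * a powr q * (a - b)"
proof (cases "b = 0 \<or> a = b")
  case True
  then show ?thesis using assms by auto
next
  case False
  then have ab: "0 < b" "b < a" using assms by auto
  have "((\<lambda>x. x powr q) has_real_derivative q * x powr (q - 1)) (at x)" if "b \<le> x" for x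
    using that ab by (intro has_real_derivative_powr) auto
  from MVT2[OF ab(2) this] obtain z where z: "b < z" "z < a" "a powr q - b powr q = (a - b) * (q * z powr (q - 1))"
    by blast
  have "z powr (q - 1) * b \<le> a powr (q - 1) * a"
    using z ab assms by (intro mult_mono powr_mono2) auto
  also have "\<dots> = a powr q" using ab powr_add[of a "q - 1" 1] by simp
  finally have "(a - b) * q * (z powr (q - 1) * b) \<le> (a - b) * q * a powr q"
    using ab assms by (intro mult_left_mono) auto
  then show ?thesis unfolding z(3) by (simp add: mult_ac)
qed

text \<open>With |w| \<le> |z|, split the difference as |z|^q (z - w) + (|z|^q - |w|^q) w; the
  second part is \<open>powr_diff_le\<close>.\<close>

lemma power_nonlinearity_lipschitz:
  fixes z w :: complex
  assumes q: "1 \<le> q" and m: "cmod z \<le> m" "cmod w \<le> m"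
  shows "cmod (of_real (cmod z powr q) * z - of_real (cmod w powr q) * w) \<le> (1 + q) * m powr q * cmod (z - w)"
proof -
  have *: "cmod (of_real (cmod z powr q) * z - of_real (cmod w powr q) * w) \<le> (1 + q) * m powr q * cmod (z - w)"
    if zw: "cmod w \<le> cmod z" "cmod z \<le> m" for z w :: complex
  proof -
    let ?a = "cmod z" and ?b = "cmod w"
    have am: "?a powr q \<le> m powr q" using q zw by (intro powr_mono2) auto
    have ba: "?b powr q \<le> ?a powr q" using q zw by (intro powr_mono2) auto
    have "of_real (?a powr q) * z - of_real (?b powr q) * w
        = of_real (?a powr q) * (z - w) + of_real (?a powr q - ?b powr q) * w"
      by (simp add: algebra_simps)
    then have "cmod (of_real (?a powr q) * z - of_real (?b powr q) * w)
        \<le> cmod (of_real (?a powr q) * (z - w)) + cmod (of_real (?a powr q - ?b powr q) * w)"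
      by (metis norm_triangle_ineq)
    also have "\<dots> = ?a powr q * cmod (z - w) + (?a powr q - ?b powr q) * ?b"
      using ba by (simp only: norm_mult norm_of_real abs_of_nonneg powr_ge_zero diff_ge_0_iff_ge)
    also have "\<dots> \<le> ?a powr q * cmod (z - w) + q * ?a powr q * (?a - ?b)"
      using powr_diff_le[of ?b ?a q] zw q by simp
    also have "\<dots> \<le> ?a powr q * cmod (z - w) + q * ?a powr q * cmod (z - w)"
      using q norm_triangle_ineq2[of z w] by (intro add_left_mono mult_left_mono) auto
    also have "\<dots> = (1 + q) * cmod (z - w) * ?a powr q" by (simp add: algebra_simps)
    also have "\<dots> \<le> (1 + q) * cmod (z - w) * m powr q" using am q by (intro mult_left_mono) auto
    finally show ?thesis by (simp add: mult_ac)
  qed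
  show ?thesis
  proof (cases "cmod w \<le> cmod z")
    case True
    then show ?thesis using * m by blast
  next
    case False
    then show ?thesis using *[of z w] m by (simp add: norm_minus_commute)
  qed
qed

definition nl :: "real \<Rightarrow> l2 \<Rightarrow> l2" where
  "nl p f = Abs_l2 (\<lambda>n. of_real (cmod (seq f n) powr (p - 1)) * seq f n)"

lemma seq_nl:
  assumes "p \<ge> 1"
  shows "seq (nl p f) n = of_real (cmod (seq f n) powr (p - 1)) * seq f n"
proof -
  have "in_lq 2 (\<lambda>n. of_real (cmod (seq f n) powr (p - 1)) * seq f n)"
    unfolding in_l2_iff
  proof (rule summable_on_comparison_test)
    show "(\<lambda>n. (norm f powr (p - 1))\<^sup>2 * (cmod (seq f n))\<^sup>2) summable_on UNIV"
      using in_l2_seq[of f] unfolding in_l2_iff by (rule summable_on_cmult_right)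
    fix n
    have "cmod (seq f n) powr (p - 1) \<le> norm f powr (p - 1)"
      using assms seq_le_norm by (intro powr_mono2) auto
    then have "cmod (seq f n) powr (p - 1) * cmod (seq f n) \<le> norm f powr (p - 1) * cmod (seq f n)"
      by (intro mult_right_mono) auto
    then have "(cmod (seq f n) powr (p - 1) * cmod (seq f n))\<^sup>2 \<le> (norm f powr (p - 1) * cmod (seq f n))\<^sup>2"
      by (intro power_mono) auto
    then show "(cmod (of_real (cmod (seq f n) powr (p - 1)) * seq f n))\<^sup>2 \<le> (norm f powr (p - 1))\<^sup>2 * (cmod (seq f n))\<^sup>2"
      by (simp add: norm_mult power_mult_distrib)
  qed auto
  then show ?thesis by (simp add: nl_def Abs_l2_inverse)
qed

text \<open>As m \<le> 1, the exponent p - 1 \<ge> 6 can be lowered to 6, the power that Strichartz'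
  inequality sums in time.\<close>

lemma nl_lipschitz:
  assumes p: "p \<ge> 7" and m: "linf f \<le> m" "linf g \<le> m" "m \<le> 1"
  shows "norm (nl p f - nl p g) \<le> p * m ^ 6 * norm (f - g)"
proof (rule norm_l2_mono)
  have m0: "0 \<le> m" using m linf_nonneg[of f] by linarith
  fix n
  have "cmod (seq (nl p f - nl p g) n) \<le> (1 + (p - 1)) * m powr (p - 1) * cmod (seq f n - seq g n)"
    using p m linf_ge[of f n] linf_ge[of g n]
    by (simp only: minus_l2.rep_eq seq_nl) (intro power_nonlinearity_lipschitz; simp add: seq_nl)
  also have "\<dots> \<le> p * m ^ 6 * cmod (seq f n - seq g n)"
  proof -
    have "m powr (p - 1) \<le> m ^ 6"
    proof (cases "m = 0")
      case False
      then have "m powr (p - 1) \<le> m powr 6" using p m m0 by (intro powr_mono') auto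
      then show ?thesis using m0 by simp
    qed (use p in simp)
    then show ?thesis using p by (intro mult_right_mono) auto
  qed
  finally show "cmod (seq (nl p f - nl p g) n) \<le> p * m ^ 6 * cmod (seq (f - g) n)"
    by (simp add: minus_l2.rep_eq)
qed (use p in auto)

lemma linf_nl_le:
  assumes "p \<ge> 1" "linf f \<le> 1"
  shows "cmod (seq (nl p f) n) \<le> linf f"
proof -
  have "cmod (seq f n) \<le> 1" using assms linf_ge order_trans by blast
  then have "cmod (seq f n) powr (p - 1) \<le> 1" using assms by (intro powr_le1) auto
  then have "cmod (seq f n) powr (p - 1) * cmod (seq f n) \<le> 1 * cmod (seq f n)"
    by (intro mult_right_mono) auto
  then show ?thesis using assms linf_ge[of f n] by (simp add: seq_nl norm_mult)
qed

lemma inner_nl: "p \<ge> 1 \<Longrightarrow> Re c = 0 \<Longrightarrow> inner (scaleC c (nl p f)) f = 0"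
  unfolding inner_l2_def
  by (intro infsum_0) (simp add: scaleC.rep_eq seq_nl inner_complex_def algebra_simps)

text \<open>The 5/4 power of |f|^p is the power p/4 \<ge> 1 of |f|^5, so summability passes from
  l5.\<close>

lemma nl_l54:
  assumes p: "p \<ge> 4" and c: "cmod c = 1"
  shows "in_lq (5/4) (seq (scaleC c (nl p f)))"
    and "lq_norm (5/4) (seq (scaleC c (nl p f))) \<le> dual5 f powr p"
proof -
  have e: "cmod (seq (scaleC c (nl p f)) n) powr (5/4) = (cmod (seq f n) powr 5) powr (p / 4)" for n
  proof (cases "seq f n = 0")
    case False
    then have "cmod (seq (scaleC c (nl p f)) n) = cmod (seq f n) powr (p - 1) * cmod (seq f n) powr 1"
      using p c by (simp add: scaleC.rep_eq seq_nl norm_mult)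
    also have "\<dots> = cmod (seq f n) powr p" unfolding powr_add[symmetric] by simp
    finally show ?thesis by (simp only: powr_powr) (simp add: mult.commute)
  qed (use p in \<open>simp add: scaleC.rep_eq seq_nl\<close>)
  have p4: "p / 4 \<ge> 1" using p by simp
  note le = infsum_powr_le[OF _ in_l5_seq[of f, unfolded in_lq_def] p4]
  show "in_lq (5/4) (seq (scaleC c (nl p f)))"
    unfolding in_lq_def e by (rule le) simp
  have "lq_norm (5/4) (seq (scaleC c (nl p f))) \<le> ((\<Sum>\<^sub>\<infinity>n. cmod (seq f n) powr 5) powr (p / 4)) powr (1 / (5/4))"
    unfolding lq_norm_def e by (intro powr_mono2 le infsum_nonneg) auto
  also have "\<dots> = lq_norm 5 (seq f) powr p"
    by (simp only: lq_norm_def powr_powr) (simp add: mult.commute)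
  also have "\<dots> \<le> dual5 f powr p"
    using p lq5_le_dual5 by (intro powr_mono2) (auto simp: lq_norm_def)
  finally show "lq_norm (5/4) (seq (scaleC c (nl p f))) \<le> dual5 f powr p" .
qed

section \<open>Accumulation over unit time intervals, and perturbations of the identity\<close>

lemma chain_bound:
  fixes g :: "real \<Rightarrow> 'a::real_normed_vector" and \<beta> :: "nat \<Rightarrow> real"
  assumes g: "\<And>k s. s \<in> {real k..real (Suc k)} \<Longrightarrow> norm (g s - g (real k)) \<le> \<beta> k"
    and \<beta>: "summable \<beta>" and t: "0 \<le> t"
  shows "norm (g t - g 0) \<le> suminf \<beta>"
proof -
  have \<beta>0: "0 \<le> \<beta> k" for k
    using g[of "real k" k] by simp
  have n: "norm (g (real n) - g 0) \<le> (\<Sum>k<n. \<beta> k)" for n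
  proof (induction n)
    case (Suc n)
    have "norm (g (real (Suc n)) - g 0) \<le> norm (g (real (Suc n)) - g (real n)) + norm (g (real n) - g 0)"
      using norm_triangle_ineq[of "g (real (Suc n)) - g (real n)" "g (real n) - g 0"] by simp
    then show ?case using Suc g[of "real (Suc n)" n] by simp
  qed simp
  define k where "k = nat \<lfloor>t\<rfloor>"
  have k: "t \<in> {real k..real (Suc k)}" using t unfolding k_def atLeastAtMost_iff by linarith
  have "norm (g t - g 0) \<le> norm (g t - g (real k)) + norm (g (real k) - g 0)"
    using norm_triangle_ineq[of "g t - g (real k)" "g (real k) - g 0"] by simp
  also have "\<dots> \<le> (\<Sum>j<Suc k. \<beta> j)" using g[OF k] n[of k] by simp
  also have "\<dots> \<le> suminf \<beta>" by (intro sum_le_suminf \<beta> \<beta>0) auto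
  finally show ?thesis .
qed

text \<open>At s = k + 1 the hypothesis bounds the increments between integers, which are therefore
  summable; between integers g deviates by at most \<beta> k, which tends to 0.\<close>

lemma chain_convergent:
  fixes g :: "real \<Rightarrow> 'a::banach" and \<beta> :: "nat \<Rightarrow> real"
  assumes g: "\<And>k s. s \<in> {real k..real (Suc k)} \<Longrightarrow> norm (g s - g (real k)) \<le> \<beta> k"
    and \<beta>: "summable \<beta>"
  shows "\<exists>L. (g \<longlongrightarrow> L) at_top"
proof -
  have "summable (\<lambda>k. g (real (Suc k)) - g (real k))"
    by (rule summable_comparison_test'[OF \<beta>, of 0]) (use g in auto)
  then have "convergent (\<lambda>n. (\<Sum>k<n. g (real (Suc k)) - g (real k)))"
    by (simp add: summable_iff_convergent)
  moreover have "(\<Sum>k<n. g (real (Suc k)) - g (real k)) = g (real n) - g 0" for n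
    by (induction n) auto
  ultimately obtain L' where "(\<lambda>n. g (real n) - g 0) \<longlonglongrightarrow> L'" by (auto simp: convergent_def)
  then have L: "(\<lambda>n. g (real n)) \<longlonglongrightarrow> L' + g 0"
    using tendsto_add[OF _ tendsto_const, of "\<lambda>n. g (real n) - g 0" L' sequentially "g 0"] by simp
  have fl: "filterlim (\<lambda>t::real. nat \<lfloor>t\<rfloor>) sequentially at_top"
    by (intro filterlim_compose[OF filterlim_nat_sequentially filterlim_floor_sequentially])
  have "((\<lambda>t. norm (g t - g (real (nat \<lfloor>t\<rfloor>)))) \<longlongrightarrow> 0) at_top"
  proof (rule tendsto_sandwich[OF _ _ tendsto_const])
    show "\<forall>\<^sub>F t in at_top. norm (g t - g (real (nat \<lfloor>t\<rfloor>))) \<le> \<beta> (nat \<lfloor>t\<rfloor>)"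
      using eventually_ge_at_top[of 0]
    proof eventually_elim
      case (elim t)
      then have "t \<in> {real (nat \<lfloor>t\<rfloor>)..real (Suc (nat \<lfloor>t\<rfloor>))}" unfolding atLeastAtMost_iff by linarith
      then show ?case by (rule g)
    qed
    show "((\<lambda>t::real. \<beta> (nat \<lfloor>t\<rfloor>)) \<longlongrightarrow> 0) at_top"
      by (rule filterlim_compose[OF summable_LIMSEQ_zero[OF \<beta>] fl])
  qed simp
  then have "((\<lambda>t. g t - g (real (nat \<lfloor>t\<rfloor>))) \<longlongrightarrow> 0) at_top"
    by (rule tendsto_norm_zero_cancel)
  from tendsto_add[OF this filterlim_compose[OF L fl]]
  show ?thesis by auto
qed

text \<open>To solve \<Phi> f = w, iterate f \<mapsto> w - (\<Phi> f - f), a contraction with factor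
  1/3. For w in the half ball it maps the ball of radius \<delta> into itself, as 1/2 + 1/3 < 1;
  preservation of norms then returns the solution to the half ball. The same estimate gives
  Lipschitz constants 4/3 and 3/2.\<close>

lemma near_identity_homeomorphism:
  fixes \<Phi> :: "'a::banach \<Rightarrow> 'a"
  assumes \<delta>: "\<delta> > 0"
    and near: "\<And>f g. norm f \<le> \<delta> \<Longrightarrow> norm g \<le> \<delta> \<Longrightarrow> norm ((\<Phi> f - \<Phi> g) - (f - g)) \<le> 1/3 * norm (f - g)"
    and iso: "\<And>f. norm f \<le> \<delta> \<Longrightarrow> norm (\<Phi> f) = norm f"
  shows "\<exists>\<Psi>. homeomorphism (ball 0 (\<delta>/2)) (ball 0 (\<delta>/2)) \<Phi> \<Psi>"
proof -
  let ?B = "ball (0::'a) (\<delta>/2)"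
  have B: "norm f \<le> \<delta>" if "f \<in> ?B" for f using that \<delta> by simp
  have lower: "2/3 * norm (f - g) \<le> norm (\<Phi> f - \<Phi> g)" and upper: "norm (\<Phi> f - \<Phi> g) \<le> 4/3 * norm (f - g)"
    if "f \<in> ?B" "g \<in> ?B" for f g
  proof -
    have "norm (f - g) \<le> norm (\<Phi> f - \<Phi> g) + norm ((\<Phi> f - \<Phi> g) - (f - g))"
      using norm_triangle_ineq4[of "\<Phi> f - \<Phi> g" "(\<Phi> f - \<Phi> g) - (f - g)"] by simp
    then show "2/3 * norm (f - g) \<le> norm (\<Phi> f - \<Phi> g)" using near[OF B B, OF that] by linarith
    have "norm (\<Phi> f - \<Phi> g) \<le> norm ((\<Phi> f - \<Phi> g) - (f - g)) + norm (f - g)"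
      using norm_triangle_ineq[of "(\<Phi> f - \<Phi> g) - (f - g)" "f - g"] by simp
    then show "norm (\<Phi> f - \<Phi> g) \<le> 4/3 * norm (f - g)" using near[OF B B, OF that] by linarith
  qed
  have inj: "inj_on \<Phi> ?B"
  proof (rule inj_onI)
    fix f g assume "f \<in> ?B" "g \<in> ?B" "\<Phi> f = \<Phi> g"
    then show "f = g" using lower[of f g] by simp
  qed
  have surj: "\<exists>f\<in>?B. \<Phi> f = w" if w: "w \<in> ?B" for w
  proof -
    define T where "T f = w - (\<Phi> f - f)" for f
    have "\<exists>!f\<in>cball 0 \<delta>. T f = f"
    proof (rule Banach_fix[where c = "1/3"])
      show "T ` cball 0 \<delta> \<subseteq> cball 0 \<delta>"
      proof (rule image_subsetI)
        fix f :: 'a assume f: "f \<in> cball 0 \<delta>"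
        have "\<Phi> 0 = 0" using iso[of 0] \<delta> by simp
        then have "norm (\<Phi> f - f) \<le> 1/3 * norm f" using near[of f 0] f \<delta> by simp
        then have "norm (T f) \<le> \<delta>/2 + 1/3 * \<delta>"
          unfolding T_def using norm_triangle_ineq4[of w "\<Phi> f - f"] w f by simp
        then show "T f \<in> cball 0 \<delta>" using \<delta> by simp
      qed
      fix f g :: 'a assume "f \<in> cball 0 \<delta>" "g \<in> cball 0 \<delta>"
      then have "norm ((\<Phi> f - \<Phi> g) - (f - g)) \<le> 1/3 * norm (f - g)" by (intro near) auto
      moreover have "T f - T g = - ((\<Phi> f - \<Phi> g) - (f - g))" by (simp add: T_def)
      ultimately show "dist (T f) (T g) \<le> 1/3 * dist f g"
        unfolding dist_norm by (metis norm_minus_cancel)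
    qed (use \<delta> in \<open>auto simp: complete_eq_closed\<close>)
    then obtain f where f: "norm f \<le> \<delta>" "T f = f" by auto
    then have "\<Phi> f = w" by (simp add: T_def algebra_simps)
    moreover have "f \<in> ?B" using iso[OF f(1)] \<open>\<Phi> f = w\<close> w by simp
    ultimately show ?thesis by blast
  qed
  have img: "\<Phi> ` ?B = ?B"
  proof
    show "\<Phi> ` ?B \<subseteq> ?B" using iso[OF B] by auto
    show "?B \<subseteq> \<Phi> ` ?B" using surj by blast
  qed
  define \<Psi> where "\<Psi> = inv_into ?B \<Phi>"
  have \<Psi>: "\<Psi> w \<in> ?B" "\<Phi> (\<Psi> w) = w" if "w \<in> ?B" for w
    using that img inv_into_into[of w \<Phi> ?B] f_inv_into_f[of w \<Phi> ?B] by (auto simp: \<Psi>_def)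
  have c\<Phi>: "continuous_on ?B \<Phi>"
    by (rule lipschitz_on_continuous_on[of "4/3"], rule lipschitz_onI, unfold dist_norm, erule (1) upper) simp
  have c\<Psi>: "continuous_on ?B \<Psi>"
  proof (rule lipschitz_on_continuous_on[of "3/2"], rule lipschitz_onI)
    fix v w assume "v \<in> ?B" "w \<in> ?B"
    then show "dist (\<Psi> v) (\<Psi> w) \<le> 3/2 * dist v w"
      using lower[of "\<Psi> v" "\<Psi> w"] \<Psi> by (simp add: dist_norm)
  qed simp
  have \<Psi>\<Phi>: "\<Psi> (\<Phi> f) = f" if "f \<in> ?B" for f
    unfolding \<Psi>_def by (rule inv_into_f_f[OF inj that])
  have "\<Psi> ` ?B = ?B" using \<Psi>(1) \<Psi>\<Phi> img by (metis (no_types, lifting) image_subset_iff subsetI subset_antisym image_eqI)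
  then have "homeomorphism ?B ?B \<Phi> \<Psi>"
    unfolding homeomorphism_def using c\<Phi> c\<Psi> img \<Psi>(2) \<Psi>\<Phi> by auto
  then show ?thesis by blast
qed

text \<open>The constant of \<open>linf_growth\<close>: exp 12 is its exponential weight at the end
  of a unit interval, and 2 comes from absorbing half of the supremum.\<close>

definition growth :: real where "growth = 2 * exp 12"

section \<open>Profiles of small solutions\<close>

context dispersive_kernel
begin

definition solution :: "real \<Rightarrow> real \<Rightarrow> (real \<Rightarrow> l2) \<Rightarrow> bool" where
  "solution \<mu> p u \<longleftrightarrow>
    (\<forall>t. (u has_vector_derivative gen K (u t) + scaleC (- \<i> * of_real \<mu>) (nl p (u t))) (at t))"

definition profile :: "(real \<Rightarrow> l2) \<Rightarrow> real \<Rightarrow> l2" where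
  "profile u t = flow (gen K) (- t) (u t)"

lemma norm_profile: "norm (profile u t) = norm (u t)"
  by (simp add: profile_def norm_flow)

lemma profile_diff: "profile (\<lambda>t. u t - v t) t = profile u t - profile v t"
  by (simp add: profile_def flow_diff)

text \<open>Testing with y, the increment itself, turns its squared norm into the increment of a
  scalar function, to which the mean value inequality applies.\<close>

lemma profile_drift:
  assumes r: "\<And>t. (r has_vector_derivative gen K (r t) + n t) (at t)"
    and n: "\<And>s. s \<in> {a..b} \<Longrightarrow> norm (n s) \<le> c" and ab: "a \<le> b" "b \<le> a + 1"
  shows "norm (profile r b - profile r a) \<le> c"
proof (cases "a = b")
  case True
  have "norm (n a) \<le> c" using n ab by simp
  from order_trans[OF norm_ge_zero this] show ?thesis using True by simp
next
  case False
  then have ab': "a < b" using ab by simp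
  define y where "y = profile r b - profile r a"
  define \<phi> where "\<phi> s = inner (r s) (flow (gen K) s y)" for s
  have d: "(\<phi> has_real_derivative inner (n s) (flow (gen K) s y)) (at s)" for s
    using weak_duhamel[where t = s and c = 0 and y = y, OF r] by (simp add: \<phi>_def[abs_def])
  have "\<phi> s = inner (profile r s) y" for s
    by (simp add: \<phi>_def profile_def flow_adjoint)
  then have "\<phi> b - \<phi> a = inner y y" by (simp add: y_def inner_diff_left)
  then have "(norm y)\<^sup>2 = \<phi> b - \<phi> a" by (simp add: power2_norm_eq_inner)
  also have "\<dots> \<le> norm (\<phi> b - \<phi> a)" by simp
  also have "\<dots> \<le> (c * norm y) * b - (c * norm y) * a"
  proof (rule differentiable_bound_general[OF ab' continuous_on_if_derivative[OF d]])
    fix s assume s: "a < s" "s < b"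
    show "(\<phi> has_vector_derivative inner (n s) (flow (gen K) s y)) (at s)"
      using d has_real_derivative_iff_has_vector_derivative by blast
    show "((\<lambda>s. c * norm y * s) has_vector_derivative c * norm y) (at s)"
      by (auto intro!: derivative_eq_intros)
    have "norm (inner (n s) (flow (gen K) s y)) \<le> norm (n s) * norm (flow (gen K) s y)"
      using Cauchy_Schwarz_ineq2 by simp
    also have "\<dots> \<le> c * norm y" using n[of s] s by (simp add: norm_flow mult_right_mono)
    finally show "norm (inner (n s) (flow (gen K) s y)) \<le> c * norm y" .
  qed (intro continuous_intros)
  also have "\<dots> = (c * norm y) * (b - a)" by (simp add: algebra_simps)
  also have "\<dots> \<le> (c * norm y) * 1"
    using ab order_trans[OF norm_ge_zero n, of a] by (intro mult_left_mono) auto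
  finally have "norm y * norm y \<le> c * norm y" by (simp add: power2_eq_square)
  moreover have "0 \<le> c" using order_trans[OF norm_ge_zero n, of a] ab by simp
  ultimately show ?thesis unfolding y_def[symmetric] by (cases "norm y = 0") auto
qed

lemma solution_norm:
  assumes u: "solution \<mu> p u" and p: "p \<ge> 1"
  shows "norm (u t) = norm (u 0)"
proof -
  have "((\<lambda>t. inner (u t) (u t)) has_real_derivative 0) (at t)" for t
  proof -
    have d: "(u has_vector_derivative gen K (u t) + scaleC (- \<i> * of_real \<mu>) (nl p (u t))) (at t)"
      using u by (simp add: solution_def)
    have "inner (gen K (u t) + scaleC (- \<i> * of_real \<mu>) (nl p (u t))) (u t) = 0"
      unfolding inner_add_left inner_B_self using p by (subst inner_nl) auto
    then show ?thesis using has_vector_derivative_inner[OF d d] by (simp add: inner_commute)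
  qed
  then have "inner (u t) (u t) = inner (u 0) (u 0)"
    by (intro DERIV_isconst_all allI)
  then show ?thesis by (simp add: norm_eq_sqrt_inner)
qed

text \<open>The exponential weight turns the Gronwall argument into a comparison of suprema.\<close>

lemma linf_growth:
  assumes u: "solution \<mu> p u" and \<mu>: "\<bar>\<mu>\<bar> = 1" and p: "p \<ge> 1" and small: "norm (u 0) \<le> 1"
    and s: "s \<in> {a..a + 1}"
  shows "linf (u s) \<le> growth * linf (u a)"
proof -
  have un: "linf (u s) \<le> 1" for s
    using linf_le_norm[of "u s"] solution_norm[OF u p, of s] small by simp
  define I where "I = {a..a + 1}"
  \<comment> \<open>A coordinate has derivative at most 5 + 1 = 6 times the sup norm. The rate 12 is
    twice that, so integrating 6 M exp (12 (s - a)) yields only half of M times the weight.\<close>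
  define h where "h s = exp (- 12 * (s - a)) * linf (u s)" for s
  have h1: "h s \<le> 1" if "s \<in> I" for s
    using mult_mono[of "exp (- 12 * (s - a))" 1 "linf (u s)" 1] that un linf_nonneg by (simp add: h_def I_def)
  have bdd: "bdd_above (h ` I)" using h1 by (intro bdd_aboveI2)
  define M where "M = (SUP s\<in>I. h s)"
  have hM: "h s \<le> M" if "s \<in> I" for s unfolding M_def by (rule cSUP_upper[OF that bdd])
  have lM: "linf (u s) \<le> M * exp (12 * (s - a))" if "s \<in> I" for s
  proof -
    have "exp (- 12 * (s - a)) * exp (12 * (s - a)) = 1" by (simp flip: exp_add)
    moreover have "h s * exp (12 * (s - a)) = (exp (- 12 * (s - a)) * exp (12 * (s - a))) * linf (u s)"
      unfolding h_def by (simp only: mult_ac)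
    ultimately have "linf (u s) = h s * exp (12 * (s - a))" by simp
    then show ?thesis using hM[OF that] by simp
  qed
  have "h t \<le> linf (u a) + M / 2" if t: "t \<in> I" for t
  proof -
    have M0: "M \<ge> 0" using hM[of t] t linf_nonneg[of "u t"] by (simp add: h_def) (meson exp_ge_zero mult_nonneg_nonneg order_trans)
    have "cmod (seq (u t) n) \<le> linf (u a) + M / 2 * exp (12 * (t - a))" for n
    proof (cases "a = t")
      case True
      then show ?thesis using linf_ge[of "u a" n] M0 by (simp add: add_increasing2)
    next
      case False
      then have at: "a < t" using t by (simp add: I_def)
      define u' where "u' s = gen K (u s) + scaleC (- \<i> * of_real \<mu>) (nl p (u s))" for s
      have d: "((\<lambda>s. seq (u s) n) has_vector_derivative seq (u' s) n) (at s)" for s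
        using u by (intro bounded_linear.has_vector_derivative[OF bounded_linear_seq]) (simp add: solution_def u'_def)
      have "norm (seq (u t) n - seq (u a) n) \<le> M / 2 * exp (12 * (t - a)) - M / 2 * exp (12 * (a - a))"
      proof (rule differentiable_bound_general[OF at])
        show "continuous_on {a..t} (\<lambda>s. seq (u s) n)"
          by (intro continuous_at_imp_continuous_on ballI has_vector_derivative_continuous[OF d])
        show "continuous_on {a..t} (\<lambda>s. M / 2 * exp (12 * (s - a)))" by (intro continuous_intros)
        fix s assume s: "a < s" "s < t"
        show "((\<lambda>s. seq (u s) n) has_vector_derivative seq (u' s) n) (at s)" by (rule d)
        show "((\<lambda>s. M / 2 * exp (12 * (s - a))) has_vector_derivative 6 * (M * exp (12 * (s - a)))) (at s)"
          unfolding has_real_derivative_iff_has_vector_derivative[symmetric]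
          by (auto intro!: derivative_eq_intros)
        have "cmod (seq (u' s) n) \<le> cmod (seq (lapk K (u s)) n) + cmod (seq (nl p (u s)) n)"
          unfolding u'_def gen_def plus_l2.rep_eq scaleC.rep_eq
          using \<mu> by (intro order_trans[OF norm_triangle_ineq]) (simp add: norm_mult)
        also have "\<dots> \<le> 5 * linf (u s) + linf (u s)"
          by (intro add_mono lapk_sup linf_ge linf_nl_le p un)
        also have "\<dots> \<le> 6 * (M * exp (12 * (s - a)))"
          using lM[of s] s t by (simp add: I_def)
        finally show "norm (seq (u' s) n) \<le> 6 * (M * exp (12 * (s - a)))" .
      qed
      then have "norm (seq (u t) n - seq (u a) n) \<le> M / 2 * exp (12 * (t - a))" using M0 by simp
      moreover have "cmod (seq (u t) n) \<le> cmod (seq (u t) n - seq (u a) n) + cmod (seq (u a) n)"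
        using norm_triangle_ineq[of "seq (u t) n - seq (u a) n" "seq (u a) n"] by simp
      ultimately show ?thesis using linf_ge[of "u a" n] by linarith
    qed
    then have "linf (u t) \<le> linf (u a) + M / 2 * exp (12 * (t - a))" by (rule linf_le)
    then have "h t \<le> exp (- 12 * (t - a)) * (linf (u a) + M / 2 * exp (12 * (t - a)))"
      unfolding h_def by (intro mult_left_mono) auto
    also have "\<dots> = exp (- 12 * (t - a)) * linf (u a) + M / 2"
    proof -
      have "exp (- 12 * (t - a)) * exp (12 * (t - a)) = 1" by (simp flip: exp_add)
      then have "exp (- 12 * (t - a)) * (M / 2 * exp (12 * (t - a))) = M / 2"
        by (metis mult.left_commute mult.right_neutral)
      then show ?thesis by (simp add: distrib_left)
    qed
    also have "\<dots> \<le> 1 * linf (u a) + M / 2"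
      using t linf_nonneg by (intro add_right_mono mult_right_mono) (auto simp: I_def)
    finally show ?thesis by simp
  qed
  then have "M \<le> linf (u a) + M / 2"
    unfolding M_def by (intro cSUP_least) (auto simp: I_def)
  then have M2: "M \<le> 2 * linf (u a)" by simp
  have "linf (u s) \<le> M * exp (12 * (s - a))" using lM s by (simp add: I_def)
  also have "\<dots> \<le> (2 * linf (u a)) * exp 12"
    using M2 s linf_nonneg by (intro mult_mono) auto
  finally show ?thesis by (simp add: growth_def mult_ac)
qed

text \<open>Taking one of two solutions to be 0 makes the estimates for differences cover a single
  solution.\<close>

lemma solution_zero: "p \<ge> 1 \<Longrightarrow> solution \<mu> p (\<lambda>_. 0)"
proof -
  assume p: "p \<ge> 1"
  have "nl p 0 = 0" by (intro l2_eqI) (simp add: seq_nl p zero_l2.rep_eq)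
  moreover have "gen K 0 = 0" "scaleC c 0 = 0" for c
    using linear_0 bounded_linear.linear[OF bounded_linear_gen] bounded_linear.linear[OF bounded_linear_scaleC] by auto
  ultimately show ?thesis by (simp add: solution_def)
qed

text \<open>Within the interval \<open>linf_growth\<close> reduces the sup norms to their values at
  time k, so the coefficients of S are the sixth powers that Strichartz' inequality sums.\<close>

lemma difference_drift:
  assumes u: "solution \<mu> p u" and v: "solution \<mu> p v" and \<mu>: "\<bar>\<mu>\<bar> = 1" and p: "p \<ge> 7"
    and small: "norm (u 0) \<le> 1" "norm (v 0) \<le> 1"
    and S: "\<And>s. 0 \<le> s \<Longrightarrow> norm (u s - v s) \<le> S" and s: "s \<in> {real k..real (Suc k)}"
  shows "norm (profile (\<lambda>t. u t - v t) s - profile (\<lambda>t. u t - v t) (real k))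
    \<le> p * growth ^ 6 * (linf (u (real k)) ^ 6 + linf (v (real k)) ^ 6) * S"
proof (rule profile_drift[where n = "\<lambda>t. scaleC (- \<i> * of_real \<mu>) (nl p (u t) - nl p (v t))"])
  interpret G: bounded_linear "gen K" by (rule bounded_linear_gen)
  interpret C: bounded_linear "scaleC c" for c by (rule bounded_linear_scaleC)
  show "((\<lambda>t. u t - v t) has_vector_derivative gen K (u t - v t)
      + scaleC (- \<i> * of_real \<mu>) (nl p (u t) - nl p (v t))) (at t)" for t
    using has_vector_derivative_diff[of u _ "at t" v] u v
    by (simp add: solution_def G.diff C.diff algebra_simps)
  show "real k \<le> s" "s \<le> real k + 1" using s by auto
  fix t assume t: "t \<in> {real k..s}"
  then have t': "t \<in> {real k..real k + 1}" using s by auto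
  define m where "m = max (linf (u t)) (linf (v t))"
  have m0: "0 \<le> m" using linf_nonneg[of "u t"] by (simp add: m_def le_max_iff_disj)
  have le1: "linf (x t) \<le> 1" if "solution \<mu> p x" "norm (x 0) \<le> 1" for x
    using linf_le_norm[of "x t"] solution_norm[OF that(1), of t] p that(2) by simp
  have gr: "linf (x t) ^ 6 \<le> growth ^ 6 * linf (x (real k)) ^ 6" if "solution \<mu> p x" "norm (x 0) \<le> 1" for x
    using power_mono[OF linf_growth[OF that(1) \<mu> _ that(2) t'] linf_nonneg, of 6] p
    by (simp add: power_mult_distrib)
  have m1: "m \<le> 1" using le1 u v small by (simp add: m_def)
  have m6: "m ^ 6 \<le> growth ^ 6 * (linf (u (real k)) ^ 6 + linf (v (real k)) ^ 6)"
  proof -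
    have "m ^ 6 \<le> linf (u t) ^ 6 + linf (v t) ^ 6"
      using linf_nonneg by (auto simp: m_def max_def)
    then show ?thesis using gr[OF u small(1)] gr[OF v small(2)] by (simp add: algebra_simps)
  qed
  have "norm (scaleC (- \<i> * of_real \<mu>) (nl p (u t) - nl p (v t))) = norm (nl p (u t) - nl p (v t))"
    using \<mu> by (simp add: norm_scaleC norm_mult)
  also have "\<dots> \<le> p * m ^ 6 * norm (u t - v t)"
    by (rule nl_lipschitz[OF p _ _ m1]) (auto simp: m_def)
  also have "\<dots> \<le> p * (growth ^ 6 * (linf (u (real k)) ^ 6 + linf (v (real k)) ^ 6)) * S"
    using p m6 m0 S[of t] t by (intro mult_mono mult_left_mono) (auto intro!: mult_nonneg_nonneg simp: growth_def linf_nonneg)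
  finally show "norm (scaleC (- \<i> * of_real \<mu>) (nl p (u t) - nl p (v t)))
      \<le> p * growth ^ 6 * (linf (u (real k)) ^ 6 + linf (v (real k)) ^ 6) * S"
    by (simp add: mult.assoc)
qed

text \<open>The last condition gives each solution a total weight of at most 1/8 in
  \<open>difference_drift\<close>, hence 1/4 for a pair.\<close>

definition threshold :: "real \<Rightarrow> real \<Rightarrow> bool" where
  "threshold p \<delta> \<longleftrightarrow> 0 < \<delta> \<and> \<delta> \<le> 1 \<and> p * growth ^ 6 * (16 * sqrt D * \<delta>) ^ 6 \<le> 1/8"

text \<open>Strichartz' inequality at N + 1 times involves only N increments of the profile, and
  these are controlled by the first N sup norms; so induction on N closes. Small increments give
  initial value plus variation at most twice \<open>norm (u 0)\<close>, and 16 = 8 * 2.\<close>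

lemma a_priori_bound:
  assumes u: "solution \<mu> p u" and \<mu>: "\<bar>\<mu>\<bar> = 1" and p: "p \<ge> 7"
    and \<delta>: "threshold p \<delta>" "norm (u 0) \<le> \<delta>"
  shows "(\<Sum>k<N. linf (u (real k)) ^ 6) \<le> (16 * sqrt D * norm (u 0)) ^ 6"
proof (induction N)
  case 0
  then show ?case using D by simp
next
  case (Suc N)
  define F where "F k = profile u (real k)" for k
  have u1: "norm (u 0) \<le> 1" using \<delta> by (simp add: threshold_def)
  have "norm (F (Suc k) - F k) \<le> p * growth ^ 6 * linf (u (real k)) ^ 6 * norm (u 0)" for k
  proof -
    have z: "linf 0 = 0" by (simp add: linf_def zero_l2.rep_eq)
    have "norm (profile (\<lambda>t. u t - 0) (real (Suc k)) - profile (\<lambda>t. u t - 0) (real k))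
      \<le> p * growth ^ 6 * (linf (u (real k)) ^ 6 + linf 0 ^ 6) * norm (u 0)"
    proof (rule difference_drift[OF u solution_zero \<mu> p u1])
      show "norm (u s - 0) \<le> norm (u 0)" for s using solution_norm[OF u, of s] p by simp
    qed (use p in auto)
    then show ?thesis by (simp add: F_def z)
  qed
  then have "(\<Sum>k<N. norm (F (Suc k) - F k)) \<le> (\<Sum>k<N. p * growth ^ 6 * linf (u (real k)) ^ 6 * norm (u 0))"
    by (intro sum_mono)
  also have "\<dots> = p * growth ^ 6 * norm (u 0) * (\<Sum>k<N. linf (u (real k)) ^ 6)"
    by (simp add: sum_distrib_left mult_ac)
  also have "\<dots> \<le> p * growth ^ 6 * norm (u 0) * (16 * sqrt D * \<delta>) ^ 6"
    using p D \<delta>(2) by (intro mult_left_mono order_trans[OF Suc] power_mono mult_nonneg_nonneg) (auto simp: growth_def)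
  also have "\<dots> = norm (u 0) * (p * growth ^ 6 * (16 * sqrt D * \<delta>) ^ 6)" by simp
  also have "\<dots> \<le> norm (u 0) * 1"
    using \<delta>(1) by (intro mult_left_mono) (auto simp: threshold_def)
  finally have V: "norm (F 0) + (\<Sum>k<N. norm (F (Suc k) - F k)) \<le> 2 * norm (u 0)"
    by (simp add: F_def norm_profile)
  have "(\<Sum>k<Suc N. linf (flow (gen K) (real k) (F k)) ^ 6)
    \<le> (8 * sqrt D * (norm (F 0) + (\<Sum>k<Suc N - 1. norm (F (Suc k) - F k)))) ^ 6"
    by (rule Strichartz)
  also have "\<dots> \<le> (8 * sqrt D * (2 * norm (u 0))) ^ 6"
    using V D by (intro power_mono mult_left_mono mult_nonneg_nonneg add_nonneg_nonneg sum_nonneg) auto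
  also have "8 * sqrt D * (2 * norm (u 0)) = 16 * sqrt D * norm (u 0)" by simp
  finally show ?case by (simp add: F_def profile_def del: sum.lessThan_Suc)
qed

lemma difference_weights:
  assumes u: "solution \<mu> p u" and v: "solution \<mu> p v" and \<mu>: "\<bar>\<mu>\<bar> = 1" and p: "p \<ge> 7"
    and \<delta>: "threshold p \<delta>" "norm (u 0) \<le> \<delta>" "norm (v 0) \<le> \<delta>"
  defines "\<beta> \<equiv> \<lambda>k. p * growth ^ 6 * (linf (u (real k)) ^ 6 + linf (v (real k)) ^ 6)"
  shows "summable \<beta>" "suminf \<beta> \<le> 1/4"
proof -
  have one: "p * growth ^ 6 * (\<Sum>k<N. linf (x (real k)) ^ 6) \<le> 1/8"
    if x: "solution \<mu> p x" "norm (x 0) \<le> \<delta>" for x N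
  proof -
    have "(\<Sum>k<N. linf (x (real k)) ^ 6) \<le> (16 * sqrt D * norm (x 0)) ^ 6"
      by (rule a_priori_bound[OF x(1) \<mu> p \<delta>(1) x(2)])
    also have "\<dots> \<le> (16 * sqrt D * \<delta>) ^ 6"
      using D x by (intro power_mono mult_left_mono) auto
    finally have "p * growth ^ 6 * (\<Sum>k<N. linf (x (real k)) ^ 6) \<le> p * growth ^ 6 * (16 * sqrt D * \<delta>) ^ 6"
      using p by (intro mult_left_mono) (auto simp: growth_def)
    then show ?thesis using \<delta>(1) by (simp add: threshold_def)
  qed
  have "(\<Sum>k<N. \<beta> k) = p * growth ^ 6 * (\<Sum>k<N. linf (u (real k)) ^ 6) + p * growth ^ 6 * (\<Sum>k<N. linf (v (real k)) ^ 6)" for N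
    by (simp add: \<beta>_def sum_distrib_left sum.distrib algebra_simps)
  then have sum: "(\<Sum>k<N. \<beta> k) \<le> 1/4" for N
    using one[OF u \<delta>(2), of N] one[OF v \<delta>(3), of N] by simp
  have \<beta>0: "0 \<le> \<beta> k" for k
    using p linf_nonneg by (auto simp: \<beta>_def growth_def)
  show sm: "summable \<beta>" by (rule summableI_nonneg_bounded[OF \<beta>0 sum])
  show "suminf \<beta> \<le> 1/4" by (rule suminf_le_const[OF sm sum])
qed

lemma profile_convergent:
  assumes u: "solution \<mu> p u" and \<mu>: "\<bar>\<mu>\<bar> = 1" and p: "p \<ge> 7"
    and \<delta>: "threshold p \<delta>" "norm (u 0) \<le> \<delta>"
  shows "\<exists>w. (profile u \<longlongrightarrow> w) at_top"
proof -
  have z: "solution \<mu> p (\<lambda>_. 0)" using p by (intro solution_zero) auto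
  have \<delta>1: "0 < \<delta>" "\<delta> \<le> 1" using \<delta> by (auto simp: threshold_def)
  define \<beta> where "\<beta> k = p * growth ^ 6 * (linf (u (real k)) ^ 6 + linf 0 ^ 6)" for k
  have sm: "summable \<beta>"
    using difference_weights(1)[OF u z \<mu> p \<delta>] \<delta>1 by (simp add: \<beta>_def[abs_def])
  show ?thesis
  proof (rule chain_convergent[OF _ summable_mult2[OF sm, of "norm (u 0)"]])
    fix k s assume s: "s \<in> {real k..real (Suc k)}"
    have "norm (profile (\<lambda>t. u t - 0) s - profile (\<lambda>t. u t - 0) (real k)) \<le> \<beta> k * norm (u 0)"
      unfolding \<beta>_def
    proof (rule difference_drift[OF u z \<mu> p _ _ _ s])
      show "norm (u s - 0) \<le> norm (u 0)" for s using solution_norm[OF u, of s] p by simp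
    qed (use \<delta> \<delta>1 in auto)
    then show "norm (profile u s - profile u (real k)) \<le> \<beta> k * norm (u 0)" by simp
  qed
qed

text \<open>Let S be the supremum over s \<ge> 0 of the distance of the solutions, finite as norms
  are conserved. The profile of the difference drifts by at most S/4, so S is at most the initial
  distance plus S/4; hence S is at most 4/3 of that distance and the drift at most 1/3 of
  it.\<close>

lemma profile_near_identity:
  assumes u: "solution \<mu> p u" and v: "solution \<mu> p v" and \<mu>: "\<bar>\<mu>\<bar> = 1" and p: "p \<ge> 7"
    and \<delta>: "threshold p \<delta>" "norm (u 0) \<le> \<delta>" "norm (v 0) \<le> \<delta>" and t: "0 \<le> t"
  shows "norm ((profile u t - profile v t) - (u 0 - v 0)) \<le> 1/3 * norm (u 0 - v 0)"
proof -
  let ?r = "\<lambda>t. u t - v t"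
  have \<delta>1: "0 < \<delta>" "\<delta> \<le> 1" using \<delta> by (auto simp: threshold_def)
  define \<beta> where "\<beta> k = p * growth ^ 6 * (linf (u (real k)) ^ 6 + linf (v (real k)) ^ 6)" for k
  have \<beta>: "summable \<beta>" "suminf \<beta> \<le> 1/4"
    using difference_weights[OF u v \<mu> p \<delta>] by (simp_all add: \<beta>_def[abs_def])
  have bdd: "bdd_above ((\<lambda>s. norm (?r s)) ` {0..})"
  proof (rule bdd_aboveI2)
    fix s
    show "norm (?r s) \<le> 2 * \<delta>"
      using norm_triangle_ineq4[of "u s" "v s"] solution_norm[OF u, of s] solution_norm[OF v, of s] p \<delta> by simp
  qed
  define S where "S = (SUP s\<in>{0..}. norm (?r s))"
  have S: "norm (?r s) \<le> S" if "0 \<le> s" for s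
    unfolding S_def using that by (intro cSUP_upper[OF _ bdd]) auto
  have S0: "S \<ge> 0" using S[of 0] norm_ge_zero[of "?r 0"] by linarith
  have drift: "norm (profile ?r s - profile ?r 0) \<le> 1/4 * S" if "0 \<le> s" for s
  proof -
    have "norm (profile ?r s - profile ?r 0) \<le> (\<Sum>k. \<beta> k * S)"
    proof (rule chain_bound[OF _ summable_mult2[OF \<beta>(1)] that])
      fix k s assume s: "s \<in> {real k..real (Suc k)}"
      show "norm (profile ?r s - profile ?r (real k)) \<le> \<beta> k * S"
        unfolding \<beta>_def using \<delta> \<delta>1
        by (intro difference_drift[OF u v \<mu> p _ _ S s]) auto
    qed
    also have "\<dots> = suminf \<beta> * S" by (rule suminf_mult2[symmetric, OF \<beta>(1)])
    also have "\<dots> \<le> 1/4 * S" using \<beta>(2) S0 by (rule mult_right_mono)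
    finally show ?thesis .
  qed
  have p0: "profile ?r 0 = u 0 - v 0" by (simp add: profile_def flow_0)
  have "norm (?r s) \<le> norm (u 0 - v 0) + 1/4 * S" if "0 \<le> s" for s
  proof -
    have "norm (?r s) = norm (profile ?r s)" by (rule norm_profile[symmetric])
    also have "\<dots> \<le> norm (profile ?r s - profile ?r 0) + norm (profile ?r 0)"
      using norm_triangle_ineq[of "profile ?r s - profile ?r 0" "profile ?r 0"] by simp
    finally show ?thesis using drift[OF that] unfolding p0 by linarith
  qed
  then have "S \<le> norm (u 0 - v 0) + 1/4 * S"
    unfolding S_def by (intro cSUP_least) auto
  moreover have "norm (profile ?r t - (u 0 - v 0)) \<le> 1/4 * S" using drift[OF t] unfolding p0 .
  ultimately show ?thesis unfolding profile_diff by linarith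
qed

end

section \<open>Decoupling of the linear flows\<close>

lemma l2_approx:
  assumes "e > 0"
  shows "\<exists>F. finite F \<and> norm (x - comb (seq x) F) < e"
proof -
  have "((\<lambda>n. (cmod (seq x n))\<^sup>2) has_sum (norm x)\<^sup>2) UNIV"
    unfolding norm_l2_sq using in_l2_seq[of x] by (simp add: in_l2_iff)
  then have "\<forall>\<^sub>F F in finite_subsets_at_top UNIV. dist (\<Sum>n\<in>F. (cmod (seq x n))\<^sup>2) ((norm x)\<^sup>2) < e\<^sup>2"
    unfolding has_sum_def using assms by (intro tendstoD) auto
  then obtain F where F: "finite F" "dist (\<Sum>n\<in>F. (cmod (seq x n))\<^sup>2) ((norm x)\<^sup>2) < e\<^sup>2"
    by (auto simp: eventually_finite_subsets_at_top)
  have "inner x (comb (seq x) F) = (\<Sum>n\<in>F. (cmod (seq x n))\<^sup>2)"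
    unfolding inner_comb by (simp only: complex_norm_square[symmetric] Re_complex_of_real)
  then have "(norm (x - comb (seq x) F))\<^sup>2 = (norm x)\<^sup>2 - (\<Sum>n\<in>F. (cmod (seq x n))\<^sup>2)"
    using norm_comb[OF F(1), of "seq x"] dot_norm_neg[of x "comb (seq x) F"] by simp
  also have "\<dots> < e\<^sup>2" using F(2) by (simp add: dist_real_def abs_less_iff)
  finally have "norm (x - comb (seq x) F) < e" using assms by (simp add: power2_less_imp_less)
  then show ?thesis using F(1) by blast
qed

text \<open>\<open>inner_flow_two_kernels\<close> reduces this to the flow of the difference kernel,
  whose matrix elements decay. Isometry and approximation by finite combinations extend the
  convergence to all of l2, without a rate.\<close>

lemma linear_flows_decouple:
  assumes a: "a > 11"
  shows "((\<lambda>t. inner (flow (gen (ker (ereal a))) t x) (flow (gen (ker \<infinity>)) t y)) \<longlongrightarrow> 0) at_top"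
proof -
  define Dk where "Dk j = ker (ereal a) j - ker \<infinity> j" for j
  have dk: "decaying_kernel Dk (2 powr - (1 + a)) 2"
    using decaying_kernel_ker_diff[OF a] by (simp add: Dk_def[abs_def])
  interpret decaying_kernel Dk "2 powr - (1 + a)" 2 by (rule dk)
  have "(2::real) powr - (1 + a) > 0" by simp
  from dispersive_decay[OF this] obtain C where
    C: "\<And>K m a' b t. decaying_kernel K (2 powr - (1 + a)) m \<Longrightarrow> 1 \<le> \<bar>t\<bar> \<Longrightarrow>
      cmod (seq (flow (gen K) t (delta a')) b) \<le> C * \<bar>t\<bar> powr (-1/3)"
    by blast
  have delta: "((\<lambda>t. seq (flow (gen Dk) t (delta i)) j) \<longlongrightarrow> 0) at_top" for i j
  proof (rule Lim_null_comparison)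
    show "\<forall>\<^sub>F t in at_top. norm (seq (flow (gen Dk) t (delta i)) j) \<le> C * t powr (-1/3)"
      using eventually_ge_at_top[of 1]
    proof eventually_elim
      case (elim t)
      then show ?case using C[OF dk, of t i j] by simp
    qed
    show "((\<lambda>t. C * t powr (-1/3)) \<longlongrightarrow> 0) at_top" by real_asymp
  qed
  have comb: "((\<lambda>t. inner (flow (gen Dk) t (comb v F)) (comb w G)) \<longlongrightarrow> 0) at_top" for v F w G
  proof -
    have "inner (flow (gen Dk) t (comb v F)) (comb w G)
        = (\<Sum>j\<in>G. Re ((\<Sum>i\<in>F. v i * seq (flow (gen Dk) t (delta i)) j) * cnj (w j)))" for t
      unfolding inner_comb by (simp add: comb_def flow_sum flow_scaleC seq_sum scaleC.rep_eq)
    moreover have "((\<lambda>t. \<Sum>j\<in>G. Re ((\<Sum>i\<in>F. v i * seq (flow (gen Dk) t (delta i)) j) * cnj (w j)))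
        \<longlongrightarrow> (\<Sum>j\<in>G. Re ((\<Sum>i\<in>F. v i * 0) * cnj (w j)))) at_top"
      by (intro tendsto_intros delta)
    ultimately show ?thesis by simp
  qed
  have "((\<lambda>t. inner (flow (gen Dk) t x) y) \<longlongrightarrow> 0) at_top"
  proof (rule tendstoI)
    fix e :: real assume e: "e > 0"
    \<comment> \<open>The truncation of y comes first; the accuracy demanded for x depends on the
      norm of the truncated vector.\<close>
    define d where "d = e / (3 * (norm x + norm y + 1))"
    have pos: "norm x + norm y + 1 > 0" using norm_ge_zero[of x] norm_ge_zero[of y] by linarith
    have d: "d > 0" "d * norm y \<le> e / 3" "d * (norm x) \<le> e / 3"
      using e pos by (auto simp: d_def divide_simps mult_le_cancel_left) 
    obtain F where F: "norm (y - comb (seq y) F) < d" using l2_approx[OF d(1)] by blast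
    define y' where "y' = comb (seq y) F"
    have "e / 3 / (norm y' + 1) > 0" using e norm_ge_zero[of y'] by (intro divide_pos_pos) linarith+
    from l2_approx[OF this, of x] obtain G where G: "norm (x - comb (seq x) G) < e / 3 / (norm y' + 1)" by blast
    define x' where "x' = comb (seq x) G"
    have xx: "norm (x - x') * norm y' \<le> e / 3"
    proof -
      have "norm (x - x') * norm y' \<le> e / 3 / (norm y' + 1) * (norm y' + 1)"
        using G e by (intro mult_mono) (auto simp: x'_def)
      also have "\<dots> = e / 3"
      proof -
        have "norm y' + 1 \<noteq> 0" using norm_ge_zero[of y'] by linarith
        then show ?thesis by (rule nonzero_eq_divide_eq[THEN iffD1]) (rule refl)
      qed
      finally show ?thesis .
    qed
    have "\<forall>\<^sub>F t in at_top. dist (inner (flow (gen Dk) t x') y') 0 < e / 3"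
      using comb e unfolding x'_def y'_def by (intro tendstoD) auto
    then show "\<forall>\<^sub>F t in at_top. dist (inner (flow (gen Dk) t x) y) 0 < e"
    proof eventually_elim
      case (elim t)
      let ?U = "flow (gen Dk) t"
      have "inner (?U x) y = inner (?U x') y' + inner (?U (x - x')) y' + inner (?U x) (y - y')"
        by (simp add: flow_diff inner_diff_left inner_diff_right)
      moreover have "\<bar>inner (?U (x - x')) y'\<bar> \<le> e / 3"
        using Cauchy_Schwarz_ineq2[of "?U (x - x')" y'] xx by (simp add: norm_flow)
      moreover have "\<bar>inner (?U x) (y - y')\<bar> \<le> norm x * d"
        using Cauchy_Schwarz_ineq2[of "?U x" "y - y'"] mult_left_mono[OF less_imp_le[OF F], of "norm x"]
        by (simp add: norm_flow y'_def)
      ultimately show ?case using elim d(3) by (simp add: mult.commute)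
    qed
  qed
  moreover have "inner (flow (gen (ker (ereal a))) t x) (flow (gen (ker \<infinity>)) t y) = inner (flow (gen Dk) t x) y" for t
    using a by (intro inner_flow_two_kernels even_kernel_ker) (auto simp: Dk_def)
  ultimately show ?thesis by simp
qed

section \<open>From the equation to the scattering map and the separation of solutions\<close>

lemma nls_solution_flow_form:
  assumes \<alpha>: "\<alpha> > 0" and p: "p \<ge> 1" and u: "nls_solution \<mu> p \<alpha> f u"
  shows "(u has_vector_derivative gen (ker \<alpha>) (u t) + scaleC (- \<i> * of_real \<mu>) (nl p (u t))) (at t)"
proof -
  obtain u' where u': "(u has_vector_derivative u' t) (at t)"
    "\<And>n. \<i> * seq (u' t) n = seq (lap \<alpha> (u t)) n
          + of_real (\<mu> * cmod (seq (u t) n) powr (p - 1)) * seq (u t) n"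
    using u unfolding nls_solution_def by blast
  have "u' t = gen (ker \<alpha>) (u t) + scaleC (- \<i> * of_real \<mu>) (nl p (u t))"
  proof (rule l2_eqI)
    fix n
    have "seq (u' t) n = - \<i> * (\<i> * seq (u' t) n)" by simp
    also have "\<dots> = seq (gen (ker \<alpha>) (u t) + scaleC (- \<i> * of_real \<mu>) (nl p (u t))) n"
      unfolding u'(2) by (simp add: gen_def lap_eq_lapk[OF \<alpha>] plus_l2.rep_eq scaleC.rep_eq seq_nl[OF p] algebra_simps)
    finally show "seq (u' t) n = seq (gen (ker \<alpha>) (u t) + scaleC (- \<i> * of_real \<mu>) (nl p (u t))) n" .
  qed
  then show ?thesis using u'(1) by simp
qed

theorem theorem3p1:
  fixes \<mu> p :: real and u :: "ereal \<Rightarrow> l2 \<Rightarrow> real \<Rightarrow> l2"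
  assumes "\<mu> \<in> {1, -1}" and "p \<ge> 7"
    and u: "\<And>\<alpha> f. \<alpha> > 0 \<Longrightarrow> nls_solution \<mu> p \<alpha> f (u \<alpha> f)"
  shows "\<exists>\<alpha>\<^sub>0::real. \<alpha>\<^sub>0 > 0 \<and>
    (\<exists>\<delta>\<^sub>1>0. \<forall>\<alpha>>ereal \<alpha>\<^sub>0.
      (\<forall>f. norm f < \<delta>\<^sub>1 \<longrightarrow> (\<exists>!w. scatters_to \<alpha> (u \<alpha> f) w)) \<and>
      (\<exists>\<Phi> \<Psi>. homeomorphism (ball 0 \<delta>\<^sub>1) (ball 0 \<delta>\<^sub>1) \<Phi> \<Psi> \<and>
        (\<forall>f\<in>ball 0 \<delta>\<^sub>1. scatters_to \<alpha> (u \<alpha> f) (\<Phi> f) \<and> norm (\<Phi> f) = norm f))) \<and>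
    (\<exists>\<delta>\<^sub>2>0. \<exists>C::real. \<forall>f::l2.
      in_lq (5/4) (seq f) \<and> 0 < lq_norm (5/4) (seq f) \<and> lq_norm (5/4) (seq f) < \<delta>\<^sub>2 \<longrightarrow>
        (\<forall>\<alpha>>ereal \<alpha>\<^sub>0. \<forall>t.
          in_lq 5 (seq (u \<alpha> f t)) \<and>
          lq_norm 5 (seq (u \<alpha> f t)) \<le> C * (1 + \<bar>t\<bar>) powr (- 1/5) * lq_norm (5/4) (seq f)) \<and>
        0 < (INF a\<in>{\<alpha>\<^sub>0<..}. SUP t\<in>{0..}. ereal (norm (u (ereal a) f t - u \<infinity> f t))))"
proof -
  obtain D where disp: "\<And>\<alpha>. \<alpha> > 11 \<Longrightarrow> dispersive_kernel (ker \<alpha>) D"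
    using dispersive_kernel_ker by blast
  have D: "D \<ge> 1" using disp[of \<infinity>] by (simp add: dispersive_kernel_def dispersive_kernel_axioms_def)
  have \<mu>: "\<bar>\<mu>\<bar> = 1" using assms(1) by auto
  have p: "p \<ge> 7" "p \<ge> 1" using assms(2) by auto
  have pos: "\<alpha> > 0" if "\<alpha> > 11" for \<alpha> :: ereal
    using that by (rule less_trans[rotated]) simp
  have u0: "u \<alpha> f 0 = f" if "\<alpha> > 11" for \<alpha> f
    using u[OF pos[OF that], of f] by (simp add: nls_solution_def)
  have sol: "dispersive_kernel.solution (ker \<alpha>) \<mu> p (u \<alpha> f)" if "\<alpha> > 11" for \<alpha> f
    unfolding dispersive_kernel.solution_def[OF disp[OF that]]
    using nls_solution_flow_form[OF pos[OF that] p(2) u[OF pos[OF that]]] by blast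
  define E where "E = p * growth ^ 6 * (16 * sqrt D) ^ 6"
  have E: "E > 0" using p D by (auto simp: E_def growth_def)
  \<comment> \<open>As \<delta> \<le> 1, its sixth power is at most \<delta>, so a linear condition
    implies \<open>threshold\<close>; it involves D and p but not \<alpha>.\<close>
  define \<delta> where "\<delta> = min 1 (1 / (8 * E))"
  have \<delta>: "0 < \<delta>" "\<delta> \<le> 1" "\<delta> * E \<le> 1/8" using E by (auto simp: \<delta>_def min_def field_simps)
  have thr: "dispersive_kernel.threshold D p \<delta>" if "\<alpha> > 11" for \<alpha> :: ereal
    unfolding dispersive_kernel.threshold_def[OF disp[OF that]]
  proof (intro conjI \<delta>)
    have "p * growth ^ 6 * (16 * sqrt D * \<delta>) ^ 6 = E * \<delta> ^ 6"
      by (simp add: E_def power_mult_distrib)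
    also have "\<dots> \<le> E * \<delta>" using E \<delta> power_decreasing[of 1 6 \<delta>] by (intro mult_left_mono) auto
    finally show "p * growth ^ 6 * (16 * sqrt D * \<delta>) ^ 6 \<le> 1/8" using \<delta> by (simp add: mult.commute)
  qed
  define pr where "pr \<alpha> f = dispersive_kernel.profile (ker \<alpha>) (u \<alpha> f)" for \<alpha> f
  \<comment> \<open>The flow is isometric, so scattering is convergence of the profile.\<close>
  have prn: "norm (pr \<alpha> f t - w) = norm (u \<alpha> f t - propagator \<alpha> t w)" if "\<alpha> > 11" for \<alpha> f t w
  proof -
    interpret dispersive_kernel "ker \<alpha>" D by (rule disp[OF that])
    have "norm (u \<alpha> f t - propagator \<alpha> t w) = norm (flow (gen (ker \<alpha>)) (- t) (u \<alpha> f t - flow (gen (ker \<alpha>)) t w))"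
      by (simp add: norm_flow propagator_eq_flow pos[OF that])
    then show ?thesis by (simp add: flow_diff pr_def profile_def)
  qed
  have scat: "scatters_to \<alpha> (u \<alpha> f) w \<longleftrightarrow> (pr \<alpha> f \<longlongrightarrow> w) at_top" if "\<alpha> > 11" for \<alpha> f w
    unfolding scatters_to_def prn[OF that, symmetric] by (simp add: LIM_zero_iff tendsto_norm_zero_iff)
  \<comment> \<open>A selected limit, meaningful for norms up to \<delta>, where one exists.\<close>
  define \<Phi> where "\<Phi> \<alpha> f = (SOME w. (pr \<alpha> f \<longlongrightarrow> w) at_top)" for \<alpha> f
  have \<Phi>: "(pr \<alpha> f \<longlongrightarrow> \<Phi> \<alpha> f) at_top" if "\<alpha> > 11" "norm f \<le> \<delta>" for \<alpha> f
  proof -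
    have "\<exists>w. (pr \<alpha> f \<longlongrightarrow> w) at_top"
      unfolding pr_def using that u0[OF that(1)]
      by (intro dispersive_kernel.profile_convergent[OF disp sol \<mu> p(1) thr]) auto
    then show ?thesis unfolding \<Phi>_def by (rule someI_ex)
  qed
  have un: "norm (u \<alpha> f t) = norm f" if "\<alpha> > 11" for \<alpha> f t
    using dispersive_kernel.solution_norm[OF disp[OF that] sol[OF that] p(2)] u0[OF that] by simp
  have pn: "norm (pr \<alpha> f t) = norm f" if "\<alpha> > 11" for \<alpha> f t
    using dispersive_kernel.norm_profile[OF disp[OF that]] un[OF that] by (simp add: pr_def)
  have \<Phi>n: "norm (\<Phi> \<alpha> f) = norm f" if "\<alpha> > 11" "norm f \<le> \<delta>" for \<alpha> f
    using tendsto_unique[OF _ tendsto_norm[OF \<Phi>[OF that]]] pn[OF that(1)] by simp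
  have near: "norm ((\<Phi> \<alpha> f - \<Phi> \<alpha> g) - (f - g)) \<le> 1/3 * norm (f - g)"
    if "\<alpha> > 11" "norm f \<le> \<delta>" "norm g \<le> \<delta>" for \<alpha> f g
  proof (rule tendsto_upperbound)
    show "((\<lambda>t. norm ((pr \<alpha> f t - pr \<alpha> g t) - (f - g))) \<longlongrightarrow> norm ((\<Phi> \<alpha> f - \<Phi> \<alpha> g) - (f - g))) at_top"
      by (intro tendsto_intros \<Phi> that)
    show "\<forall>\<^sub>F t in at_top. norm ((pr \<alpha> f t - pr \<alpha> g t) - (f - g)) \<le> 1/3 * norm (f - g)"
      using eventually_ge_at_top[of 0]
    proof eventually_elim
      case (elim t)
      then show ?case
        using dispersive_kernel.profile_near_identity[OF disp[OF that(1)] sol[OF that(1)] sol[OF that(1)] \<mu> p(1) thr[OF that(1)], of f g t]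
          u0[OF that(1)] that by (simp add: pr_def)
    qed
  qed simp
  \<comment> \<open>Half the radius, as in \<open>near_identity_homeomorphism\<close>.\<close>
  define \<delta>1 where "\<delta>1 = \<delta> / 2"
  have \<delta>1: "\<delta>1 > 0" "\<delta>1 \<le> \<delta>" using \<delta> by (auto simp: \<delta>1_def)
  have part1: "(\<forall>f. norm f < \<delta>1 \<longrightarrow> (\<exists>!w. scatters_to \<alpha> (u \<alpha> f) w)) \<and>
      (\<exists>\<Phi> \<Psi>. homeomorphism (ball 0 \<delta>1) (ball 0 \<delta>1) \<Phi> \<Psi> \<and>
        (\<forall>f\<in>ball 0 \<delta>1. scatters_to \<alpha> (u \<alpha> f) (\<Phi> f) \<and> norm (\<Phi> f) = norm f))"
    if \<alpha>: "\<alpha> > 11" for \<alpha>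
  proof (intro conjI allI impI)
    fix f :: l2 assume "norm f < \<delta>1"
    then have f: "norm f \<le> \<delta>" using \<delta>1 by simp
    show "\<exists>!w. scatters_to \<alpha> (u \<alpha> f) w"
    proof (rule ex1I)
      show "scatters_to \<alpha> (u \<alpha> f) (\<Phi> \<alpha> f)" unfolding scat[OF \<alpha>] by (rule \<Phi>[OF \<alpha> f])
      fix w assume "scatters_to \<alpha> (u \<alpha> f) w"
      then have "(pr \<alpha> f \<longlongrightarrow> w) at_top" unfolding scat[OF \<alpha>] .
      then show "w = \<Phi> \<alpha> f" using tendsto_unique[OF _ _ \<Phi>[OF \<alpha> f]] by simp
    qed
  next
    obtain \<Psi> where "homeomorphism (ball 0 \<delta>1) (ball 0 \<delta>1) (\<Phi> \<alpha>) \<Psi>"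
      using near_identity_homeomorphism[OF \<delta>(1) near[OF \<alpha>] \<Phi>n[OF \<alpha>]] unfolding \<delta>1_def by blast
    moreover have "scatters_to \<alpha> (u \<alpha> f) (\<Phi> \<alpha> f) \<and> norm (\<Phi> \<alpha> f) = norm f" if "f \<in> ball 0 \<delta>1" for f
      unfolding scat[OF \<alpha>] using \<Phi>[OF \<alpha>] \<Phi>n[OF \<alpha>] that \<delta>1 by simp
    ultimately show "\<exists>\<Phi> \<Psi>. homeomorphism (ball 0 \<delta>1) (ball 0 \<delta>1) \<Phi> \<Psi> \<and>
        (\<forall>f\<in>ball 0 \<delta>1. scatters_to \<alpha> (u \<alpha> f) (\<Phi> f) \<and> norm (\<Phi> f) = norm f)" by blast
  qed
  \<comment> \<open>The first bound makes the asymptotic states available, because the l2 norm is at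
    most the l5/4 norm; the second is the smallness required by \<open>l5_decay\<close>.\<close>
  define \<delta>2 where "\<delta>2 = min \<delta>1 (1 / (5600 * D\<^sup>2))"
  have \<delta>2: "\<delta>2 > 0" using \<delta>1 D by (simp add: \<delta>2_def)
  have decay: "lq_norm 5 (seq (u \<alpha> f t)) \<le> (20 * D) * (1 + \<bar>t\<bar>) powr (- 1/5) * lq_norm (5/4) (seq f)"
    if f: "in_lq (5/4) (seq f)" "0 < lq_norm (5/4) (seq f)" "lq_norm (5/4) (seq f) < \<delta>2" and \<alpha>: "\<alpha> > 11" for f \<alpha> t
  proof -
    interpret dispersive_kernel "ker \<alpha>" D by (rule disp[OF \<alpha>])
    have "lq_norm (5/4) (seq f) \<le> 1 / (5600 * D\<^sup>2)" using f(3) by (simp add: \<delta>2_def)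
    then have sm: "5600 * D\<^sup>2 * lq_norm (5/4) (seq f) \<le> 1" using D by (simp add: field_simps)
    have c: "cmod (- \<i> * of_real \<mu>) = 1" using \<mu> by (simp add: norm_mult)
    have p4: "p \<ge> 4" using p by simp
    have d: "(u \<alpha> f has_vector_derivative gen (ker \<alpha>) (u \<alpha> f t) + scaleC (- \<i> * of_real \<mu>) (nl p (u \<alpha> f t))) (at t)" for t
      using sol[OF \<alpha>] by (simp add: solution_def)
    show ?thesis
      using l5_decay[OF d nl_l54[OF p4 c] p(1), of t] f sm u0[OF \<alpha>] by simp
  qed
  \<comment> \<open>The lower bound is the same for every a, and this is what passes to the infimum;
    only the time at which it is reached depends on a.\<close>
  have separate: "ereal (norm f) \<le> (SUP t\<in>{0..}. ereal (norm (u (ereal a) f t - u \<infinity> f t)))"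
    if f: "0 < norm f" "norm f \<le> \<delta>" and a: "a > 11" for f a
  proof -
    have a': "ereal a > 11" "(\<infinity>::ereal) > 11" using a by auto
    interpret A: dispersive_kernel "ker (ereal a)" D by (rule disp[OF a'(1)])
    interpret I: dispersive_kernel "ker \<infinity>" D by (rule disp[OF a'(2)])
    define x y where "x = \<Phi> (ereal a) f" and "y = \<Phi> \<infinity> f"
    let ?x = "\<lambda>t. flow (gen (ker (ereal a))) t x" and ?y = "\<lambda>t. flow (gen (ker \<infinity>)) t y"
    let ?u = "\<lambda>t. u (ereal a) f t" and ?v = "\<lambda>t. u \<infinity> f t"
    have "((\<lambda>t. norm (?u t - ?x t)) \<longlongrightarrow> 0) at_top"
      using \<Phi>[OF a'(1) f(2)] unfolding scat[OF a'(1), symmetric] scatters_to_def x_def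
      by (simp add: propagator_eq_flow[OF pos[OF a'(1)]])
    moreover have "((\<lambda>t. norm (?v t - ?y t)) \<longlongrightarrow> 0) at_top"
      using \<Phi>[OF a'(2) f(2)] unfolding scat[OF a'(2), symmetric] scatters_to_def y_def
      by (simp add: propagator_eq_flow[OF pos[OF a'(2)]])
    moreover have "((\<lambda>t. inner (?x t) (?y t)) \<longlongrightarrow> 0) at_top"
      by (rule linear_flows_decouple[OF a])
    ultimately have "((\<lambda>t. norm (?u t - ?x t) * norm f + norm x * norm (?v t - ?y t)
        + \<bar>inner (?x t) (?y t)\<bar>) \<longlongrightarrow> 0 * norm f + norm x * 0 + \<bar>0\<bar>) at_top"
      by (intro tendsto_intros)
    moreover have "0 * norm f + norm x * 0 + \<bar>0\<bar> < (norm f)\<^sup>2 / 2" using f by simp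
    ultimately have "\<forall>\<^sub>F t in at_top. norm (?u t - ?x t) * norm f + norm x * norm (?v t - ?y t)
        + \<bar>inner (?x t) (?y t)\<bar> < (norm f)\<^sup>2 / 2"
      by (rule order_tendstoD(2))
    from eventually_happens[OF eventually_conj[OF this eventually_ge_at_top[of 0]]]
    obtain t where t: "0 \<le> t" "norm (?u t - ?x t) * norm f + norm x * norm (?v t - ?y t)
        + \<bar>inner (?x t) (?y t)\<bar> < (norm f)\<^sup>2 / 2" by auto
    \<comment> \<open>Replacing the solutions by their asymptotic free evolutions one at a time
      bounds their inner product by half of the squared norm of f. Both have the norm of f, so their
      distance is then at least that norm.\<close>
    have "inner (?u t) (?v t) = inner (?u t - ?x t) (?v t) + inner (?x t) (?v t - ?y t) + inner (?x t) (?y t)"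
      by (simp add: inner_diff_left inner_diff_right)
    moreover have "inner (?u t - ?x t) (?v t) \<le> norm (?u t - ?x t) * norm f"
      using norm_cauchy_schwarz[of "?u t - ?x t" "?v t"] un[OF a'(2)] by simp
    moreover have "inner (?x t) (?v t - ?y t) \<le> norm x * norm (?v t - ?y t)"
      using norm_cauchy_schwarz[of "?x t" "?v t - ?y t"] by (simp add: A.norm_flow)
    ultimately have "inner (?u t) (?v t) \<le> (norm f)\<^sup>2 / 2" using t(2) by linarith
    moreover have "(norm (?u t - ?v t))\<^sup>2 = 2 * (norm f)\<^sup>2 - 2 * inner (?u t) (?v t)"
      using dot_norm_neg[of "?u t" "?v t"] un[OF a'(1)] un[OF a'(2)] by simp
    ultimately have "(norm f)\<^sup>2 \<le> (norm (?u t - ?v t))\<^sup>2" by simp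
    then have "norm f \<le> norm (?u t - ?v t)" by (rule power2_le_imp_le) simp
    then show ?thesis using t(1) by (intro SUP_upper2[of t]) auto
  qed
  show ?thesis
  proof (rule exI[of _ "11::real"], intro conjI)
    show "\<exists>\<delta>\<^sub>1>0. \<forall>\<alpha>>ereal 11.
      (\<forall>f. norm f < \<delta>\<^sub>1 \<longrightarrow> (\<exists>!w. scatters_to \<alpha> (u \<alpha> f) w)) \<and>
      (\<exists>\<Phi> \<Psi>. homeomorphism (ball 0 \<delta>\<^sub>1) (ball 0 \<delta>\<^sub>1) \<Phi> \<Psi> \<and>
        (\<forall>f\<in>ball 0 \<delta>\<^sub>1. scatters_to \<alpha> (u \<alpha> f) (\<Phi> f) \<and> norm (\<Phi> f) = norm f))"
      using \<delta>1(1) part1 by (intro exI[of _ \<delta>1]) simp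
    show "\<exists>\<delta>\<^sub>2>0. \<exists>C::real. \<forall>f::l2.
      in_lq (5/4) (seq f) \<and> 0 < lq_norm (5/4) (seq f) \<and> lq_norm (5/4) (seq f) < \<delta>\<^sub>2 \<longrightarrow>
        (\<forall>\<alpha>>ereal 11. \<forall>t.
          in_lq 5 (seq (u \<alpha> f t)) \<and>
          lq_norm 5 (seq (u \<alpha> f t)) \<le> C * (1 + \<bar>t\<bar>) powr (- 1/5) * lq_norm (5/4) (seq f)) \<and>
        0 < (INF a\<in>{11<..}. SUP t\<in>{0..}. ereal (norm (u (ereal a) f t - u \<infinity> f t)))"
    proof (rule exI[of _ \<delta>2], rule conjI, rule \<delta>2, rule exI[of _ "20 * D"], intro conjI allI impI)
      fix f :: l2
      assume "in_lq (5/4) (seq f) \<and> 0 < lq_norm (5/4) (seq f) \<and> lq_norm (5/4) (seq f) < \<delta>2"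
      then have f: "in_lq (5/4) (seq f)" "0 < lq_norm (5/4) (seq f)" "lq_norm (5/4) (seq f) < \<delta>2" by auto
      show "in_lq 5 (seq (u \<alpha> f t))" for \<alpha> t by (rule in_l5_seq)
      show "lq_norm 5 (seq (u \<alpha> f t)) \<le> 20 * D * (1 + \<bar>t\<bar>) powr (- 1/5) * lq_norm (5/4) (seq f)"
        if "\<alpha> > ereal 11" for \<alpha> t using decay[OF f] that by simp
      have "f \<noteq> 0"
      proof
        assume "f = 0"
        then show False using f(2) by (simp add: lq_norm_def zero_l2.rep_eq)
      qed
      then have nf: "0 < norm f" by simp
      have "norm f \<le> lq_norm (5/4) (seq f)"
        unfolding norm_l2_def by (rule lq_norm_mono(2)[OF f(1)]) auto
      then have "norm f \<le> \<delta>" using f(3) \<delta>1 by (simp add: \<delta>2_def)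
      then have "ereal (norm f) \<le> (INF a\<in>{11<..}. SUP t\<in>{0..}. ereal (norm (u (ereal a) f t - u \<infinity> f t)))"
        by (intro INF_greatest separate nf) auto
      then show "0 < (INF a\<in>{11<..}. SUP t\<in>{0..}. ereal (norm (u (ereal a) f t - u \<infinity> f t)))"
        using nf by (meson ereal_less(2) less_le_trans)
    qed
  qed simp
qed

end
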